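(* Let $L$, $K$ be étale $k$-algebras of dimensions $3$, $2$ respectively, and let $(E,\tau)=(L\otimes_k K,1\otimes\bar{\ })$. There exists a surjective map from $H^1(k,\mathbf{SU}(E,\tau))$ to the set of $L$-isomorphism classes of étale Tits process algebras arising from $(L,K)$.
   Context: $k$ is a field of characteristic different from $2$ and $3$; $\bar{\ }$ is the non-trivial $k$-automorphism of $K$; $L$, $K$ need not be fields; $L$ is identified with $E^\tau=\{x\in E:\tau(x)=x\}$. $\mathbf{SU}(E,\tau)$ is the $k$-torus with $\mathbf{SU}(E,\tau)(R)=\{x\in E\otimes_k R : x\tau(x)=1,\ N_{E/K}(x)=1\}$. A pair $(u,\mu)\in L^*\times K^*$ is admissible if $N_{L/k}(u)=N_{K/k}(\mu)=\mu\overline\mu$. For an admissible pair, the étale Tits process algebra $J(E,\tau,u,\mu)$ is the $9$-dimensional Jordan algebra of degree $3$ on the vector space $L\oplus E$ with unit $1=(1,0)$, cubic norm $$N(a,b)=N_{L/k}(a)+\mu N_{E/K}(b)+\overline{\mu N_{E/K}(b)}-T_{L/k}(a\,b\,u\,\tau(b)),$$ adjoint $(a,b)^\#=(a^\#-b u\tau(b),\ \overline\mu\,\tau(b)^\#u^{-1}-ab)$ and trace $T(a,b)=T_{L/k}(a)$; here $^\#$ on $L$ and $E$ is the usual adjoint, characterized as the quadratic map with $xx^\#=N_{L/k}(x)$, resp. $xx^\#=N_{E/K}(x)$, and the Jordan product is the bilinearization of $x^2=x^\#+T(x)x-T(x^\#)1$. It contains $L=\{(l,0):l\in L\}$ as a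 subalgebra. The étale Tits process algebras arising from $(L,K)$ are the algebras $J(E,\tau,u,\mu)$, $(u,\mu)$ admissible. Two such algebras $J_1,J_2$ are $L$-isomorphic if there exists a $k$-algebra isomorphism $J_1\to J_2$ which restricts to the subalgebra $L$ of $J_1$ and $J_2$, i.e. maps $L\subset J_1$ onto $L\subset J_2$ (not necessarily as the identity). *)

theory Defs
  imports
    "HOL-Library.FuncSet"
    "HOL-Library.Product_Plus"
    "HOL-Computational_Algebra.Polynomial"
    "Jordan_Normal_Form.Determinant"
begin

section \<open>Commutative algebras\<close>

text \<open>
  A commutative algebra \<open>A\<close> over a commutative ring \<open>R\<close> is given by its structure homomorphism
  \<open>f :: R \<Rightarrow> A\<close>. Neither \<open>R\<close> nor \<open>A\<close> has to be a field.
\<close>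

abbreviation alg_scale :: "('r::comm_ring_1 \<Rightarrow> 'a::comm_ring_1) \<Rightarrow> 'r \<Rightarrow> 'a \<Rightarrow> 'a"
  where "alg_scale f \<equiv> (\<lambda>c x. f c * x)"

definition alg_dim :: "('k::field \<Rightarrow> 'a::comm_ring_1) \<Rightarrow> nat"
  where "alg_dim f = vector_space.dim (alg_scale f) UNIV"

definition alg_automorphism :: "('r::comm_ring_1 \<Rightarrow> 'a::comm_ring_1) \<Rightarrow> ('a \<Rightarrow> 'a) \<Rightarrow> bool"
  where "alg_automorphism f \<sigma> \<longleftrightarrow> comm_ring_hom \<sigma> \<and> bij \<sigma> \<and> (\<forall>c. \<sigma> (f c) = f c)"

definition unit_inv :: "'a::comm_ring_1 \<Rightarrow> 'a"
  where "unit_inv x = (THE y. x * y = 1)"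


subsection \<open>Separable polynomials, etale algebras, separable closures\<close>

definition separable_poly :: "'k::field poly \<Rightarrow> bool"
  where "separable_poly p \<longleftrightarrow> coprime p (pderiv p)"

text \<open>
  An etale algebra over a field is a finite direct product of finite separable field extensions.
  The decomposition is expressed internally: \<open>I\<close> is the set of the identity elements of the factors,
  and the factor belonging to \<open>e \<in> I\<close> is the ideal \<open>e A\<close>, a ring with unit element \<open>e\<close>. An element
  of an extension field is separable if it is a root of a separable polynomial over the base field;
  the value of \<open>p\<close> at \<open>e x\<close> in the factor \<open>e A\<close> is \<open>e p(x)\<close>.
\<close>

definition etale_algebra :: "('k::field \<Rightarrow> 'a::comm_ring_1) \<Rightarrow> bool"
  where "etale_algebra f \<longleftrightarrow>
    comm_ring_hom f \<and>
    (\<exists>B. finite B \<and> module.span (alg_scale f) B = UNIV) \<and>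
    (\<exists>I. finite I \<and> (\<Sum>e\<in>I. e) = 1 \<and>
      (\<forall>e\<in>I. e \<noteq> 0 \<and> e * e = e) \<and>
      (\<forall>e\<in>I. \<forall>e'\<in>I. e \<noteq> e' \<longrightarrow> e * e' = 0) \<and>
      (\<forall>e\<in>I. \<forall>x. e * x \<noteq> 0 \<longrightarrow> (\<exists>y. (e * x) * (e * y) = e)) \<and>
      (\<forall>e\<in>I. \<forall>x. \<exists>p. separable_poly p \<and> e * poly (map_poly f p) x = 0))"

definition separable_closure :: "('k::field \<Rightarrow> 's::field) \<Rightarrow> bool"
  where "separable_closure f \<longleftrightarrow>
    comm_ring_hom f \<and>
    (\<forall>x. \<exists>p. separable_poly p \<and> poly (map_poly f p) x = 0) \<and>
    (\<forall>p :: 's poly. separable_poly p \<and> degree p > 0 \<longrightarrow> (\<exists>x. poly p x = 0))"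


subsection \<open>Norm, trace and adjoint\<close>

definition alg_basis :: "('r::comm_ring_1 \<Rightarrow> 'a::comm_ring_1) \<Rightarrow> 'a list \<Rightarrow> bool"
  where "alg_basis f bs \<longleftrightarrow> distinct bs \<and>
    \<not> module.dependent (alg_scale f) (set bs) \<and> module.span (alg_scale f) (set bs) = UNIV"

definition mult_matrix :: "('r::comm_ring_1 \<Rightarrow> 'a::comm_ring_1) \<Rightarrow> 'a list \<Rightarrow> 'a \<Rightarrow> 'r mat"
  where "mult_matrix f bs x = Matrix.mat (length bs) (length bs)
    (\<lambda>(i, j). module.representation (alg_scale f) (set bs) (x * bs ! j) (bs ! i))"

text \<open>
  Norm and trace of an algebra which is free of finite rank as a module: determinant and trace of
  multiplication by an element, with respect to an arbitrarily chosen basis.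
\<close>

definition alg_norm :: "('r::comm_ring_1 \<Rightarrow> 'a::comm_ring_1) \<Rightarrow> 'a \<Rightarrow> 'r"
  where "alg_norm f x = Determinant.det (mult_matrix f (SOME bs. alg_basis f bs) x)"

definition alg_trace :: "('r::comm_ring_1 \<Rightarrow> 'a::comm_ring_1) \<Rightarrow> 'a \<Rightarrow> 'r"
  where "alg_trace f x =
    (let bs = (SOME bs. alg_basis f bs) in \<Sum>i<length bs. mult_matrix f bs x $$ (i, i))"

definition quadratic_map :: "('r::comm_ring_1 \<Rightarrow> 'a::comm_ring_1) \<Rightarrow> ('a \<Rightarrow> 'a) \<Rightarrow> bool"
  where "quadratic_map f q \<longleftrightarrow>
    (\<forall>c x. q (f c * x) = f (c ^ 2) * q x) \<and>
    (\<forall>y. module_hom (alg_scale f) (alg_scale f) (\<lambda>x. q (x + y) - q x - q y)) \<and>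
    (\<forall>x. module_hom (alg_scale f) (alg_scale f) (\<lambda>y. q (x + y) - q x - q y))"

definition alg_adjoint :: "('r::comm_ring_1 \<Rightarrow> 'a::comm_ring_1) \<Rightarrow> 'a \<Rightarrow> 'a"
  where "alg_adjoint f = (THE q. quadratic_map f q \<and> (\<forall>x. x * q x = f (alg_norm f x)))"


subsection \<open>Tensor products\<close>

text \<open>
  \<open>is_tensor_product f g i j\<close>: the algebra \<open>T\<close> with the \<open>k\<close>-algebra homomorphisms
  \<open>i :: A \<Rightarrow> T\<close>, \<open>a \<mapsto> a \<otimes> 1\<close>, and \<open>j :: B \<Rightarrow> T\<close>, \<open>b \<mapsto> 1 \<otimes> b\<close>, is a tensor product over the field \<open>k\<close> of
  the algebras \<open>f :: k \<Rightarrow> A\<close> and \<open>g :: k \<Rightarrow> B\<close>, i.e. \<open>(a, b) \<mapsto> i a * j b\<close> is a universal bilinear map.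
  A definition cannot quantify over all target types, so the universal property is required for
  bilinear maps with values in \<open>k\<close>. As \<open>k\<close> is a field, the universal property for bilinear maps to
  arbitrary vector spaces follows: see \<open>tensor_product_universal\<close>.
\<close>

definition alg_bilinear ::
  "('k::field \<Rightarrow> 'a::comm_ring_1) \<Rightarrow> ('k \<Rightarrow> 'b::comm_ring_1) \<Rightarrow> ('k \<Rightarrow> 'v \<Rightarrow> 'v::ab_group_add)
    \<Rightarrow> ('a \<Rightarrow> 'b \<Rightarrow> 'v) \<Rightarrow> bool"
  where "alg_bilinear f g s \<beta> \<longleftrightarrow>
    (\<forall>b. module_hom (alg_scale f) s (\<lambda>a. \<beta> a b)) \<and> (\<forall>a. module_hom (alg_scale g) s (\<lambda>b. \<beta> a b))"

definition is_tensor_product ::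
  "('k::field \<Rightarrow> 'a::comm_ring_1) \<Rightarrow> ('k \<Rightarrow> 'b::comm_ring_1)
    \<Rightarrow> ('a \<Rightarrow> 't::comm_ring_1) \<Rightarrow> ('b \<Rightarrow> 't) \<Rightarrow> bool"
  where "is_tensor_product f g i j \<longleftrightarrow>
    comm_ring_hom f \<and> comm_ring_hom g \<and> comm_ring_hom i \<and> comm_ring_hom j \<and>
    (\<forall>c. i (f c) = j (g c)) \<and>
    (\<forall>\<beta>. alg_bilinear f g (*) \<beta> \<longrightarrow>
      (\<exists>!h. module_hom (alg_scale (i \<circ> f)) (*) h \<and> (\<forall>a b. h (i a * j b) = \<beta> a b)))"

text \<open>
  The algebra homomorphism \<open>\<phi> \<otimes> \<psi>\<close> between the tensor products given by \<open>i, j\<close> and by \<open>i', j'\<close>.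
\<close>

definition tensor_map ::
  "('a \<Rightarrow> 't::comm_ring_1) \<Rightarrow> ('b \<Rightarrow> 't) \<Rightarrow> ('c \<Rightarrow> 'u::comm_ring_1) \<Rightarrow> ('d \<Rightarrow> 'u)
    \<Rightarrow> ('a \<Rightarrow> 'c) \<Rightarrow> ('b \<Rightarrow> 'd) \<Rightarrow> 't \<Rightarrow> 'u"
  where "tensor_map i j i' j' \<phi> \<psi> =
    (THE h. comm_ring_hom h \<and> (\<forall>a b. h (i a * j b) = i' (\<phi> a) * j' (\<psi> b)))"

lemma vector_space_alg_scale:
  assumes "comm_ring_hom (f :: 'k::field \<Rightarrow> 'a::comm_ring_1)"
  shows "vector_space (alg_scale f)"
proof -
  interpret comm_ring_hom f by fact
  show ?thesis
    by unfold_locales (auto simp: algebra_simps hom_add hom_mult)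
qed

lemma vector_space_field: "vector_space ((*) :: 'k::field \<Rightarrow> 'k \<Rightarrow> 'k)"
  by unfold_locales (auto simp: algebra_simps)

lemma ex_functional:
  assumes "vector_space (s :: 'k::field \<Rightarrow> 'v::ab_group_add \<Rightarrow> 'v)"
    and "v \<notin> module.span s S"
  shows "\<exists>h. module_hom s (*) h \<and> (\<forall>x\<in>S. h x = 0) \<and> h v \<noteq> (0::'k)"
proof -
  interpret V: vector_space s by fact
  interpret k: vector_space "(*) :: 'k \<Rightarrow> 'k \<Rightarrow> 'k" by (rule vector_space_field)
  interpret P: vector_space_pair s "(*) :: 'k \<Rightarrow> 'k \<Rightarrow> 'k" ..
  obtain B where B: "B \<subseteq> S" "V.independent B" "S \<subseteq> V.span B" "card B = V.dim S"
    by (rule V.basis_exists)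
  have vB: "v \<notin> V.span B"
    using assms(2) B(1) V.span_mono by blast
  hence ind: "V.independent (insert v B)" and vB': "v \<notin> B"
    using B(2) V.independent_insert V.span_base by auto
  define h where "h = P.construct (insert v B) (\<lambda>x. if x = v then 1 else 0)"
  have lin: "Vector_Spaces.linear s (*) h"
    unfolding h_def by (rule P.linear_construct[OF ind])
  have h: "h x = (if x = v then 1 else 0)" if "x \<in> insert v B" for x
    unfolding h_def by (rule P.construct_basis[OF ind that])
  have mh: "module_hom s (*) h"
    using lin by (simp add: Vector_Spaces.linear_def)
  have "h x = 0" if "x \<in> S" for x
  proof (rule module_hom.eq_0_on_span[OF mh])
    show "x \<in> V.span B" using B(3) that by blast
  qed (use h vB' in auto)
  thus ?thesis using mh h[of v] by auto
qed

lemma sum_scale_relation: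
  assumes "vector_space (s :: 'k::field \<Rightarrow> 'v::ab_group_add \<Rightarrow> 'v)"
    and F: "finite F" and r: "\<And>x. x \<in> F \<Longrightarrow> pure (r x) = x"
  shows "(\<Sum>p\<in>insert q (r ` F). s ((if p \<in> r ` F then c (pure p) else 0) - (if p = q then 1 else 0)) (w p))
    = (\<Sum>x\<in>F. s (c x) (w (r x))) - w q"
proof -
  interpret X: vector_space s by fact
  let ?G = "insert q (r ` F)"
  have rinj: "inj_on r F"
    by (rule inj_on_inverseI[of _ pure]) (rule r)
  have "(\<Sum>p\<in>?G. s ((if p \<in> r ` F then c (pure p) else 0) - (if p = q then 1 else 0)) (w p)) =
      (\<Sum>p\<in>?G. if p \<in> r ` F then s (c (pure p)) (w p) else 0) - (\<Sum>p\<in>?G. if p = q then w p else 0)"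
    unfolding sum_subtractf[symmetric]
    by (intro sum.cong) (auto simp: X.scale_left_diff_distrib)
  also have "(\<Sum>p\<in>?G. if p = q then w p else 0) = w q"
    using F by (simp add: sum.delta)
  also have "(\<Sum>p\<in>?G. if p \<in> r ` F then s (c (pure p)) (w p) else 0)
      = (\<Sum>p\<in>r ` F. s (c (pure p)) (w p))"
    using F by (intro sum.mono_neutral_cong_right) auto
  also have "\<dots> = (\<Sum>x\<in>F. s (c x) (w (r x)))"
    using rinj r by (simp add: sum.reindex)
  finally show ?thesis .
qed

lemma ex1_unique: "\<exists>!x. P x \<Longrightarrow> P a \<Longrightarrow> P b \<Longrightarrow> a = b"
  by blast

lemma ex1_linear_extension:
  assumes t: "vector_space (t :: 'k::field \<Rightarrow> 't::ab_group_add \<Rightarrow> 't)"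
    and s: "vector_space (s :: 'k \<Rightarrow> 'v::ab_group_add \<Rightarrow> 'v)"
    and uniq: "\<And>h. module_hom t (*) h \<Longrightarrow> \<forall>p. h (pure p) = (0::'k) \<Longrightarrow> h = (\<lambda>_. 0)"
    and ext: "\<And>\<phi>. module_hom s (*) \<phi> \<Longrightarrow> \<exists>h. module_hom t (*) h \<and> (\<forall>p. h (pure p) = (\<phi> (\<beta> p) :: 'k))"
  shows "\<exists>!h. module_hom t s h \<and> (\<forall>p. h (pure p) = \<beta> p)"
proof -
  interpret T: vector_space t by fact
  interpret X: vector_space s by fact
  interpret P: vector_space_pair t s ..
  have span: "T.span (range pure) = UNIV"
  proof (rule ccontr)
    assume "T.span (range pure) \<noteq> UNIV"
    then obtain v where "v \<notin> T.span (range pure)" by blast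
    from ex_functional[OF t this] obtain h :: "'t \<Rightarrow> 'k"
      where h: "module_hom t (*) h" "\<forall>x\<in>range pure. h x = 0" "h v \<noteq> 0" by blast
    have "h = (\<lambda>_. 0)" using h(1,2) by (intro uniq) auto
    thus False using h(3) by simp
  qed
  have key: "(\<Sum>p\<in>F. s (c p) (\<beta> p)) = 0"
    if F: "finite F" and 0: "(\<Sum>p\<in>F. t (c p) (pure p)) = 0" for F c
  proof (rule ccontr)
    assume "(\<Sum>p\<in>F. s (c p) (\<beta> p)) \<noteq> 0" (is "?z \<noteq> 0")
    hence "?z \<notin> X.span {}" by simp
    from ex_functional[OF s this] obtain \<phi> :: "'v \<Rightarrow> 'k" where
      \<phi>: "module_hom s (*) \<phi>" "\<phi> ?z \<noteq> 0" by blast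
    interpret \<phi>: module_hom s "(*)" \<phi> by fact
    from ext[OF \<phi>(1)] obtain h where h: "module_hom t (*) h" "\<And>p. h (pure p) = \<phi> (\<beta> p)"
      by blast
    interpret h: module_hom t "(*)" h by fact
    have "\<phi> ?z = h (\<Sum>p\<in>F. t (c p) (pure p))"
      by (simp add: \<phi>.sum \<phi>.scale h.sum h.scale h(2))
    thus False using \<phi>(2) 0 by (simp add: h.zero)
  qed
  obtain B where B: "B \<subseteq> range pure" "T.independent B" "range pure \<subseteq> T.span B"
    by (rule T.basis_exists)
  have UB: "T.span B = UNIV"
    using span T.span_minimal[OF B(3) T.subspace_span] by blast
  define r where "r = inv_into UNIV pure"
  have r: "pure (r b) = b" if "b \<in> B" for b
    using that B(1) unfolding r_def by (metis f_inv_into_f subsetD)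
  define h where "h = P.construct B (\<lambda>b. \<beta> (r b))"
  have lin: "Vector_Spaces.linear t s h"
    unfolding h_def by (rule P.linear_construct[OF B(2)])
  hence mh: "module_hom t s h" by (simp add: Vector_Spaces.linear_def)
  interpret h: module_hom t s h by fact
  have hB: "h b = \<beta> (r b)" if "b \<in> B" for b
    unfolding h_def by (rule P.construct_basis[OF B(2) that])
  have hp: "h (pure q) = \<beta> q" for q
  proof -
    have "pure q \<in> T.span B" using UB by simp
    then obtain F c where F: "finite F" "F \<subseteq> B" "pure q = (\<Sum>x\<in>F. t (c x) x)"
      unfolding T.span_explicit by blast
    have rF: "\<And>x. x \<in> F \<Longrightarrow> pure (r x) = x" using r F(2) by blast
    have "(\<Sum>x\<in>F. t (c x) (pure (r x))) = pure q"
      using F(3) rF by simp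
    hence "(\<Sum>p\<in>insert q (r ` F).
        t ((if p \<in> r ` F then c (pure p) else 0) - (if p = q then 1 else 0)) (pure p)) = 0"
      by (subst sum_scale_relation[where pure = pure and r = r and F = F, OF t F(1)]) (auto simp: rF)
    hence "(\<Sum>p\<in>insert q (r ` F).
        s ((if p \<in> r ` F then c (pure p) else 0) - (if p = q then 1 else 0)) (\<beta> p)) = 0"
      by (rule key[rotated]) (simp add: F(1))
    hence "(\<Sum>x\<in>F. s (c x) (\<beta> (r x))) - \<beta> q = 0"
      by (subst (asm) sum_scale_relation[where pure = pure and r = r and F = F, OF s F(1)]) (auto simp: rF)
    moreover have "h (pure q) = (\<Sum>x\<in>F. s (c x) (\<beta> (r x)))"
      unfolding F(3) h.sum using F(2) by (intro sum.cong) (auto simp: h.scale hB)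
    ultimately show ?thesis by simp
  qed
  show ?thesis
  proof (rule ex1I)
    show "module_hom t s h \<and> (\<forall>p. h (pure p) = \<beta> p)" using mh hp by blast
    fix h' assume h': "module_hom t s h' \<and> (\<forall>p. h' (pure p) = \<beta> p)"
    show "h' = h"
    proof
      fix x
      have lin': "Vector_Spaces.linear t s h'"
        unfolding Vector_Spaces.linear_def using h' t s by blast
      have eq: "h' y = h y" if "y \<in> range pure" for y
        using that h' hp by force
      have "x \<in> T.span (range pure)" using span by simp
      with eq show "h' x = h x"
        by (rule P.linear_eq_on_span[OF lin' lin])
    qed
  qed
qed

theorem tensor_product_universal:
  assumes T: "is_tensor_product (f :: 'k::field \<Rightarrow> 'a::comm_ring_1) (g :: 'k \<Rightarrow> 'b::comm_ring_1)
      (i :: 'a \<Rightarrow> 't::comm_ring_1) j"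
    and s: "vector_space (s :: 'k \<Rightarrow> 'v::ab_group_add \<Rightarrow> 'v)"
    and \<beta>: "alg_bilinear f g s \<beta>"
  shows "\<exists>!h. module_hom (alg_scale (i \<circ> f)) s h \<and> (\<forall>a b. h (i a * j b) = \<beta> a b)"
proof -
  interpret f: comm_ring_hom f using T by (simp add: is_tensor_product_def)
  interpret g: comm_ring_hom g using T by (simp add: is_tensor_product_def)
  interpret i: comm_ring_hom i using T by (simp add: is_tensor_product_def)
  have "comm_ring_hom (i \<circ> f)"
    by unfold_locales (auto simp: f.hom_add f.hom_mult i.hom_add i.hom_mult)
  hence t: "vector_space (alg_scale (i \<circ> f))"
    by (rule vector_space_alg_scale)
  define t where "t = alg_scale (i \<circ> f)"
  note t = t[folded t_def]
  have vs: "Modules.module (alg_scale f)" "Modules.module (alg_scale g)" "Modules.module t" "Modules.module ((*) :: 'k \<Rightarrow> 'k \<Rightarrow> 'k)"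
    using vector_space_alg_scale[OF f.comm_ring_hom_axioms]
      vector_space_alg_scale[OF g.comm_ring_hom_axioms] t vector_space_field[where ?'k = 'k]
    by (auto simp: module_iff_vector_space)
  have ex1: "\<exists>!h. module_hom t (*) h \<and> (\<forall>a b. h (i a * j b) = \<gamma> a b)"
    if "alg_bilinear f g (*) \<gamma>" for \<gamma>
    using T that unfolding is_tensor_product_def t_def by blast
  define pure where "pure = (\<lambda>p. i (fst p) * j (snd p))"
  have "\<exists>!h. module_hom t s h \<and> (\<forall>p. h (pure p) = (\<lambda>p. \<beta> (fst p) (snd p)) p)"
  proof (rule ex1_linear_extension[OF t s])
    fix h :: "'t \<Rightarrow> 'k"
    assume h: "module_hom t (*) h" "\<forall>p. h (pure p) = 0"
    have "alg_bilinear f g (*) (\<lambda>a b. 0 :: 'k)"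
      unfolding alg_bilinear_def using vs by (auto simp: module_hom_iff)
    note ex = ex1[OF this]
    have "module_hom t (*) h \<and> (\<forall>a b. h (i a * j b) = 0)"
      using h by (simp add: pure_def)
    moreover have "module_hom t (*) (\<lambda>_. 0 :: 'k) \<and> (\<forall>a b. (0 :: 'k) = 0)"
      using vs by (simp add: module_hom_iff)
    ultimately show "h = (\<lambda>_. 0)" by (rule ex1_unique[OF ex])
  next
    fix \<phi> :: "'v \<Rightarrow> 'k"
    assume \<phi>: "module_hom s (*) \<phi>"
    have "alg_bilinear f g (*) (\<lambda>a b. \<phi> (\<beta> a b))"
      unfolding alg_bilinear_def
    proof (intro conjI allI)
      show "module_hom (alg_scale f) (*) (\<lambda>a. \<phi> (\<beta> a b))" for b
        using module_hom_compose[of "alg_scale f" s "\<lambda>a. \<beta> a b" "(*)" \<phi>] \<beta> \<phi>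
        by (simp add: alg_bilinear_def o_def)
      show "module_hom (alg_scale g) (*) (\<lambda>b. \<phi> (\<beta> a b))" for a
        using module_hom_compose[of "alg_scale g" s "\<lambda>b. \<beta> a b" "(*)" \<phi>] \<beta> \<phi>
        by (simp add: alg_bilinear_def o_def)
    qed
    from ex1[OF this] obtain h where "module_hom t (*) h" "\<forall>a b. h (i a * j b) = \<phi> (\<beta> a b)"
      by (rule ex1E) blast
    thus "\<exists>h. module_hom t (*) h \<and> (\<forall>p. h (pure p) = \<phi> (\<beta> (fst p) (snd p)))"
      by (auto simp: pure_def)
  qed
  thus ?thesis by (simp add: pure_def t_def split_paired_all)
qed


section \<open>Galois cohomology in degree one\<close>

definition galois_group :: "('k::field \<Rightarrow> 's::field) \<Rightarrow> ('s \<Rightarrow> 's) set"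
  where "galois_group f = {\<sigma>. alg_automorphism f \<sigma>}"

text \<open>
  Continuity for the Krull topology on the Galois group and the discrete topology on the
  coefficients: the sets of all automorphisms agreeing with \<open>\<sigma>\<close> on a finite set \<open>F\<close> form a
  neighbourhood basis of \<open>\<sigma>\<close>.
\<close>

definition krull_continuous :: "('k::field \<Rightarrow> 's::field) \<Rightarrow> (('s \<Rightarrow> 's) \<Rightarrow> 'm) \<Rightarrow> bool"
  where "krull_continuous f c \<longleftrightarrow>
    (\<forall>\<sigma>\<in>galois_group f. \<exists>F. finite F \<and>
      (\<forall>\<rho>\<in>galois_group f. (\<forall>x\<in>F. \<rho> x = \<sigma> x) \<longrightarrow> c \<rho> = c \<sigma>))"

text \<open>
  The first cohomology set with values in a multiplicative group \<open>M\<close> contained in a commutative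
  ring, on which the Galois group acts by \<open>act\<close>.
\<close>

definition galois_cocycles ::
  "('k::field \<Rightarrow> 's::field) \<Rightarrow> (('s \<Rightarrow> 's) \<Rightarrow> 'm \<Rightarrow> 'm) \<Rightarrow> 'm::comm_ring_1 set
    \<Rightarrow> (('s \<Rightarrow> 's) \<Rightarrow> 'm) set"
  where "galois_cocycles f act M =
    {c \<in> galois_group f \<rightarrow>\<^sub>E M. krull_continuous f c \<and>
      (\<forall>\<sigma>\<in>galois_group f. \<forall>\<rho>\<in>galois_group f. c (\<sigma> \<circ> \<rho>) = c \<sigma> * act \<sigma> (c \<rho>))}"

definition cohomologous ::
  "('k::field \<Rightarrow> 's::field) \<Rightarrow> (('s \<Rightarrow> 's) \<Rightarrow> 'm \<Rightarrow> 'm) \<Rightarrow> 'm::comm_ring_1 set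
    \<Rightarrow> ((('s \<Rightarrow> 's) \<Rightarrow> 'm) \<times> (('s \<Rightarrow> 's) \<Rightarrow> 'm)) set"
  where "cohomologous f act M =
    {(c, c'). c \<in> galois_cocycles f act M \<and> c' \<in> galois_cocycles f act M \<and>
      (\<exists>m\<in>M. \<forall>\<sigma>\<in>galois_group f. m * c' \<sigma> = c \<sigma> * act \<sigma> m)}"

definition galois_H1 ::
  "('k::field \<Rightarrow> 's::field) \<Rightarrow> (('s \<Rightarrow> 's) \<Rightarrow> 'm \<Rightarrow> 'm) \<Rightarrow> 'm::comm_ring_1 set
    \<Rightarrow> (('s \<Rightarrow> 's) \<Rightarrow> 'm) set set"
  where "galois_H1 f act M = galois_cocycles f act M // cohomologous f act M"


section \<open>The special unitary group\<close>

text \<open>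
  Throughout, \<open>lE :: L \<Rightarrow> E\<close> and \<open>kE :: K \<Rightarrow> E\<close> are the canonical maps to \<open>E = L \<otimes> K\<close>, and \<open>bar\<close> is the
  conjugation of \<open>K\<close>.
\<close>

definition tau :: "('l \<Rightarrow> 'e::comm_ring_1) \<Rightarrow> ('q \<Rightarrow> 'e) \<Rightarrow> ('q \<Rightarrow> 'q) \<Rightarrow> 'e \<Rightarrow> 'e"
  where "tau lE kE bar = tensor_map lE kE lE kE id bar"

text \<open>
  The points of \<open>SU(E, \<tau>)\<close> over a \<open>k\<close>-algebra \<open>R\<close>, inside \<open>E \<otimes> R\<close>. Here \<open>eR :: E \<Rightarrow> E \<otimes> R\<close> and
  \<open>rE :: R \<Rightarrow> E \<otimes> R\<close>, and \<open>kR :: K \<Rightarrow> K \<otimes> R\<close> and \<open>rK :: R \<Rightarrow> K \<otimes> R\<close>, are the canonical maps. The norm of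
  \<open>E\<close> over \<open>K\<close>, extended to \<open>R\<close>, is the norm of \<open>E \<otimes> R\<close> over \<open>K \<otimes> R\<close>.
\<close>

definition SU ::
  "('l \<Rightarrow> 'e::comm_ring_1) \<Rightarrow> ('q \<Rightarrow> 'e) \<Rightarrow> ('q \<Rightarrow> 'q)
    \<Rightarrow> ('e \<Rightarrow> 'er::comm_ring_1) \<Rightarrow> ('r \<Rightarrow> 'er) \<Rightarrow> ('q \<Rightarrow> 'qr::comm_ring_1) \<Rightarrow> ('r \<Rightarrow> 'qr) \<Rightarrow> 'er set"
  where "SU lE kE bar eR rE kR rK =
    {x. x * tensor_map eR rE eR rE (tau lE kE bar) id x = 1 \<and>
        alg_norm (tensor_map kR rK eR rE kE id) x = 1}"

text \<open>The first cohomology set of \<open>SU(E, \<tau>)\<close>, computed with the separable closure \<open>aS :: k \<Rightarrow> k_s\<close>;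
  the Galois group acts on \<open>E \<otimes> k_s\<close> through the second factor.\<close>

definition H1_SU ::
  "('l \<Rightarrow> 'e::comm_ring_1) \<Rightarrow> ('q \<Rightarrow> 'e) \<Rightarrow> ('q \<Rightarrow> 'q) \<Rightarrow> ('k::field \<Rightarrow> 's::field)
    \<Rightarrow> ('e \<Rightarrow> 'es::comm_ring_1) \<Rightarrow> ('s \<Rightarrow> 'es) \<Rightarrow> ('q \<Rightarrow> 'qs::comm_ring_1) \<Rightarrow> ('s \<Rightarrow> 'qs)
    \<Rightarrow> (('s \<Rightarrow> 's) \<Rightarrow> 'es) set set"
  where "H1_SU lE kE bar aS eS sE kS sK =
    galois_H1 aS (\<lambda>\<sigma>. tensor_map eS sE eS sE id \<sigma>) (SU lE kE bar eS sE kS sK)"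


section \<open>Etale Tits process algebras\<close>

text \<open>
  The Jordan algebra of a cubic form with unit, adjoint and trace; the Jordan product \<open>x \<bullet> y\<close>
  satisfies \<open>x \<bullet> x = x\<^sup>2\<close>.
\<close>

record ('k, 'v) cubic_jordan_algebra =
  cj_scale :: "'k \<Rightarrow> 'v \<Rightarrow> 'v"
  cj_one :: 'v
  cj_norm :: "'v \<Rightarrow> 'k"
  cj_adjoint :: "'v \<Rightarrow> 'v"
  cj_trace :: "'v \<Rightarrow> 'k"

definition jordan_square :: "('k, 'v::ab_group_add) cubic_jordan_algebra \<Rightarrow> 'v \<Rightarrow> 'v"
  where "jordan_square J x =
    cj_adjoint J x + cj_scale J (cj_trace J x) x - cj_scale J (cj_trace J (cj_adjoint J x)) (cj_one J)"

definition jordan_mult :: "('k::field, 'v::ab_group_add) cubic_jordan_algebra \<Rightarrow> 'v \<Rightarrow> 'v \<Rightarrow> 'v"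
  where "jordan_mult J x y =
    cj_scale J (1 / 2) (jordan_square J (x + y) - jordan_square J x - jordan_square J y)"

definition admissible ::
  "('k::field \<Rightarrow> 'l::comm_ring_1) \<Rightarrow> ('k \<Rightarrow> 'q::comm_ring_1) \<Rightarrow> ('q \<Rightarrow> 'q) \<Rightarrow> 'l \<Rightarrow> 'q \<Rightarrow> bool"
  where "admissible aL aK bar u \<mu> \<longleftrightarrow>
    u dvd 1 \<and> \<mu> dvd 1 \<and> alg_norm aL u = alg_norm aK \<mu> \<and> aK (alg_norm aK \<mu>) = \<mu> * bar \<mu>"

text \<open>
  \<open>L\<close> and \<open>k\<close> are identified with their images in \<open>E\<close> and \<open>K\<close>; \<open>the_inv lE\<close> and \<open>the_inv aK\<close>
  turn \<open>\<tau>\<close>-invariant elements of \<open>E\<close> and \<open>bar\<close>-invariant elements of \<open>K\<close> into elements of \<open>L\<close> and \<open>k\<close>.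
\<close>

definition tits_process ::
  "('k::field \<Rightarrow> 'l::comm_ring_1) \<Rightarrow> ('k \<Rightarrow> 'q::comm_ring_1) \<Rightarrow> ('l \<Rightarrow> 'e::comm_ring_1) \<Rightarrow> ('q \<Rightarrow> 'e)
    \<Rightarrow> ('q \<Rightarrow> 'q) \<Rightarrow> 'l \<Rightarrow> 'q \<Rightarrow> ('k, 'l \<times> 'e) cubic_jordan_algebra"
  where "tits_process aL aK lE kE bar u \<mu> = (let \<tau> = tau lE kE bar in
    \<lparr> cj_scale = (\<lambda>c (a, b). (aL c * a, lE (aL c) * b)),
      cj_one = (1, 0),
      cj_norm = (\<lambda>(a, b). alg_norm aL a
        + the_inv aK (\<mu> * alg_norm kE b + bar (\<mu> * alg_norm kE b))
        - alg_trace aL (the_inv lE (lE a * b * lE u * \<tau> b))),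
      cj_adjoint = (\<lambda>(a, b).
        (alg_adjoint aL a - the_inv lE (b * lE u * \<tau> b),
         kE (bar \<mu>) * alg_adjoint kE (\<tau> b) * lE (unit_inv u) - lE a * b)),
      cj_trace = (\<lambda>(a, b). alg_trace aL a) \<rparr>)"

definition tits_process_algebras ::
  "('k::field \<Rightarrow> 'l::comm_ring_1) \<Rightarrow> ('k \<Rightarrow> 'q::comm_ring_1) \<Rightarrow> ('l \<Rightarrow> 'e::comm_ring_1) \<Rightarrow> ('q \<Rightarrow> 'e)
    \<Rightarrow> ('q \<Rightarrow> 'q) \<Rightarrow> ('k, 'l \<times> 'e) cubic_jordan_algebra set"
  where "tits_process_algebras aL aK lE kE bar =
    {tits_process aL aK lE kE bar u \<mu> | u \<mu>. admissible aL aK bar u \<mu>}"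

text \<open>
  An \<open>L\<close>-isomorphism is an isomorphism of \<open>k\<close>-algebras mapping the subalgebra \<open>L\<close> onto \<open>L\<close>, but not
  necessarily by the identity.
\<close>

definition L_isomorphic ::
  "(('k::field, 'l::comm_ring_1 \<times> 'e::comm_ring_1) cubic_jordan_algebra
    \<times> ('k, 'l \<times> 'e) cubic_jordan_algebra) set"
  where "L_isomorphic = {(J1, J2). \<exists>\<phi>. bij \<phi> \<and>
    module_hom (cj_scale J1) (cj_scale J2) \<phi> \<and>
    (\<forall>x y. \<phi> (jordan_mult J1 x y) = jordan_mult J2 (\<phi> x) (\<phi> y)) \<and>
    \<phi> ` range (\<lambda>l. (l, 0)) = range (\<lambda>l. (l, 0))}"

definition L_isomorphism_classes ::
  "('k::field \<Rightarrow> 'l::comm_ring_1) \<Rightarrow> ('k \<Rightarrow> 'q::comm_ring_1) \<Rightarrow> ('l \<Rightarrow> 'e::comm_ring_1) \<Rightarrow> ('q \<Rightarrow> 'e)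
    \<Rightarrow> ('q \<Rightarrow> 'q) \<Rightarrow> ('k, 'l \<times> 'e) cubic_jordan_algebra set set"
  where "L_isomorphism_classes aL aK lE kE bar =
    tits_process_algebras aL aK lE kE bar //
      (L_isomorphic \<inter> tits_process_algebras aL aK lE kE bar \<times> tits_process_algebras aL aK lE kE bar)"

end

theory Submission
  imports Defs "Jordan_Normal_Form.Char_Poly"
begin

text \<open>
  For an admissible pair \<open>(u, \<mu>)\<close> the equations \<open>w \<tau>(w) = u\<close>, \<open>N(w) = \<mu>\<close> define a torsor under
  \<open>SU(E, \<tau>)\<close>. If this torsor has a point \<open>w\<close> over the separable closure \<open>k_s\<close>, then
  \<open>\<sigma> \<mapsto> w\<inverse> \<sigma>(w)\<close> is a cocycle with values in \<open>SU(E, \<tau>)\<close>. The surjection sends the class of this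
  cocycle to the class of \<open>J(E, \<tau>, u, \<mu>)\<close>, with the class of \<open>J(E, \<tau>, 1, 1)\<close> as the default value. Every
  class of algebras is then a value, so two things remain to be proved: the point \<open>w\<close> exists, and the
  map is well defined.

  Existence (\<open>admissible_splits\<close>). Write \<open>K = k[d]\<close> with \<open>d\<^sup>2 = D\<close> and \<open>bar d = -d\<close>. A square root of \<open>D\<close> in
  \<open>k_s\<close> splits \<open>K \<otimes> k_s\<close> by idempotents \<open>e\<^sub>1\<close>, \<open>e\<^sub>2\<close> which \<open>\<tau>\<close> exchanges; let \<open>\<mu>\<close> have the components
  \<open>m\<^sub>1\<close>, \<open>m\<^sub>2\<close>, so that \<open>m\<^sub>1 m\<^sub>2 = N(u)\<close>. If \<open>s\<close> is a cube root of \<open>m\<^sub>1\<close>, then \<open>w = e\<^sub>1 s + e\<^sub>2 u s\<inverse>\<close> is a point.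
  The two roots lie in \<open>k_s\<close> because the characteristic is neither 2 nor 3.

  Well-definedness (\<open>cohomologous_splits\<close> and \<open>tits_process_isomorphic\<close>). If the cocycles of \<open>w\<close> and \<open>w'\<close>
  differ by the coboundary of \<open>m\<close>, then \<open>y = w m w'\<inverse>\<close> is invariant under the Galois group, hence lies in
  \<open>E\<close> (\<open>galois_descent\<close>), and it satisfies \<open>u = u' y \<tau>(y)\<close> and \<open>\<mu> = \<mu>' N(y)\<close>. For such a \<open>y\<close> the map
  \<open>(a, b) \<mapsto> (a, b y)\<close> is an isomorphism of the two Tits process algebras which is the identity on \<open>L\<close>.

  Three ingredients carry this argument. The fixed field of the Galois group of a separable closure is the
  base field (\<open>separable_closure_fixed_field\<close>); this needs enough automorphisms, which Zorn's lemma provides.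
  The norm of a free algebra is independent of the basis, multiplicative and compatible with base change
  and with semilinear automorphisms (\<open>alg_norm_hom\<close>). The adjoint of an algebra of rank 3 exists by
  the Cayley-Hamilton theorem, is unique, and turns the multiplication by a unit \<open>w\<close> into the one by
  \<open>N(w) w\<inverse>\<close> (\<open>rank_3_adjoint_mult_unit\<close>).
\<close>

section \<open>Separable polynomials\<close>

text \<open>
  The Euclidean algorithm: the Bezout coefficients for \<open>(q, p mod q)\<close> give those for \<open>(p, q)\<close>.
\<close>
lemma coprime_bezout:
  fixes p q :: "'a::euclidean_ring"
  assumes "coprime p q"
  shows "\<exists>a b. a * p + b * q = 1"
  using assms
proof (induction "euclidean_size q" arbitrary: p q rule: less_induct)
  case less
  show ?case
  proof (cases "q = 0")
    case True
    hence "p dvd 1" using less.prems by simp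
    thus ?thesis using True by (metis dvd_def mult.commute add.right_neutral mult_zero_right)
  next
    case False
    have "coprime q (p mod q)" using less.prems
      by (metis False coprime_commute coprime_mod_left_iff)
    from less.hyps[OF mod_size_less[OF False] this]
    obtain a b where ab: "a * q + b * (p mod q) = 1" by blast
    have "b * p + (a - b * (p div q)) * q = a * q + b * (p - p div q * q)"
      by (simp add: algebra_simps)
    also have "p - p div q * q = p mod q" by (simp add: minus_div_mult_eq_mod)
    finally show ?thesis using ab by metis
  qed
qed

lemma separable_polyI:
  assumes "a * p + b * pderiv p = 1" shows "separable_poly p"
  unfolding separable_poly_def using assms by (metis coprimeI dvd_add dvd_mult)

lemma separable_poly_dvd:
  fixes p q :: "'a::field poly"
  assumes "separable_poly p" "q dvd p"
  shows "separable_poly q"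
proof -
  obtain r where r: "p = q * r" using assms(2) by blast
  obtain a b where "a * p + b * pderiv p = 1"
    using assms(1) coprime_bezout unfolding separable_poly_def by blast
  hence "(a * r + b * pderiv r) * q + (b * r) * pderiv q = 1"
    unfolding r pderiv_mult by (simp add: algebra_simps)
  thus ?thesis by (rule separable_polyI)
qed

text \<open>
  Separability survives an extension of the field because it is witnessed by a Bezout identity.
\<close>
lemma separable_poly_map_poly:
  assumes "comm_ring_hom (f :: 'k::field \<Rightarrow> 's::field)" "separable_poly p"
  shows "separable_poly (map_poly f p)"
proof -
  interpret comm_ring_hom f by fact
  interpret field_hom f ..
  interpret idom_hom f ..
  interpret f: map_poly_idom_hom f ..
  obtain a b where "a * p + b * pderiv p = 1"
    using assms(2) coprime_bezout unfolding separable_poly_def by blast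
  hence "map_poly f (a * p + b * pderiv p) = map_poly f 1" by (rule arg_cong)
  hence "map_poly f a * map_poly f p + map_poly f b * pderiv (map_poly f p) = 1"
    by (simp add: map_poly_pderiv f.hom_add f.hom_mult f.hom_one)
  thus ?thesis by (rule separable_polyI)
qed

lemma separable_closure_two_roots:
  fixes g :: "'s::field poly"
  assumes S: "separable_closure (f :: 'k::field \<Rightarrow> 's)" and g: "separable_poly g" "degree g > 1"
  shows "\<exists>y. poly g y = 0 \<and> y \<noteq> x"
proof -
  have root: "\<exists>y. poly p y = 0" if "separable_poly p" "degree p > 0" for p :: "'s poly"
    using S that unfolding separable_closure_def by blast
  obtain y where y: "poly g y = 0" using root[OF g(1)] g(2) by auto
  then obtain h where h: "g = [:-y, 1:] * h" unfolding poly_eq_0_iff_dvd by blast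
  have "h \<noteq> 0" using g(2) h by auto
  hence "degree g = 1 + degree h" unfolding h by (subst degree_mult_eq) auto
  hence "degree h > 0" using g(2) by simp
  moreover have "separable_poly h" using g(1) h separable_poly_dvd by (metis dvd_triv_right)
  ultimately obtain y' where y': "poly h y' = 0" using root by blast
  have "y' \<noteq> y"
  proof
    assume "y' = y"
    hence "poly h y = 0" using y' by simp
    hence "poly (pderiv g) y = 0" "poly g y = 0" unfolding h
      by (simp_all only: pderiv_mult poly_add poly_mult) (simp_all add: pderiv_pCons)
    hence "[:-y, 1:] dvd 1" using g(1) unfolding separable_poly_def poly_eq_0_iff_dvd
      by (metis coprime_common_divisor)
    thus False by (simp add: is_unit_iff_degree)
  qed
  thus ?thesis using y y' h by (metis mult_zero_right poly_mult)
qed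

text \<open>
  If \<open>a + x q(x) = 0\<close> with \<open>a \<noteq> 0\<close>, then \<open>- a\<inverse> q(x)\<close> is inverse to \<open>x\<close>; a zero constant term can be divided
  out. So a ring of algebraic elements which contains the base field is closed under inverses.
\<close>
lemma algebraic_inverse_polynomial:
  assumes "comm_ring_hom (f :: 'k::field \<Rightarrow> 's::field)"
  shows "p \<noteq> 0 \<Longrightarrow> poly (map_poly f p) x = 0 \<Longrightarrow> x \<noteq> 0 \<Longrightarrow> \<exists>r. x * poly (map_poly f r) x = 1"
proof (induction p)
  case 0
  then show ?case by simp
next
  case (pCons a q)
  interpret comm_ring_hom f by fact
  interpret field_hom f ..
  show ?case
  proof (cases "a = 0")
    case True
    then show ?thesis using pCons by (auto simp: map_poly_pCons)
  next
    case False
    have 0: "x * poly (map_poly f q) x = - f a" using pCons.prems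
      by (simp add: map_poly_pCons eq_neg_iff_add_eq_0 add.commute)
    have "map_poly f (smult (- inverse a) q) = smult (- inverse (f a)) (map_poly f q)"
      by (simp only: map_poly_hom_smult hom_uminus hom_inverse)
    hence "x * poly (map_poly f (smult (- inverse a) q)) x = - inverse (f a) * (x * poly (map_poly f q) x)"
      by simp
    also have "\<dots> = 1" unfolding 0 using False by simp
    finally show ?thesis by blast
  qed
qed

text \<open>
  Kummer equations: for \<open>p = X\<^sup>n - c\<close> the combination \<open>X p' - n p\<close> is the constant \<open>n c\<close>, whence \<open>p\<close> is
  separable if \<open>n\<close> and \<open>c\<close> are nonzero.
\<close>
lemma separable_closure_root:
  fixes f :: "'k::field \<Rightarrow> 's::field"
  assumes S: "separable_closure f" and n: "(of_nat n :: 'k) \<noteq> 0" and c: "c \<noteq> 0"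
  shows "\<exists>s :: 's. s ^ n = c"
proof -
  interpret f: comm_ring_hom f using S unfolding separable_closure_def by blast
  interpret f: field_hom f ..
  have n': "(of_nat n :: 's) \<noteq> 0" using n f.hom_of_nat[of n] f.hom_0_iff by metis
  have n0: "n > 0" using n by (cases n) auto
  define p :: "'s poly" where "p = monom 1 n - [:c:]"
  have "pderiv p = monom (of_nat n) (n - 1)" by (simp add: p_def pderiv_diff pderiv_monom pderiv_pCons)
  hence "monom (inverse (of_nat n * c)) 1 * pderiv p = monom (inverse c) n"
    using n' n0 by (simp add: mult_monom)
  moreover have "[:- inverse c:] * p = 1 - monom (inverse c) n"
    using c by (simp add: p_def smult_diff_right smult_monom one_pCons minus_monom[symmetric])
  ultimately have "[:- inverse c:] * p + monom (inverse (of_nat n * c)) 1 * pderiv p = 1"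
    by (simp only: diff_add_cancel)
  hence "separable_poly p" by (rule separable_polyI)
  moreover have "degree p > 0"
  proof -
    have "coeff p n = 1" using n0 by (simp add: p_def coeff_pCons split: nat.splits)
    thus ?thesis using n0 le_degree[of p n] by simp
  qed
  ultimately obtain s where "poly p s = 0" using S unfolding separable_closure_def by blast
  thus ?thesis by (auto simp: p_def poly_monom)
qed

section \<open>The fixed field of the Galois group\<close>

text \<open>
  The graphs of isomorphisms between intermediate rings: an extension of an automorphism is then just a
  larger set, so Zorn's lemma applies to inclusion. The last clause makes \<open>G\<close> and its converse single-valued,
  because \<open>G\<close> is closed under differences. Domain and range are treated symmetrically, so that surjectivity
  of a maximal \<open>G\<close> comes for free by passing to the converse.
\<close>
definition partial_automorphism :: "('k::field \<Rightarrow> 's::field) \<Rightarrow> ('s \<times> 's) set \<Rightarrow> bool"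
  where "partial_automorphism f G \<longleftrightarrow>
    (\<forall>c. (f c, f c) \<in> G) \<and>
    (\<forall>x y x' y'. (x, y) \<in> G \<longrightarrow> (x', y') \<in> G \<longrightarrow> (x + x', y + y') \<in> G \<and> (x * x', y * y') \<in> G) \<and>
    (\<forall>x y. (x, y) \<in> G \<longrightarrow> (x = 0 \<longleftrightarrow> y = 0))"

text \<open>
  Pairs of corresponding polynomials over the domain and over the range of the isomorphism with graph \<open>G\<close>.
\<close>
definition lift_coeffs :: "('a::zero \<times> 'a) set \<Rightarrow> ('a poly \<times> 'a poly) set"
  where "lift_coeffs G = {(p, q). \<forall>n. (coeff p n, coeff q n) \<in> G}"

locale partial_aut = f: comm_ring_hom f
  for f :: "'k::field \<Rightarrow> 's::field" and G :: "('s \<times> 's) set" +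
  assumes G: "partial_automorphism f G"
    and algebraic: "\<And>x. \<exists>p. p \<noteq> 0 \<and> poly (map_poly f p) x = 0"
begin

sublocale f: field_hom f ..

lemma const: "(f c, f c) \<in> G"
  and add: "(x, y) \<in> G \<Longrightarrow> (x', y') \<in> G \<Longrightarrow> (x + x', y + y') \<in> G"
  and mult: "(x, y) \<in> G \<Longrightarrow> (x', y') \<in> G \<Longrightarrow> (x * x', y * y') \<in> G"
  and zero_iff: "(x, y) \<in> G \<Longrightarrow> x = 0 \<longleftrightarrow> y = 0"
  using G unfolding partial_automorphism_def by blast+

lemma zero: "(0, 0) \<in> G" and one: "(1, 1) \<in> G" and minus_one: "(-1, -1) \<in> G"
  using const[of 0] const[of 1] const[of "-1"] by (simp_all add: f.hom_uminus)

lemma diff: "(x, y) \<in> G \<Longrightarrow> (x', y') \<in> G \<Longrightarrow> (x - x', y - y') \<in> G"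
  using add[of x y "-1 * x'" "-1 * y'"] mult[OF minus_one, of x' y'] by simp

lemma sum: "(\<And>a. a \<in> A \<Longrightarrow> (u a, v a) \<in> G) \<Longrightarrow> ((\<Sum>a\<in>A. u a), (\<Sum>a\<in>A. v a)) \<in> G"
  by (induction A rule: infinite_finite_induct) (auto simp: zero intro!: add)

lemma power: "(x, y) \<in> G \<Longrightarrow> (x ^ n, y ^ n) \<in> G"
  by (induction n) (auto simp: one intro: mult)

lemma poly_base: "(x, y) \<in> G \<Longrightarrow> (poly (map_poly f p) x, poly (map_poly f p) y) \<in> G"
  unfolding poly_altdef by (intro sum) (auto simp: coeff_map_poly intro!: mult power const)

text \<open>
  A partial automorphism is a field isomorphism: the inverse of \<open>x\<close> is the value at \<open>x\<close> of a polynomial over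
  the base field, and the value of the same polynomial at \<open>y\<close> is the inverse of \<open>y\<close>.
\<close>
lemma inverse: assumes "(x, y) \<in> G" shows "(inverse x, inverse y) \<in> G"
proof (cases "x = 0")
  case True
  thus ?thesis using zero_iff[OF assms] zero by simp
next
  case False
  obtain p where "p \<noteq> 0" "poly (map_poly f p) x = 0" using algebraic by blast
  from algebraic_inverse_polynomial[OF f.comm_ring_hom_axioms this False]
  obtain r where r: "x * poly (map_poly f r) x = 1" by blast
  have "(x * poly (map_poly f r) x - 1, y * poly (map_poly f r) y - 1) \<in> G"
    by (intro diff mult poly_base assms one)
  from zero_iff[OF this] have "y * poly (map_poly f r) y = 1" using r by simp
  hence "inverse x = poly (map_poly f r) x" "inverse y = poly (map_poly f r) y"
    using r by (metis inverse_unique)+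
  thus ?thesis using poly_base[OF assms] by simp
qed

lemma lift_base: "(map_poly f p, map_poly f p) \<in> lift_coeffs G"
  by (simp add: lift_coeffs_def coeff_map_poly const)

lemma lift_diff: "(p, q) \<in> lift_coeffs G \<Longrightarrow> (p', q') \<in> lift_coeffs G \<Longrightarrow> (p - p', q - q') \<in> lift_coeffs G"
  by (simp add: lift_coeffs_def diff)

lemma lift_add: "(p, q) \<in> lift_coeffs G \<Longrightarrow> (p', q') \<in> lift_coeffs G \<Longrightarrow> (p + p', q + q') \<in> lift_coeffs G"
  by (simp add: lift_coeffs_def add)

lemma lift_mult: "(p, q) \<in> lift_coeffs G \<Longrightarrow> (p', q') \<in> lift_coeffs G \<Longrightarrow> (p * p', q * q') \<in> lift_coeffs G"
  by (auto simp add: lift_coeffs_def coeff_mult intro!: sum mult)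

lemma lift_monom: "(x, y) \<in> G \<Longrightarrow> (monom x n, monom y n) \<in> lift_coeffs G"
  by (simp add: lift_coeffs_def zero)

lemma lift_degree: "(p, q) \<in> lift_coeffs G \<Longrightarrow> degree p = degree q"
  unfolding degree_def lift_coeffs_def by (simp add: zero_iff[of "coeff p n" "coeff q n" for n])

lemma lift_zero_iff: "(p, q) \<in> lift_coeffs G \<Longrightarrow> p = 0 \<longleftrightarrow> q = 0"
  unfolding poly_eq_iff lift_coeffs_def using zero_iff by auto

text \<open>
  The first component of the pair is, up to a scalar, the minimal polynomial of \<open>z\<close> over the domain of \<open>G\<close>, the second its image
  under the isomorphism. Divisibility is stated for the images, where it is needed: every relation
  satisfied by \<open>z\<close> is transported to a multiple of \<open>g2\<close>.
\<close>
lemma minimal_polynomial: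
  obtains g1 g2 where "(g1, g2) \<in> lift_coeffs G" "degree g2 > 0" "poly g1 z = 0"
    "\<And>p q. (p, q) \<in> lift_coeffs G \<Longrightarrow> poly p z = 0 \<Longrightarrow> g2 dvd q"
proof -
  let ?P = "\<lambda>g. fst g \<noteq> 0 \<and> g \<in> lift_coeffs G \<and> poly (fst g) z = 0"
  obtain p0 where p0: "p0 \<noteq> 0" "poly (map_poly f p0) z = 0" using algebraic by blast
  have "?P (map_poly f p0, map_poly f p0)" using p0 lift_base by (simp add: map_poly_eq_0_iff)
  from ex_has_least_nat[of ?P, OF this, of "\<lambda>g. degree (fst g)"]
  obtain g where g_min: "?P g \<and> (\<forall>h. ?P h \<longrightarrow> degree (fst g) \<le> degree (fst h))"
    by (rule exE)
  have g: "?P g" using g_min by (rule conjunct1)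
  have min: "degree (fst g) \<le> degree (fst h)" if "?P h" for h
    by (rule conjunct2[OF g_min, THEN spec, THEN mp, OF that])
  obtain g1 g2 where g12: "g = (g1, g2)" by (cases g)
  have g1: "g1 \<noteq> 0" "(g1, g2) \<in> lift_coeffs G" "poly g1 z = 0" using g g12 by auto
  have deg: "degree g1 = degree g2" using lift_degree g1 by blast
  have "degree g1 > 0" using g1 by (cases "degree g1 = 0") (auto elim: degree_eq_zeroE)
  moreover have "g2 dvd q" if "(p, q) \<in> lift_coeffs G" "poly p z = 0" for p q
    using that
  proof (induction "degree p" arbitrary: p q rule: less_induct)
    case less
    show ?case
    proof (cases "p = 0")
      case True
      thus ?thesis using less.prems lift_zero_iff by auto
    next
      case False
      hence le: "degree g1 \<le> degree p" using min[of "(p, q)"] less.prems g12 by simp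
      define n where "n = degree p - degree g1"
      define a where "a = lead_coeff p * inverse (lead_coeff g1)"
      define b where "b = lead_coeff q * inverse (lead_coeff g2)"
      have degq: "degree p = degree q" using lift_degree less.prems by blast
      \<comment> \<open>One step of the division with remainder, on both sides at once: the leading term of \<open>p\<close> is cancelled,
        and the remainder still vanishes at \<open>z\<close>.\<close>
      have ab: "(a, b) \<in> G" unfolding a_def b_def
        using less.prems(1) g1(2) degq deg by (intro mult inverse) (auto simp: lift_coeffs_def)
      define p' where "p' = p - monom a n * g1"
      define q' where "q' = q - monom b n * g2"
      have p'q': "(p', q') \<in> lift_coeffs G" unfolding p'_def q'_def
        by (intro lift_diff lift_mult lift_monom ab less.prems g1)
      have p'z: "poly p' z = 0" by (simp add: p'_def less.prems g1)
      have a0: "a \<noteq> 0" using False g1 by (simp add: a_def)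
      have dm: "degree (monom a n * g1) = degree p"
        using a0 g1(1) le by (simp add: degree_mult_eq degree_monom_eq n_def)
      have lm: "lead_coeff (monom a n * g1) = lead_coeff p"
        unfolding lead_coeff_mult using g1(1) a0 by (simp add: a_def degree_monom_eq)
      have "g2 dvd q'"
      proof (cases "p' = 0")
        case True
        thus ?thesis using p'q' lift_zero_iff by auto
      next
        case p'0: False
        have le': "degree p' \<le> degree p" unfolding p'_def using dm
          by (metis degree_diff_le le_refl)
        have "coeff p' (degree p) = 0" using lm dm by (simp add: p'_def)
        hence "degree p' < degree p" using le' p'0
          by (metis leading_coeff_0_iff nless_le)
        thus ?thesis using less.hyps p'q' p'z by blast
      qed
      hence "g2 dvd q' + monom b n * g2" by simp
      thus ?thesis unfolding q'_def by simp
    qed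
  qed
  ultimately show thesis using that g1 deg by simp
qed

text \<open>
  One step of the extension: \<open>z\<close> may be sent to any root of the transported minimal polynomial. The hypothesis
  on \<open>z\<close> is passed on to \<open>g\<close>, which divides the image of a separable polynomial over the base field.
  The case of degree one records that only elements of the domain have no freedom.
\<close>
lemma extend:
  assumes sep: "\<exists>p. separable_poly p \<and> poly (map_poly f p) z = 0"
  obtains g where "separable_poly g" "degree g > 0" "degree g = 1 \<Longrightarrow> z \<in> Domain G"
    "\<And>y. poly g y = 0 \<Longrightarrow> \<exists>G'. partial_automorphism f G' \<and> G \<subseteq> G' \<and> (z, y) \<in> G'"
proof -
  obtain g1 g2 where g: "(g1, g2) \<in> lift_coeffs G" "degree g2 > 0" "poly g1 z = 0"
    and dvd: "\<And>p q. (p, q) \<in> lift_coeffs G \<Longrightarrow> poly p z = 0 \<Longrightarrow> g2 dvd q"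
    using minimal_polynomial[of z] by blast
  obtain p where p: "separable_poly p" "poly (map_poly f p) z = 0" using sep by blast
  have "separable_poly g2"
    using dvd[OF lift_base p(2)] separable_poly_map_poly[OF f.comm_ring_hom_axioms p(1)]
    by (rule separable_poly_dvd[rotated])
  moreover have "z \<in> Domain G" if "degree g2 = 1"
  proof -
    have d1: "degree g1 = 1" using that lift_degree g(1) by simp
    then obtain a b where g1: "g1 = [:a, b:]" "b \<noteq> 0"
      by (metis degree_eq_zeroE degree_pCons_eq_if degree_pCons_0 gr_zeroI less_numeral_extra(1) n_not_Suc_n nat.inject One_nat_def pCons_cases pCons_eq_0_iff zero_neq_one)
    have "z = - a * inverse b" using g(3) g1 by (simp add: field_simps eq_neg_iff_add_eq_0)
    moreover have "(coeff g1 0, coeff g2 0) \<in> G" "(coeff g1 1, coeff g2 1) \<in> G"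
      using g(1) by (auto simp: lift_coeffs_def)
    hence "(-1 * coeff g1 0 * inverse (coeff g1 1), -1 * coeff g2 0 * inverse (coeff g2 1)) \<in> G"
      by (intro mult inverse minus_one)
    ultimately show ?thesis using g1 by auto
  qed
  moreover have "\<exists>G'. partial_automorphism f G' \<and> G \<subseteq> G' \<and> (z, y) \<in> G'" if y: "poly g2 y = 0" for y
  proof -
    define G' where "G' = {(poly p z, poly q y) | p q. (p, q) \<in> lift_coeffs G}"
    have G'I: "(p, q) \<in> lift_coeffs G \<Longrightarrow> (poly p z, poly q y) \<in> G'" for p q
      unfolding G'_def by blast
    have GG': "(a, b) \<in> G'" if "(a, b) \<in> G" for a b
      using G'I[OF lift_monom[OF that, of 0]] by (simp add: poly_monom)
    have add': "(a + a', b + b') \<in> G'" if "(a, b) \<in> G'" "(a', b') \<in> G'" for a b a' b'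
      using that lift_add unfolding G'_def by (smt (verit, del_insts) Pair_inject mem_Collect_eq poly_add)
    have mult': "(a * a', b * b') \<in> G'" if "(a, b) \<in> G'" "(a', b') \<in> G'" for a b a' b'
      using that lift_mult unfolding G'_def by (smt (verit, del_insts) Pair_inject mem_Collect_eq poly_mult)
    have left: "b = 0" if "(0, b) \<in> G'" for b
      using that dvd y unfolding G'_def by (auto elim!: dvdE) (metis mult_zero_left poly_mult dvdE)
    have pb: "(poly (map_poly f p) a, poly (map_poly f p) b) \<in> G'" if "(a, b) \<in> G'" for a b p
    proof (induction p)
      case 0
      show ?case using GG'[OF zero] by simp
    next
      case (pCons c p)
      show ?case using add'[OF GG'[OF const[of c]] mult'[OF that pCons.IH]]
        by (simp add: f.map_poly_pCons_hom)
    qed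
    \<comment> \<open>If \<open>a\<close> were a unit, then \<open>a r(a) = 1\<close> would be paired with \<open>0\<close>, which contradicts the other
      direction for \<open>a r(a) - 1\<close>.\<close>
    have right: "a = 0" if a: "(a, 0) \<in> G'" for a
    proof (rule ccontr)
      assume "a \<noteq> 0"
      obtain p where "p \<noteq> 0" "poly (map_poly f p) a = 0" using algebraic by blast
      from algebraic_inverse_polynomial[OF f.comm_ring_hom_axioms this \<open>a \<noteq> 0\<close>]
      obtain r where r: "a * poly (map_poly f r) a = 1" by blast
      have "(-1 + a * poly (map_poly f r) a, -1 + 0 * poly (map_poly f r) 0) \<in> G'"
        by (intro add' mult' pb a GG' minus_one)
      hence "(0, -1) \<in> G'" using r by simp
      from left[OF this] show False by simp
    qed
    have "partial_automorphism f G'" unfolding partial_automorphism_def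
      using add' mult' left right GG'[OF const] by blast
    moreover have "(z, y) \<in> G'" using G'I[OF lift_monom[OF one, of 1]] by (simp add: poly_monom)
    moreover have "G \<subseteq> G'" using GG' by auto
    ultimately show ?thesis by blast
  qed
  ultimately show thesis using that g(2) by blast
qed

end

lemma partial_automorphism_converse:
  "partial_automorphism f (G\<inverse>) \<longleftrightarrow> partial_automorphism f G"
  unfolding partial_automorphism_def by auto

lemma separable_closure_algebraic:
  assumes "separable_closure (f :: 'k::field \<Rightarrow> 's::field)"
  shows "\<exists>p. p \<noteq> 0 \<and> poly (map_poly f p) x = 0"
proof -
  obtain p where p: "separable_poly p" "poly (map_poly f p) x = 0"
    using assms unfolding separable_closure_def by blast
  have "p \<noteq> 0" using p(1) by (auto simp: separable_poly_def)
  thus ?thesis using p by blast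
qed

lemma separable_closure_partial_aut:
  assumes "separable_closure (f :: 'k::field \<Rightarrow> 's::field)" "partial_automorphism f G"
  shows "partial_aut f G"
  using assms separable_closure_algebraic[OF assms(1)]
  unfolding partial_aut_def partial_aut_axioms_def separable_closure_def by blast

lemma maximal_partial_automorphism_total:
  assumes S: "separable_closure (f :: 'k::field \<Rightarrow> 's::field)" and G: "partial_automorphism f G"
    and max: "\<And>G'. partial_automorphism f G' \<Longrightarrow> G \<subseteq> G' \<Longrightarrow> G' = G"
  shows "Domain G = UNIV"
proof -
  interpret partial_aut f G by (rule separable_closure_partial_aut[OF S G])
  have "z \<in> Domain G" for z
  proof -
    have "\<exists>p. separable_poly p \<and> poly (map_poly f p) z = 0"
      using S unfolding separable_closure_def by blast
    from extend[OF this] obtain g where g: "separable_poly g" "degree g > 0"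
      "\<And>y. poly g y = 0 \<Longrightarrow> \<exists>G'. partial_automorphism f G' \<and> G \<subseteq> G' \<and> (z, y) \<in> G'" by metis
    obtain y where "poly g y = 0" using S g(1,2) unfolding separable_closure_def by blast
    with g(3) max show ?thesis by blast
  qed
  thus ?thesis by blast
qed

lemma partial_automorphism_extends:
  assumes S: "separable_closure (f :: 'k::field \<Rightarrow> 's::field)" and G: "partial_automorphism f G"
  shows "\<exists>\<sigma>\<in>galois_group f. \<forall>(x, y)\<in>G. \<sigma> x = y"
proof -
  let ?A = "{H. partial_automorphism f H \<and> G \<subseteq> H}"
  have "\<exists>M\<in>?A. \<forall>X\<in>?A. M \<subseteq> X \<longrightarrow> X = M"
  proof (rule subset_Zorn_nonempty)
    show "?A \<noteq> {}" using G by blast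
  next
    fix C assume C: "C \<noteq> {}" "subset.chain ?A C"
    have cl: "(x + x', y + y') \<in> \<Union>C \<and> (x * x', y * y') \<in> \<Union>C"
      if xy: "(x, y) \<in> \<Union>C" "(x', y') \<in> \<Union>C" for x y x' y'
    proof -
      obtain H H' where H: "H \<in> C" "(x, y) \<in> H" "H' \<in> C" "(x', y') \<in> H'" using xy by blast
      have "H \<union> H' \<in> C" using C(2) H unfolding subset_chain_def by (metis sup.absorb1 sup.absorb2)
      moreover from this have "partial_automorphism f (H \<union> H')" using C(2) unfolding subset_chain_def by blast
      moreover have "(x, y) \<in> H \<union> H'" "(x', y') \<in> H \<union> H'" using H by auto
      ultimately show ?thesis unfolding partial_automorphism_def by blast
    qed
    have mem: "partial_automorphism f H" "G \<subseteq> H" if "H \<in> C" for H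
      using C(2) that unfolding subset_chain_def by auto
    obtain H0 where H0: "H0 \<in> C" using C(1) by blast
    have "(f c, f c) \<in> H0" for c
      using mem(1)[OF H0] unfolding partial_automorphism_def by (rule conjunct1[THEN spec])
    hence const: "(f c, f c) \<in> \<Union>C" for c using H0 by blast
    have zero: "x = 0 \<longleftrightarrow> y = 0" if xy: "(x, y) \<in> \<Union>C" for x y
    proof -
      obtain H where "H \<in> C" "(x, y) \<in> H" using xy by blast
      thus ?thesis using mem(1)[of H] unfolding partial_automorphism_def by blast
    qed
    have "partial_automorphism f (\<Union>C)"
      unfolding partial_automorphism_def
    proof (intro conjI allI impI)
      fix x y x' y' assume xy: "(x, y) \<in> \<Union>C" "(x', y') \<in> \<Union>C"
      show "(x + x', y + y') \<in> \<Union>C" using cl[OF xy] by (rule conjunct1)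
      show "(x * x', y * y') \<in> \<Union>C" using cl[OF xy] by (rule conjunct2)
    qed (rule const, rule zero)
    thus "\<Union>C \<in> ?A" using H0 mem(2)[OF H0] by blast
  qed
  then obtain M where MA: "M \<in> ?A" and maxA: "\<forall>X\<in>?A. M \<subseteq> X \<longrightarrow> X = M"
    by (rule bexE)
  have M: "partial_automorphism f M" "G \<subseteq> M" using MA by simp_all
  have max: "X = M" if "partial_automorphism f X" "M \<subseteq> X" for X
    using maxA[THEN bspec, of X] that M(2) by simp
  interpret partial_aut f M by (rule separable_closure_partial_aut[OF S M(1)])
  have dom: "Domain M = UNIV" using maximal_partial_automorphism_total[OF S M(1) max] .
  have "Domain (M\<inverse>) = UNIV"
  proof (rule maximal_partial_automorphism_total[OF S])
    show "partial_automorphism f (M\<inverse>)" using M(1) partial_automorphism_converse by blast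
    show "X = M\<inverse>" if "partial_automorphism f X" "M\<inverse> \<subseteq> X" for X
      using max[of "X\<inverse>"] that partial_automorphism_converse[of f X] by (metis converse_converse converse_mono)
  qed
  hence ran: "Range M = UNIV" by simp
  have unique: "y = y'" if "(x, y) \<in> M" "(x, y') \<in> M" for x y y'
    using zero_iff[OF diff[OF that]] by simp
  have inj: "x = x'" if "(x, y) \<in> M" "(x', y) \<in> M" for x x' y
    using zero_iff[OF diff[OF that]] by simp
  define \<sigma> where "\<sigma> x = (THE y. (x, y) \<in> M)" for x
  have \<sigma>: "\<sigma> x = y \<longleftrightarrow> (x, y) \<in> M" for x y
  proof -
    obtain y' where y': "(x, y') \<in> M" using dom by blast
    hence "\<sigma> x = y'" unfolding \<sigma>_def using unique by (intro the_equality) auto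
    thus ?thesis using unique y' by auto
  qed
  have \<sigma>M: "(x, \<sigma> x) \<in> M" for x using \<sigma>[of x "\<sigma> x"] by simp
  have "comm_ring_hom \<sigma>"
    by unfold_locales (simp_all add: \<sigma> add mult zero one \<sigma>M)
  moreover have "bij \<sigma>"
  proof (rule bijI)
    show "inj \<sigma>" using \<sigma>M inj by (metis injI)
    show "surj \<sigma>" using ran \<sigma> by (metis Range.cases UNIV_I surjI surj_def)
  qed
  moreover have "\<sigma> (f c) = f c" for c using \<sigma> const by simp
  ultimately have "\<sigma> \<in> galois_group f" unfolding galois_group_def alg_automorphism_def
    by simp
  moreover have "\<forall>(x, y)\<in>G. \<sigma> x = y" using \<sigma> M(2) by auto
  ultimately show ?thesis by blast
qed

text \<open>
  An element outside of the base field has a separable minimal polynomial of degree at least two, hence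
  a second root; the corresponding partial automorphism extends to one which moves the element.
\<close>
theorem separable_closure_fixed_field:
  assumes S: "separable_closure (f :: 'k::field \<Rightarrow> 's::field)"
    and fixed: "\<And>\<sigma>. \<sigma> \<in> galois_group f \<Longrightarrow> \<sigma> x = x"
  shows "x \<in> range f"
proof -
  interpret f: comm_ring_hom f using S unfolding separable_closure_def by blast
  interpret f: field_hom f ..
  define G where "G = range (\<lambda>c. (f c, f c))"
  have "partial_automorphism f G" unfolding partial_automorphism_def G_def
    by (auto simp flip: f.hom_add f.hom_mult)
  then interpret partial_aut f G by (rule separable_closure_partial_aut[OF S])
  have "\<exists>p. separable_poly p \<and> poly (map_poly f p) x = 0"
    using S unfolding separable_closure_def by blast
  from extend[OF this] obtain g where g: "separable_poly g" "degree g > 0"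
      "degree g = 1 \<Longrightarrow> x \<in> Domain G"
      "\<And>y. poly g y = 0 \<Longrightarrow> \<exists>G'. partial_automorphism f G' \<and> G \<subseteq> G' \<and> (x, y) \<in> G'" by metis
  show ?thesis
  proof (cases "degree g = 1")
    case True
    thus ?thesis using g(3) by (auto simp: G_def)
  next
    case False
    hence "degree g > 1" using g(2) by simp
    from separable_closure_two_roots[OF S g(1) this] obtain y where y: "poly g y = 0" "y \<noteq> x" by blast
    obtain G' where "partial_automorphism f G'" "(x, y) \<in> G'" using g(4)[OF y(1)] by blast
    from partial_automorphism_extends[OF S this(1)] this(2)
    obtain \<sigma> where "\<sigma> \<in> galois_group f" "\<sigma> x = y" by fast
    thus ?thesis using fixed y(2) by auto
  qed
qed

section \<open>Finite bases and the norm\<close>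

text \<open>
  Bases as indexed families instead of sets or lists: tensor products and towers then give bases by explicit
  formulas, and the coordinates of a vector are a function of the index.
\<close>
definition finite_basis :: "('r::comm_ring_1 \<Rightarrow> 'a::comm_ring_1) \<Rightarrow> 'i set \<Rightarrow> ('i \<Rightarrow> 'a) \<Rightarrow> bool"
  where "finite_basis f I b \<longleftrightarrow> finite I \<and> (\<forall>x. \<exists>c. x = (\<Sum>i\<in>I. f (c i) * b i)) \<and>
    (\<forall>c. (\<Sum>i\<in>I. f (c i) * b i) = 0 \<longrightarrow> (\<forall>i\<in>I. c i = 0))"

lemma module_alg_scale:
  assumes "comm_ring_hom f" shows "Modules.module (alg_scale f)"
proof -
  interpret comm_ring_hom f by fact
  show ?thesis by unfold_locales (auto simp: algebra_simps hom_add hom_mult)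
qed

lemma finite_basis_coords:
  assumes "finite_basis f I b"
  obtains c where "\<And>x. x = (\<Sum>i\<in>I. f (c x i) * b i)"
  using assms unfolding finite_basis_def by metis

lemma finite_basis_coeff_eq:
  assumes "comm_ring_hom f" "finite_basis f I b"
    and "(\<Sum>i\<in>I. f (c i) * b i) = (\<Sum>i\<in>I. f (d i) * b i)" "i \<in> I"
  shows "c i = d i"
proof -
  interpret comm_ring_hom f by fact
  have "(\<Sum>i\<in>I. f (c i - d i) * b i) = 0"
    using assms(3) by (simp add: hom_minus left_diff_distrib sum_subtractf)
  hence "c i - d i = 0" using assms(2,4) unfolding finite_basis_def
    by (elim conjE allE[of _ "\<lambda>i. c i - d i"]) simp
  thus ?thesis by simp
qed

lemma finite_basis_inj:
  fixes f :: "'r::comm_ring_1 \<Rightarrow> 'a::comm_ring_1"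
  assumes "comm_ring_hom f" "finite_basis f I b" shows "inj_on b I"
proof (rule inj_onI, rule ccontr)
  interpret comm_ring_hom f by fact
  fix i j assume ij: "i \<in> I" "j \<in> I" "b i = b j" "i \<noteq> j"
  have I: "finite I" using assms(2) by (simp add: finite_basis_def)
  have delta: "(\<Sum>k\<in>I. f (if k = l then 1 else 0) * b k) = b l" if "l \<in> I" for l
  proof -
    have "(\<Sum>k\<in>I. f (if k = l then 1 else 0) * b k) = (\<Sum>k\<in>I. if k = l then b k else 0)"
      by (intro sum.cong) auto
    thus ?thesis using I that by simp
  qed
  have "(\<lambda>k. if k = i then 1 else 0) i = (\<lambda>k. if k = j then 1 else 0 :: 'r) i"
    using delta ij by (intro finite_basis_coeff_eq[OF assms]) auto
  thus False using ij(4) by simp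
qed

lemma finite_basis_iff_span_independent:
  assumes f: "comm_ring_hom f" and I: "finite I" and inj: "inj_on b I"
  shows "finite_basis f I b \<longleftrightarrow> \<not> module.dependent (alg_scale f) (b ` I) \<and> module.span (alg_scale f) (b ` I) = UNIV"
proof -
  interpret M: Modules.module "alg_scale f" by (rule module_alg_scale[OF f])
  have sum: "(\<Sum>v\<in>b ` I. f (u v) * v) = (\<Sum>i\<in>I. f (u (b i)) * b i)" for u
    using inj by (simp add: sum.reindex)
  have inv: "(\<Sum>i\<in>I. f (c i) * b i) = (\<Sum>i\<in>I. f ((c \<circ> the_inv_into I b) (b i)) * b i)" for c
    using inj by (intro sum.cong) (auto simp: the_inv_into_f_f)
  have "M.span (b ` I) = UNIV \<longleftrightarrow> (\<forall>x. \<exists>c. x = (\<Sum>i\<in>I. f (c i) * b i))" (is "_ \<longleftrightarrow> ?S")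
  proof
    assume "M.span (b ` I) = UNIV"
    hence UNIV: "range (\<lambda>u. \<Sum>v\<in>b ` I. f (u v) * v) = UNIV"
      using M.span_finite[of "b ` I"] I by simp
    show ?S
    proof
      fix x
      have "x \<in> range (\<lambda>u. \<Sum>v\<in>b ` I. f (u v) * v)" unfolding UNIV by simp
      then obtain u where "x = (\<Sum>i\<in>I. f (u (b i)) * b i)" unfolding sum by (rule rangeE)
      thus "\<exists>c. x = (\<Sum>i\<in>I. f (c i) * b i)" by (rule exI[of _ "\<lambda>i. u (b i)"])
    qed
  next
    assume S: ?S
    have "x \<in> range (\<lambda>u. \<Sum>v\<in>b ` I. f (u v) * v)" for x
    proof -
      obtain c where "x = (\<Sum>i\<in>I. f (c i) * b i)" using S by blast
      thus ?thesis unfolding sum by (subst (asm) inv) blast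
    qed
    thus "M.span (b ` I) = UNIV" using M.span_finite[of "b ` I"] I by auto
  qed
  moreover have "\<not> M.dependent (b ` I) \<longleftrightarrow> (\<forall>c. (\<Sum>i\<in>I. f (c i) * b i) = 0 \<longrightarrow> (\<forall>i\<in>I. c i = 0))"
    (is "?A \<longleftrightarrow> ?B")
  proof
    assume A: ?A
    show ?B
    proof (intro allI impI ballI)
      fix c i assume c: "(\<Sum>i\<in>I. f (c i) * b i) = 0" and i: "i \<in> I"
      have "(\<Sum>v\<in>b ` I. f ((c \<circ> the_inv_into I b) v) * v) = 0"
        unfolding sum using c inv[of c] by simp
      hence "(c \<circ> the_inv_into I b) (b i) = 0" using A M.dependent_finite[of "b ` I"] I i by blast
      thus "c i = 0" using inj i by (simp add: the_inv_into_f_f)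
    qed
  next
    assume ?B
    thus ?A using M.dependent_finite[of "b ` I"] I sum by auto
  qed
  ultimately show ?thesis using I unfolding finite_basis_def by blast
qed

lemma alg_basis_iff_finite_basis:
  assumes f: "comm_ring_hom f"
  shows "alg_basis f bs \<longleftrightarrow> finite_basis f {..<length bs} ((!) bs)"
proof -
  have im: "(!) bs ` {..<length bs} = set bs"
    by (auto simp: set_conv_nth)
  have d: "distinct bs \<longleftrightarrow> inj_on ((!) bs) {..<length bs}"
    by (auto simp: distinct_conv_nth inj_on_def)
  show ?thesis
    unfolding alg_basis_def d
    using finite_basis_iff_span_independent[OF f, of "{..<length bs}" "(!) bs"] im
      finite_basis_inj[OF f, of "{..<length bs}" "(!) bs"] by auto
qed

lemma finite_basis_imp_alg_basis:
  fixes n :: nat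
  assumes f: "comm_ring_hom f" and b: "finite_basis f {..<n} b"
  shows "alg_basis f (map b [0..<n])"
proof -
  have "finite_basis f {..<n} (\<lambda>i. map b [0..<n] ! i) = finite_basis f {..<n} b"
    unfolding finite_basis_def by (intro conj_cong refl all_cong ex_cong) (auto intro!: sum.cong)
  thus ?thesis using b alg_basis_iff_finite_basis[OF f, of "map b [0..<n]"] by simp
qed

lemma mult_matrix_spec:
  assumes f: "comm_ring_hom f" and bs: "alg_basis f bs" and j: "j < length bs"
  shows "x * bs ! j = (\<Sum>i<length bs. f (mult_matrix f bs x $$ (i, j)) * bs ! i)"
proof -
  interpret M: Modules.module "alg_scale f" by (rule module_alg_scale[OF f])
  let ?r = "M.representation (set bs) (x * bs ! j)"
  have inj: "inj_on ((!) bs) {..<length bs}" using bs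
    by (auto simp: alg_basis_def distinct_conv_nth inj_on_def)
  have im: "(!) bs ` {..<length bs} = set bs"
    by (auto simp: set_conv_nth)
  have "x * bs ! j = (\<Sum>v\<in>set bs. f (?r v) * v)"
    using bs by (intro M.sum_representation_eq[symmetric]) (auto simp: alg_basis_def)
  also have "\<dots> = (\<Sum>i<length bs. f (?r (bs ! i)) * bs ! i)"
    using inj by (simp add: im[symmetric] sum.reindex)
  finally show ?thesis using j by (simp add: mult_matrix_def)
qed

text \<open>
  The matrix-vector product in terms of families.
\<close>
lemma sum_linear_combinations:
  assumes f: "comm_ring_hom f"
  shows "(\<Sum>j\<in>J. f (c j) * (\<Sum>i\<in>I. f (P i j) * b i)) = (\<Sum>i\<in>I. f (\<Sum>j\<in>J. P i j * c j) * b i)"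
proof -
  interpret comm_ring_hom f by fact
  have "(\<Sum>j\<in>J. f (c j) * (\<Sum>i\<in>I. f (P i j) * b i)) = (\<Sum>j\<in>J. \<Sum>i\<in>I. f (P i j * c j) * b i)"
    by (simp add: sum_distrib_left hom_mult mult_ac)
  also have "\<dots> = (\<Sum>i\<in>I. \<Sum>j\<in>J. f (P i j * c j) * b i)" by (rule sum.swap)
  finally show ?thesis by (simp add: hom_sum sum_distrib_right)
qed

lemma mat_times_mat:
  "Matrix.mat m n (\<lambda>(i, j). A i j) * Matrix.mat n l (\<lambda>(i, j). B i j)
    = Matrix.mat m l (\<lambda>(i, j). \<Sum>k<n. A i k * B k j)"
  by (rule eq_matI) (auto simp: scalar_prod_def lessThan_atLeast0)

lemma finite_basis_transition:
  fixes n m :: nat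
  assumes f: "comm_ring_hom f" and b: "finite_basis f {..<n} b" and b': "finite_basis f {..<m} b'"
    and P: "\<And>j. j < n \<Longrightarrow> b j = (\<Sum>i<m. f (P i j) * b' i)"
    and Q: "\<And>j. j < m \<Longrightarrow> b' j = (\<Sum>i<n. f (Q i j) * b i)"
  shows "Matrix.mat n m (\<lambda>(i, j). Q i j) * Matrix.mat m n (\<lambda>(i, j). P i j) = 1\<^sub>m n"
proof -
  interpret comm_ring_hom f by fact
  have "(\<Sum>k<m. Q i k * P k j) = (if i = j then 1 else 0)" if "i < n" "j < n" for i j
  proof (rule finite_basis_coeff_eq[OF f b, of "\<lambda>i. \<Sum>k<m. Q i k * P k j" "\<lambda>i. if i = j then 1 else 0"])
    show "(\<Sum>i<n. f (\<Sum>k<m. Q i k * P k j) * b i) = (\<Sum>i<n. f (if i = j then 1 else 0) * b i)"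
    proof -
      have "(\<Sum>i<n. f (if i = j then 1 else 0) * b i) = (\<Sum>i<n. if i = j then b i else 0)"
        by (intro sum.cong) auto
      also have "\<dots> = b j" using that by simp
      also have "b j = (\<Sum>k<m. f (P k j) * (\<Sum>i<n. f (Q i k) * b i))"
        using P[OF that(2)] Q by simp
      finally show ?thesis unfolding sum_linear_combinations[OF f] by simp
    qed
  qed (use that in auto)
  thus ?thesis unfolding mat_times_mat by (intro eq_matI) auto
qed

text \<open>
  Invariance of the rank over a commutative ring. If \<open>m < n\<close>, both factors are padded with zeros to square
  matrices; the product remains \<open>1\<close>, although the padded \<open>P\<close> has a zero row and thus determinant \<open>0\<close>.
\<close>
lemma invertible_matrix_not_wide:
  fixes Q P :: "nat \<Rightarrow> nat \<Rightarrow> 'r::comm_ring_1"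
  assumes "Matrix.mat n m (\<lambda>(i, j). Q i j) * Matrix.mat m n (\<lambda>(i, j). P i j) = 1\<^sub>m n"
  shows "n \<le> m"
proof (rule ccontr)
  assume "\<not> n \<le> m"
  hence mn: "m < n" by simp
  define Q' where "Q' i j = (if j < m then Q i j else 0)" for i j
  define P' where "P' i j = (if i < m then P i j else 0)" for i j
  let ?Q = "Matrix.mat n n (\<lambda>(i, j). Q' i j)" and ?P = "Matrix.mat n n (\<lambda>(i, j). P' i j)"
  have s: "(\<Sum>k<n. Q' i k * P' k j) = (\<Sum>k<m. Q i k * P k j)" for i j
    using mn by (intro sum.mono_neutral_cong_right) (auto simp: Q'_def P'_def)
  have "?Q * ?P = 1\<^sub>m n" unfolding mat_times_mat s using assms unfolding mat_times_mat .
  hence "det ?Q * det ?P = 1" by (subst det_mult[symmetric]) auto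
  moreover have "det ?P = 0"
    by (subst laplace_expansion_row[of _ n "m"]) (auto simp: mn P'_def)
  ultimately show False by simp
qed

text \<open>
  The norm may be computed with every basis: the matrix \<open>M\<close> of the multiplication in the given basis is
  conjugate, by the transition matrices, to the one for the basis chosen in the definition of the norm.
\<close>
lemma alg_norm_eq_det:
  fixes n :: nat
  assumes f: "comm_ring_hom f" and b: "finite_basis f {..<n} b"
    and M: "\<And>j. j < n \<Longrightarrow> x * b j = (\<Sum>i<n. f (M i j) * b i)"
  shows "alg_norm f x = det (Matrix.mat n n (\<lambda>(i, j). M i j))"
proof -
  interpret comm_ring_hom f by fact
  define bs where "bs = (SOME bs. alg_basis f bs)"
  have bs: "alg_basis f bs" unfolding bs_def
    using finite_basis_imp_alg_basis[OF f b] by (rule someI)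
  define m where "m = length bs"
  define b' where "b' = (!) bs"
  have b': "finite_basis f {..<m} b'"
    using bs unfolding alg_basis_iff_finite_basis[OF f] m_def b'_def .
  define N where "N i j = mult_matrix f bs x $$ (i, j)" for i j
  have N: "x * b' j = (\<Sum>i<m. f (N i j) * b' i)" if "j < m" for j
    using mult_matrix_spec[OF f bs] that unfolding m_def b'_def N_def by blast
  obtain c where c: "\<And>x. x = (\<Sum>i<n. f (c x i) * b i)" using finite_basis_coords[OF b] by blast
  obtain c' where c': "\<And>x. x = (\<Sum>i<m. f (c' x i) * b' i)" using finite_basis_coords[OF b'] by blast
  define P where "P i j = c' (b j) i" for i j
  define Q where "Q i j = c (b' j) i" for i j
  have P: "b j = (\<Sum>i<m. f (P i j) * b' i)" for j unfolding P_def by (rule c')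
  have Q: "b' j = (\<Sum>i<n. f (Q i j) * b i)" for j unfolding Q_def by (rule c)
  have QP: "Matrix.mat n m (\<lambda>(i, j). Q i j) * Matrix.mat m n (\<lambda>(i, j). P i j) = 1\<^sub>m n"
    by (rule finite_basis_transition[OF f b b' P Q])
  have PQ: "Matrix.mat m n (\<lambda>(i, j). P i j) * Matrix.mat n m (\<lambda>(i, j). Q i j) = 1\<^sub>m m"
    by (rule finite_basis_transition[OF f b' b Q P])
  have mn: "m = n" using invertible_matrix_not_wide[OF PQ] invertible_matrix_not_wide[OF QP] by simp
  have "(\<Sum>k<n. N i k * P k j) = (\<Sum>k<n. P i k * M k j)" if ij: "i < n" "j < n" for i j
  proof (rule finite_basis_coeff_eq[OF f b', unfolded mn,
        of "\<lambda>i. \<Sum>k<n. N i k * P k j" "\<lambda>i. \<Sum>k<n. P i k * M k j"])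
    have "x * b j = (\<Sum>k<n. f (P k j) * (\<Sum>i<n. f (N i k) * b' i))"
      by (subst P[of j]) (simp add: sum_distrib_left mult.left_commute[of x] N mn)
    moreover have "x * b j = (\<Sum>k<n. f (M k j) * (\<Sum>i<n. f (P i k) * b' i))"
      unfolding M[OF ij(2)] using P mn by simp
    ultimately show "(\<Sum>i<n. f (\<Sum>k<n. N i k * P k j) * b' i) = (\<Sum>i<n. f (\<Sum>k<n. P i k * M k j) * b' i)"
      unfolding sum_linear_combinations[OF f] by simp
  qed (use ij in auto)
  hence "Matrix.mat n n (\<lambda>(i, j). N i j) * Matrix.mat n n (\<lambda>(i, j). P i j)
      = Matrix.mat n n (\<lambda>(i, j). P i j) * Matrix.mat n n (\<lambda>(i, j). M i j)" (is "?N * ?P = _ * ?M")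
    unfolding mat_times_mat by (intro eq_matI) auto
  hence "det (?N * ?P) = det (?P * ?M)" by simp
  hence NM: "det ?N * det ?P = det ?P * det ?M" by (simp add: det_mult[of _ n])
  let ?Q = "Matrix.mat n n (\<lambda>(i, j). Q i j)"
  have "det (?P * ?Q) = 1" using PQ mn by simp
  hence PQ1: "det ?P * det ?Q = 1" by (simp add: det_mult[of _ n])
  have "det ?N = (det ?N * det ?P) * det ?Q" unfolding mult.assoc PQ1 by (rule mult_1_right[symmetric])
  also have "\<dots> = det ?M * (det ?P * det ?Q)" unfolding NM by (simp only: ac_simps)
  finally have "det ?N = det ?M" unfolding PQ1 by (simp only: mult_1_right)
  moreover have "mult_matrix f bs x = ?N" unfolding N_def
    using mn unfolding m_def by (intro eq_matI) (auto simp: mult_matrix_def)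
  ultimately show ?thesis unfolding alg_norm_def bs_def[symmetric] by simp
qed

lemma finite_basis_mult_coords:
  assumes "finite_basis f I b"
  obtains M where "\<And>x j. x * b j = (\<Sum>i\<in>I. f (M x i j) * b i)"
proof -
  obtain c where "\<And>x. x = (\<Sum>i\<in>I. f (c x i) * b i)" using finite_basis_coords[OF assms] by blast
  hence "x * b j = (\<Sum>i\<in>I. f (c (x * b j) i) * b i)" for x j by blast
  thus thesis by (rule that)
qed

lemma alg_norm_mult:
  fixes n :: nat
  assumes f: "comm_ring_hom f" and b: "finite_basis f {..<n} b"
  shows "alg_norm f (x * y) = alg_norm f x * alg_norm f y"
proof -
  obtain M where M: "\<And>x j. x * b j = (\<Sum>i<n. f (M x i j) * b i)"
    using finite_basis_mult_coords[OF b] by blast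
  have "x * y * b j = (\<Sum>i<n. f (\<Sum>k<n. M x i k * M y k j) * b i)" for j
  proof -
    have "x * y * b j = (\<Sum>k<n. f (M y k j) * (x * b k))"
      unfolding mult.assoc M[of y] by (simp add: sum_distrib_left mult.left_commute)
    thus ?thesis unfolding M[of x] sum_linear_combinations[OF f] .
  qed
  from alg_norm_eq_det[OF f b this] show ?thesis
    unfolding alg_norm_eq_det[OF f b M] mat_times_mat[symmetric] by (simp add: det_mult[of _ n])
qed

text \<open>
  A semilinear map which carries a basis to a basis transports the whole multiplication table. The cases
  \<open>f = f'\<close> (automorphisms) and \<open>h\<close> a base change map are the ones of interest.
\<close>
lemma alg_norm_hom:
  fixes n :: nat
  assumes f: "comm_ring_hom f" and b: "finite_basis f {..<n} b"
    and f': "comm_ring_hom f'" and b': "finite_basis f' {..<n} b'"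
    and h: "comm_ring_hom h" and g: "comm_ring_hom g"
    and hf: "\<And>c. h (f c) = f' (g c)" and hb: "\<And>i. i < n \<Longrightarrow> h (b i) = b' i"
  shows "alg_norm f' (h x) = g (alg_norm f x)"
proof -
  interpret h: comm_ring_hom h by fact
  interpret g: comm_ring_hom g by fact
  obtain M where M: "\<And>x j. x * b j = (\<Sum>i<n. f (M x i j) * b i)"
    using finite_basis_mult_coords[OF b] by blast
  have "h x * b' j = (\<Sum>i<n. f' (g (M x i j)) * b' i)" if "j < n" for j
    using arg_cong[OF M[of x j], of h] that by (simp add: h.hom_mult h.hom_sum hf hb)
  from alg_norm_eq_det[OF f' b' this]
  moreover have "Matrix.mat n n (\<lambda>(i, j). g (M x i j)) = map_mat g (Matrix.mat n n (\<lambda>(i, j). M x i j))"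
    by (intro eq_matI) auto
  ultimately have "alg_norm f' (h x) = det (map_mat g (Matrix.mat n n (\<lambda>(i, j). M x i j)))"
    by simp
  thus ?thesis using alg_norm_eq_det[OF f b M] by (simp add: g.hom_det)
qed

lemma alg_norm_scalar:
  fixes n :: nat
  assumes f: "comm_ring_hom f" and b: "finite_basis f {..<n} b"
  shows "alg_norm f (f c) = c ^ n"
proof -
  interpret comm_ring_hom f by fact
  have "f c * b j = (\<Sum>i<n. f (if i = j then c else 0) * b i)" if "j < n" for j
  proof -
    have "(\<Sum>i<n. f (if i = j then c else 0) * b i) = (\<Sum>i<n. if i = j then f c * b i else 0)"
      by (intro sum.cong) auto
    thus ?thesis using that by simp
  qed
  from alg_norm_eq_det[OF f b this]
  moreover have "Matrix.mat n n (\<lambda>(i, j). if i = j then c else 0) = c \<cdot>\<^sub>m 1\<^sub>m n"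
    by (intro eq_matI) auto
  ultimately show ?thesis by simp
qed

lemma alg_norm_one:
  fixes n :: nat
  assumes "comm_ring_hom f" "finite_basis f {..<n} b"
  shows "alg_norm f 1 = 1"
proof -
  interpret comm_ring_hom f by fact
  show ?thesis using alg_norm_scalar[OF assms, of 1] by simp
qed

lemma alg_dim_finite_basis:
  assumes f: "comm_ring_hom (f :: 'k::field \<Rightarrow> 'a::comm_ring_1)" and n: "alg_dim f = n" "n > 0"
  shows "\<exists>b. finite_basis f {..<n} b"
proof -
  interpret V: vector_space "alg_scale f" by (rule vector_space_alg_scale[OF f])
  obtain B where B: "V.independent B" "UNIV \<subseteq> V.span B" "card B = V.dim UNIV"
    by (rule V.basis_exists[of UNIV]) blast
  have cB: "card B = n" using B(3) n unfolding alg_dim_def by simp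
  hence "finite B" using n(2) card_ge_0_finite by metis
  then obtain b where b: "bij_betw b {..<n} B"
    using cB ex_bij_betw_nat_finite lessThan_atLeast0 by metis
  hence "inj_on b {..<n}" "b ` {..<n} = B" by (auto simp: bij_betw_def)
  thus ?thesis using finite_basis_iff_span_independent[OF f, of "{..<n}" b] B by auto
qed

section \<open>Tensor products\<close>

lemma finite_basis_coords_linear:
  assumes f: "comm_ring_hom f" and b: "finite_basis f I b"
  obtains c where "\<And>x. x = (\<Sum>i\<in>I. f (c x i) * b i)"
    "\<And>x y i. i \<in> I \<Longrightarrow> c (x + y) i = c x i + c y i"
    "\<And>a x i. i \<in> I \<Longrightarrow> c (f a * x) i = a * c x i"
    "\<And>i j. i \<in> I \<Longrightarrow> j \<in> I \<Longrightarrow> c (b j) i = (if i = j then 1 else 0)"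
proof -
  interpret comm_ring_hom f by fact
  obtain c where c: "\<And>x. x = (\<Sum>i\<in>I. f (c x i) * b i)" using finite_basis_coords[OF b] by blast
  note eqI = finite_basis_coeff_eq[OF f b]
  have "c (x + y) i = c x i + c y i" if "i \<in> I" for x y i
  proof (rule eqI[of "c (x + y)" "\<lambda>i. c x i + c y i", OF _ that])
    have "(\<Sum>i\<in>I. f (c x i + c y i) * b i) = (\<Sum>i\<in>I. f (c x i) * b i) + (\<Sum>i\<in>I. f (c y i) * b i)"
      by (simp add: hom_add distrib_right sum.distrib)
    thus "(\<Sum>i\<in>I. f (c (x + y) i) * b i) = (\<Sum>i\<in>I. f (c x i + c y i) * b i)"
      unfolding c[symmetric] by (rule sym)
  qed
  moreover have "c (f a * x) i = a * c x i" if "i \<in> I" for a x i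
  proof (rule eqI[of "c (f a * x)" "\<lambda>i. a * c x i", OF _ that])
    have "(\<Sum>i\<in>I. f (a * c x i) * b i) = f a * (\<Sum>i\<in>I. f (c x i) * b i)"
      by (simp add: hom_mult sum_distrib_left mult.assoc)
    thus "(\<Sum>i\<in>I. f (c (f a * x) i) * b i) = (\<Sum>i\<in>I. f (a * c x i) * b i)"
      unfolding c[symmetric] by simp
  qed
  moreover have "c (b j) i = (if i = j then 1 else 0)" if "i \<in> I" "j \<in> I" for i j
  proof (rule eqI[of "c (b j)" "\<lambda>i. if i = j then 1 else 0", OF _ that(1)])
    have "(\<Sum>i\<in>I. f (if i = j then 1 else 0) * b i) = (\<Sum>i\<in>I. if i = j then b i else 0)"
      by (intro sum.cong) auto
    also have "\<dots> = b j" using that b by (simp add: finite_basis_def)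
    finally show "(\<Sum>i\<in>I. f (c (b j) i) * b i) = (\<Sum>i\<in>I. f (if i = j then 1 else 0) * b i)"
      unfolding c[symmetric] by simp
  qed
  ultimately show thesis using that c by blast
qed

lemma finite_basis_tower:
  assumes f: "comm_ring_hom f" and g: "comm_ring_hom g"
    and b: "finite_basis g I b" and c: "finite_basis f J c"
  shows "finite_basis (g \<circ> f) (I \<times> J) (\<lambda>(i, j). g (c j) * b i)"
  unfolding finite_basis_def
proof (intro conjI allI impI ballI)
  interpret f: comm_ring_hom f by fact
  interpret g: comm_ring_hom g by fact
  show "finite (I \<times> J)" using b c by (simp add: finite_basis_def)
  have eq: "(\<Sum>p\<in>I \<times> J. (g \<circ> f) (d p) * (case p of (i, j) \<Rightarrow> g (c j) * b i))
      = (\<Sum>i\<in>I. g (\<Sum>j\<in>J. f (d (i, j)) * c j) * b i)" for d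
  proof -
    have "(\<Sum>i\<in>I. g (\<Sum>j\<in>J. f (d (i, j)) * c j) * b i) = (\<Sum>i\<in>I. \<Sum>j\<in>J. g (f (d (i, j))) * g (c j) * b i)"
      by (simp only: g.hom_sum g.hom_mult sum_distrib_right)
    also have "\<dots> = (\<Sum>(i, j)\<in>I \<times> J. g (f (d (i, j))) * g (c j) * b i)"
      by (rule sum.cartesian_product)
    finally show ?thesis by (auto intro: sum.cong simp: mult.assoc)
  qed
  show "\<exists>d. x = (\<Sum>p\<in>I \<times> J. (g \<circ> f) (d p) * (case p of (i, j) \<Rightarrow> g (c j) * b i))" for x
  proof -
    obtain u where u: "\<And>x. x = (\<Sum>i\<in>I. g (u x i) * b i)" using finite_basis_coords[OF b] by blast
    obtain v where v: "\<And>x. x = (\<Sum>j\<in>J. f (v x j) * c j)" using finite_basis_coords[OF c] by blast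
    have "x = (\<Sum>i\<in>I. g (\<Sum>j\<in>J. f (v (u x i) j) * c j) * b i)"
      unfolding v[symmetric] by (rule u)
    thus ?thesis unfolding eq by (intro exI[of _ "\<lambda>(i, j). v (u x i) j"]) simp
  qed
  fix d p assume 0: "(\<Sum>p\<in>I \<times> J. (g \<circ> f) (d p) * (case p of (i, j) \<Rightarrow> g (c j) * b i)) = 0"
    and p: "p \<in> I \<times> J"
  note 0 = 0[unfolded eq]
  have "\<forall>i\<in>I. (\<Sum>j\<in>J. f (d (i, j)) * c j) = 0"
    using b 0 unfolding finite_basis_def
    by (elim conjE allE[of _ "\<lambda>i. \<Sum>j\<in>J. f (d (i, j)) * c j"]) simp
  hence "(\<Sum>j\<in>J. f (d (fst p, j)) * c j) = 0" using p by auto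
  hence "\<forall>j\<in>J. d (fst p, j) = 0"
    using c unfolding finite_basis_def by (elim conjE allE[of _ "\<lambda>j. d (fst p, j)"]) simp
  thus "d p = 0" using p by auto
qed

lemma is_tensor_product_homs:
  assumes "is_tensor_product f g i j"
  shows "comm_ring_hom f" "comm_ring_hom g" "comm_ring_hom i" "comm_ring_hom j" "i (f c) = j (g c)"
  using assms by (simp_all add: is_tensor_product_def)

lemma comm_ring_hom_comp:
  "comm_ring_hom f \<Longrightarrow> comm_ring_hom g \<Longrightarrow> comm_ring_hom (g \<circ> f)"
proof -
  assume "comm_ring_hom f" "comm_ring_hom g"
  then interpret f: comm_ring_hom f + g: comm_ring_hom g by simp_all
  show ?thesis by unfold_locales (auto simp: f.hom_add f.hom_mult g.hom_add g.hom_mult)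
qed

lemma comm_ring_hom_id: "comm_ring_hom id"
  by unfold_locales auto

text \<open>
  The pure tensors span: otherwise a nonzero functional would vanish on all of them, against the uniqueness
  part of the universal property.
\<close>
lemma tensor_product_induct:
  assumes T: "is_tensor_product (f :: 'k::field \<Rightarrow> 'a::comm_ring_1) (g :: 'k \<Rightarrow> 'b::comm_ring_1)
      (i :: 'a \<Rightarrow> 't::comm_ring_1) j"
    and pure: "\<And>a b. P (i a * j b)" and add: "\<And>x y. P x \<Longrightarrow> P y \<Longrightarrow> P (x + y)"
  shows "P t"
proof -
  interpret f: comm_ring_hom f by (rule is_tensor_product_homs[OF T])
  interpret i: comm_ring_hom i by (rule is_tensor_product_homs[OF T])
  interpret j: comm_ring_hom j by (rule is_tensor_product_homs[OF T])
  have if': "comm_ring_hom (i \<circ> f)"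
    by (intro comm_ring_hom_comp f.comm_ring_hom_axioms i.comm_ring_hom_axioms)
  interpret V: vector_space "alg_scale (i \<circ> f)" by (rule vector_space_alg_scale[OF if'])
  interpret k: vector_space "(*) :: 'k \<Rightarrow> 'k \<Rightarrow> 'k" by (rule vector_space_field)
  define S where "S = range (\<lambda>(a, b). i a * j b)"
  have "t \<in> V.span S"
  proof (rule ccontr)
    assume "t \<notin> V.span S"
    from ex_functional[OF V.vector_space_axioms this]
    obtain h :: "'t \<Rightarrow> 'k" where h: "module_hom (alg_scale (i \<circ> f)) (*) h" "\<forall>x\<in>S. h x = 0" "h t \<noteq> 0"
      by blast
    have "alg_bilinear f g (*) (\<lambda>a b. 0 :: 'k)"
      unfolding alg_bilinear_def module_hom_iff
      by (intro conjI allI module_alg_scale is_tensor_product_homs[OF T] k.module_axioms) simp_all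
    hence ex: "\<exists>!h. module_hom (alg_scale (i \<circ> f)) (*) h \<and> (\<forall>a b. h (i a * j b) = (0 :: 'k))"
      using T unfolding is_tensor_product_def by blast
    have "module_hom (alg_scale (i \<circ> f)) (*) (\<lambda>_. 0 :: 'k)"
      using V.module_axioms k.module_axioms by (simp add: module_hom_iff)
    moreover have "\<forall>a b. h (i a * j b) = 0" using h(2) by (auto simp: S_def)
    ultimately have "h = (\<lambda>_. 0)" using h(1) by (intro ex1_unique[OF ex]) auto
    thus False using h(3) by simp
  qed
  thus ?thesis
  proof (induction rule: V.span_induct_alt)
    case base
    show ?case using pure[of 0 0] by simp
  next
    case (step c x y)
    then obtain a b where "x = i a * j b" by (auto simp: S_def)
    hence "(i \<circ> f) c * x = i (f c * a) * j b" by (simp add: i.hom_mult mult.assoc)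
    thus ?case using add[OF pure step.IH, of "f c * a" b] by simp
  qed
qed

text \<open>
  The linear map given by the universal property is multiplicative, since it is so on pure tensors.
\<close>
lemma tensor_product_hom:
  assumes T: "is_tensor_product (f :: 'k::field \<Rightarrow> 'a::comm_ring_1) (g :: 'k \<Rightarrow> 'b::comm_ring_1)
      (i :: 'a \<Rightarrow> 't::comm_ring_1) j"
    and \<phi>: "comm_ring_hom (\<phi> :: 'a \<Rightarrow> 'u::comm_ring_1)" and \<psi>: "comm_ring_hom \<psi>"
    and agree: "\<And>c. \<phi> (f c) = \<psi> (g c)"
  shows "\<exists>!h. comm_ring_hom h \<and> (\<forall>a b. h (i a * j b) = \<phi> a * \<psi> b)"
proof (rule ex_ex1I)
  interpret f: comm_ring_hom f by (rule is_tensor_product_homs[OF T])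
  interpret g: comm_ring_hom g by (rule is_tensor_product_homs[OF T])
  interpret i: comm_ring_hom i by (rule is_tensor_product_homs[OF T])
  interpret j: comm_ring_hom j by (rule is_tensor_product_homs[OF T])
  interpret \<phi>: comm_ring_hom \<phi> by fact
  interpret \<psi>: comm_ring_hom \<psi> by fact
  let ?s = "alg_scale (\<phi> \<circ> f)"
  have s: "vector_space ?s"
    by (intro vector_space_alg_scale comm_ring_hom_comp f.comm_ring_hom_axioms \<phi>)
  have "alg_bilinear f g ?s (\<lambda>a b. \<phi> a * \<psi> b)"
    unfolding alg_bilinear_def module_hom_iff
    by (intro conjI allI module_alg_scale is_tensor_product_homs[OF T] s[folded module_iff_vector_space])
      (simp_all add: \<phi>.hom_add \<phi>.hom_mult \<psi>.hom_add \<psi>.hom_mult agree algebra_simps)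
  from tensor_product_universal[OF T s this] obtain h
    where h: "module_hom (alg_scale (i \<circ> f)) ?s h" "\<And>a b. h (i a * j b) = \<phi> a * \<psi> b" by blast
  have add: "h (x + y) = h x + h y" for x y using h(1) by (simp add: module_hom_iff)
  have "h (x * y) = h x * h y" for x y
  proof (induction x rule: tensor_product_induct[OF T])
    case (1 a b)
    show ?case
    proof (induction y rule: tensor_product_induct[OF T])
      case (1 a' b')
      have "h (i a * j b * (i a' * j b')) = h (i (a * a') * j (b * b'))"
        by (simp add: i.hom_mult j.hom_mult mult_ac)
      thus ?case by (simp add: h(2) \<phi>.hom_mult \<psi>.hom_mult mult_ac)
    next
      case (2 x y)
      thus ?case by (simp only: distrib_left add)
    qed
  next
    case (2 x y)
    thus ?case by (simp only: distrib_right add)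
  qed
  moreover have "h 1 = 1" using h(2)[of 1 1] by simp
  moreover have "h 0 = 0" using add[of 0 0] by simp
  ultimately have "comm_ring_hom h" using add by unfold_locales auto
  thus "\<exists>h. comm_ring_hom h \<and> (\<forall>a b. h (i a * j b) = \<phi> a * \<psi> b)" using h(2) by blast
next
  fix h h'
  assume h: "comm_ring_hom h \<and> (\<forall>a b. h (i a * j b) = \<phi> a * \<psi> b)"
    and h': "comm_ring_hom h' \<and> (\<forall>a b. h' (i a * j b) = \<phi> a * \<psi> b)"
  interpret h: comm_ring_hom h using h by blast
  interpret h': comm_ring_hom h' using h' by blast
  show "h = h'"
  proof
    show "h t = h' t" for t
      by (induction t rule: tensor_product_induct[OF T]) (simp_all add: h h' h.hom_add h'.hom_add)
  qed
qed

lemma tensor_map: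
  assumes T: "is_tensor_product (f :: 'k::field \<Rightarrow> 'a::comm_ring_1) (g :: 'k \<Rightarrow> 'b::comm_ring_1)
      (i :: 'a \<Rightarrow> 't::comm_ring_1) j"
    and homs: "comm_ring_hom i'" "comm_ring_hom j'" "comm_ring_hom \<phi>" "comm_ring_hom \<psi>"
    and agree: "\<And>c. i' (\<phi> (f c)) = j' (\<psi> (g c))"
  shows tensor_map_hom: "comm_ring_hom (tensor_map i j i' j' \<phi> \<psi>)"
    and tensor_map_left: "tensor_map i j i' j' \<phi> \<psi> (i a) = i' (\<phi> a)"
    and tensor_map_right: "tensor_map i j i' j' \<phi> \<psi> (j b) = j' (\<psi> b)"
proof -
  interpret i: comm_ring_hom i by (rule is_tensor_product_homs[OF T])
  interpret j: comm_ring_hom j by (rule is_tensor_product_homs[OF T])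
  interpret i': comm_ring_hom i' by fact
  interpret j': comm_ring_hom j' by fact
  interpret \<phi>: comm_ring_hom \<phi> by fact
  interpret \<psi>: comm_ring_hom \<psi> by fact
  have "\<exists>!h. comm_ring_hom h \<and> (\<forall>a b. h (i a * j b) = (i' \<circ> \<phi>) a * (j' \<circ> \<psi>) b)"
    using agree by (intro tensor_product_hom[OF T] comm_ring_hom_comp homs) simp
  from theI'[OF this] have h: "comm_ring_hom (tensor_map i j i' j' \<phi> \<psi>)"
    "\<And>a b. tensor_map i j i' j' \<phi> \<psi> (i a * j b) = i' (\<phi> a) * j' (\<psi> b)"
    unfolding tensor_map_def comp_def by blast+
  show "comm_ring_hom (tensor_map i j i' j' \<phi> \<psi>)" by (rule h)
  show "tensor_map i j i' j' \<phi> \<psi> (i a) = i' (\<phi> a)" using h(2)[of a 1] by simp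
  show "tensor_map i j i' j' \<phi> \<psi> (j b) = j' (\<psi> b)" using h(2)[of 1 b] by simp
qed

text \<open>
  The family spans because the pure tensors do. It is independent because the coordinate functions of \<open>b\<close> extend
  to \<open>B\<close>-valued linear functions on the tensor product, by the universal property.
\<close>
lemma finite_basis_base_change:
  assumes T: "is_tensor_product (f :: 'k::field \<Rightarrow> 'a::comm_ring_1) (g :: 'k \<Rightarrow> 'b::comm_ring_1)
      (i :: 'a \<Rightarrow> 't::comm_ring_1) j"
    and b: "finite_basis f I b"
  shows "finite_basis j I (\<lambda>n. i (b n))"
proof -
  interpret f: comm_ring_hom f by (rule is_tensor_product_homs[OF T])
  interpret g: comm_ring_hom g by (rule is_tensor_product_homs[OF T])
  interpret i: comm_ring_hom i by (rule is_tensor_product_homs[OF T])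
  interpret j: comm_ring_hom j by (rule is_tensor_product_homs[OF T])
  obtain c where c: "\<And>x. x = (\<Sum>n\<in>I. f (c x n) * b n)"
    and c_add: "\<And>x y n. n \<in> I \<Longrightarrow> c (x + y) n = c x n + c y n"
    and c_scale: "\<And>a x n. n \<in> I \<Longrightarrow> c (f a * x) n = a * c x n"
    and c_b: "\<And>n m. n \<in> I \<Longrightarrow> m \<in> I \<Longrightarrow> c (b m) n = (if n = m then 1 else 0)"
    using finite_basis_coords_linear[OF f.comm_ring_hom_axioms b] by blast
  have I: "finite I" using b by (simp add: finite_basis_def)
  have "\<exists>d. t = (\<Sum>n\<in>I. j (d n) * i (b n))" for t
  proof (induction t rule: tensor_product_induct[OF T])
    case (1 a y)
    have "i a * j y = i (\<Sum>n\<in>I. f (c a n) * b n) * j y" using c[of a] by simp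
    also have "\<dots> = (\<Sum>n\<in>I. j (g (c a n) * y) * i (b n))"
      unfolding i.hom_sum sum_distrib_right
      by (intro sum.cong) (simp_all add: i.hom_mult j.hom_mult is_tensor_product_homs(5)[OF T] mult_ac)
    finally show ?case by (rule exI[of _ "\<lambda>n. g (c a n) * y"])
  next
    case (2 x y)
    then obtain d d' where "x = (\<Sum>n\<in>I. j (d n) * i (b n))" "y = (\<Sum>n\<in>I. j (d' n) * i (b n))" by blast
    hence "x + y = (\<Sum>n\<in>I. j (d n + d' n) * i (b n))" by (simp add: j.hom_add distrib_right sum.distrib)
    thus ?case by (intro exI)
  qed
  moreover have "d n = 0" if 0: "(\<Sum>n\<in>I. j (d n) * i (b n)) = 0" and n: "n \<in> I" for d n
  proof -
    have s: "vector_space (alg_scale g)" by (rule vector_space_alg_scale[OF g.comm_ring_hom_axioms])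
    have "alg_bilinear f g (alg_scale g) (\<lambda>a y. g (c a n) * y)"
      unfolding alg_bilinear_def module_hom_iff
      by (intro conjI allI module_alg_scale is_tensor_product_homs[OF T])
        (simp_all add: c_add[OF n] c_scale[OF n] c_scale[OF n, unfolded mult.commute[of "f _"]] g.hom_add g.hom_mult algebra_simps)
    from tensor_product_universal[OF T s this] obtain h
      where h: "module_hom (alg_scale (i \<circ> f)) (alg_scale g) h" "\<And>a y. h (i a * j y) = g (c a n) * y"
      by blast
    have "h (\<Sum>m\<in>I. j (d m) * i (b m)) = (\<Sum>m\<in>I. h (i (b m) * j (d m)))"
      by (simp add: module_hom.sum[OF h(1)] mult.commute)
    also have "\<dots> = (\<Sum>m\<in>I. if m = n then d m else 0)"
      unfolding h(2) using n by (intro sum.cong) (auto simp: c_b)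
    also have "\<dots> = d n" using n I by simp
    finally show ?thesis unfolding 0 by (simp add: module_hom.zero[OF h(1)])
  qed
  ultimately show ?thesis using I unfolding finite_basis_def by blast
qed

lemma field_hom_inj:
  assumes "comm_ring_hom (f :: 'k::field \<Rightarrow> 'a::comm_ring_1)" "f x = f y"
  shows "x = y"
proof (rule ccontr)
  interpret comm_ring_hom f by fact
  assume "x \<noteq> y"
  hence "f (x - y) * f (inverse (x - y)) = 1" unfolding hom_mult[symmetric] by simp
  thus False using assms(2) by (simp add: hom_minus)
qed

lemma tensor_product_left_inj:
  assumes T: "is_tensor_product (f :: 'k::field \<Rightarrow> 'a::comm_ring_1) (g :: 'k \<Rightarrow> 'b::comm_ring_1)
      (i :: 'a \<Rightarrow> 't::comm_ring_1) j"
    and b: "finite_basis f I b" and eq: "i x = i y"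
  shows "x = y"
proof -
  interpret f: comm_ring_hom f by (rule is_tensor_product_homs[OF T])
  interpret i: comm_ring_hom i by (rule is_tensor_product_homs[OF T])
  obtain c where c: "\<And>x. x = (\<Sum>n\<in>I. f (c x n) * b n)" using finite_basis_coords[OF b] by blast
  have ix: "i x = (\<Sum>n\<in>I. j (g (c x n)) * i (b n))" for x
    using arg_cong[OF c[of x], of i] by (simp add: i.hom_sum i.hom_mult is_tensor_product_homs(5)[OF T])
  have sums: "(\<Sum>n\<in>I. j (g (c x n)) * i (b n)) = (\<Sum>n\<in>I. j (g (c y n)) * i (b n))"
    unfolding ix[symmetric] by (rule eq)
  have "c x n = c y n" if "n \<in> I" for n
  proof (rule field_hom_inj[OF is_tensor_product_homs(2)[OF T]])
    show "g (c x n) = g (c y n)"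
      by (rule finite_basis_coeff_eq[OF is_tensor_product_homs(4)[OF T] finite_basis_base_change[OF T b],
          of "\<lambda>n. g (c x n)" "\<lambda>n. g (c y n)" n, OF sums that])
  qed
  hence "(\<Sum>n\<in>I. f (c x n) * b n) = (\<Sum>n\<in>I. f (c y n) * b n)" by (intro sum.cong) simp_all
  thus ?thesis unfolding c[symmetric] .
qed

section \<open>The adjoint in rank three\<close>

lemma det_3:
  "det (Matrix.mat 3 3 (\<lambda>(i, j). M i j)) =
    M 0 0 * (M 1 1 * M 2 2 - M 1 2 * M 2 1) - M 0 1 * (M 1 0 * M 2 2 - M 1 2 * M 2 0)
    + M 0 2 * (M 1 0 * M 2 1 - M 1 1 * (M 2 0 :: 'r::comm_ring_1))"
proof -
  have det1: "det (Matrix.mat (Suc 0) (Suc 0) F) = F (0, 0)" for F :: "nat \<times> nat \<Rightarrow> 'r"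
    using det_single[of "Matrix.mat (Suc 0) (Suc 0) F"] by simp
  have det2: "det (Matrix.mat (Suc (Suc 0)) (Suc (Suc 0)) F) = F (0, 0) * F (1, 1) - F (0, 1) * F (1, 0)"
    for F :: "nat \<times> nat \<Rightarrow> 'r"
    by (subst laplace_expansion_row[of _ "Suc (Suc 0)" 0]) (simp_all add: cofactor_def det1 mat_delete_def)
  let ?A = "Matrix.mat 3 3 (\<lambda>(i, j). M i j)"
  have "det ?A = (\<Sum>j<3. ?A $$ (0, j) * cofactor ?A 0 j)"
    by (intro laplace_expansion_row) auto
  thus ?thesis
    by (simp add: numeral_3_eq_3 cofactor_def det2 mat_delete_def numeral_2_eq_2 right_diff_distrib)
qed

text \<open>
  The difference \<open>d\<close> of two candidates is quadratic with \<open>x d(x) = 0\<close>. Comparing \<open>(x + y) d(x + y)\<close> with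
  \<open>(x - y) d(x - y)\<close> separates the terms of different degree, as 2 is invertible, and leaves
  \<open>x B(x, y) + y d(x) = 0\<close> and \<open>x d(y) + y B(x, y) = 0\<close> for the polar form \<open>B\<close>. For \<open>y = 1\<close> the second
  equation gives \<open>B(x, 1) = 0\<close>, and then the first one \<open>d(x) = 0\<close>.
\<close>
lemma quadratic_map_unique:
  fixes f :: "'r::comm_ring_1 \<Rightarrow> 'a::comm_ring_1"
  assumes f: "comm_ring_hom f" and two: "(2 :: 'r) dvd 1"
    and q: "quadratic_map f q" "\<And>x. x * q x = f (N x)"
    and q': "quadratic_map f q'" "\<And>x. x * q' x = f (N x)"
  shows "q = q'"
proof
  interpret comm_ring_hom f by fact
  obtain h :: 'r where h: "1 = 2 * h" using two by (rule dvdE)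
  have cancel: "y = 0" if "2 * y = 0" for y :: 'a
  proof -
    have "y = f (2 * h) * y" using h by simp
    also have "\<dots> = f h * (2 * y)" by (simp add: hom_mult hom_numeral mult_ac)
    finally show ?thesis using that by simp
  qed
  define d where "d x = q x - q' x" for x
  define B where "B x y = d (x + y) - d x - d y" for x y
  have d0: "x * d x = 0" for x using q(2)[of x] q'(2)[of x] by (simp add: d_def right_diff_distrib)
  have "q (f (-1) * y) = f ((-1)^2) * q y" "q' (f (-1) * y) = f ((-1)^2) * q' y" for y
    using q(1) q'(1) unfolding quadratic_map_def by blast+
  hence d_minus: "d (- y) = d y" for y by (simp add: d_def hom_uminus)
  have addB: "B x (- y) = - B x y" for x y
  proof -
    have lin: "module_hom (alg_scale f) (alg_scale f) (\<lambda>y. q (x + y) - q x - q y)"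
      "module_hom (alg_scale f) (alg_scale f) (\<lambda>y. q' (x + y) - q' x - q' y)"
      using q(1) q'(1) unfolding quadratic_map_def by blast+
    show ?thesis using module_hom.neg[OF lin(1), of y] module_hom.neg[OF lin(2), of y]
      by (simp add: B_def d_def algebra_simps)
  qed
  show "q x = q' x" for x
  proof -
    have plus: "(x + y) * (d x + d y + B x y) = 0" for x y
      using d0[of "x + y"] by (simp add: B_def)
    have minus: "(x - y) * (d x + d y - B x y) = 0" for x y
      using plus[of x "- y"] by (simp add: addB d_minus)
    have "2 * (x * B x y + y * d x)
        = (x + y) * (d x + d y + B x y) - (x - y) * (d x + d y - B x y) - 2 * (y * d y)" for x y
      by (simp add: algebra_simps)
    hence "2 * (x * B x y + y * d x) = 0" for x y unfolding plus minus d0 by simp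
    hence 1: "x * B x y + y * d x = 0" for x y by (rule cancel)
    have "2 * (x * d y + y * B x y)
        = (x + y) * (d x + d y + B x y) + (x - y) * (d x + d y - B x y) - 2 * (x * d x)" for x y
      by (simp add: algebra_simps)
    hence "2 * (x * d y + y * B x y) = 0" for x y unfolding plus minus d0 by simp
    hence 2: "x * d y + y * B x y = 0" for x y by (rule cancel)
    have "d 1 = 0" using d0[of 1] by simp
    hence "B x 1 = 0" using 2[of x 1] by simp
    hence "d x = 0" using 1[of x 1] by simp
    thus ?thesis by (simp add: d_def)
  qed
qed

text \<open>
  The vector \<open>(b0, b1, b2)\<close> is in the kernel of \<open>x - M\<close>, where \<open>M\<close> is the transpose of the matrix of the
  \<open>mij\<close>; hence it is annihilated by the determinant \<open>p\<close> of \<open>x - M\<close>. The coefficients below are the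
  cofactors.
\<close>
lemma cayley_hamilton_3:
  fixes x b0 b1 b2 :: "'a::comm_ring_1"
  assumes "x * b0 = m00 * b0 + m10 * b1 + m20 * b2"
    and "x * b1 = m01 * b0 + m11 * b1 + m21 * b2"
    and "x * b2 = m02 * b0 + m12 * b1 + m22 * b2"
  defines "p \<equiv> x * (x * x - (m00 + m11 + m22) * x
      + (m00 * m11 - m01 * m10 + m00 * m22 - m02 * m20 + m11 * m22 - m12 * m21))
      - (m00 * (m11 * m22 - m12 * m21) - m01 * (m10 * m22 - m12 * m20) + m02 * (m10 * m21 - m11 * m20))"
  shows "p * b0 = 0" "p * b1 = 0" "p * b2 = 0"
proof -
  define r0 where "r0 = x * b0 - (m00 * b0 + m10 * b1 + m20 * b2)"
  define r1 where "r1 = x * b1 - (m01 * b0 + m11 * b1 + m21 * b2)"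
  define r2 where "r2 = x * b2 - (m02 * b0 + m12 * b1 + m22 * b2)"
  have r: "r0 = 0" "r1 = 0" "r2 = 0" using assms(1-3) by (simp_all add: r0_def r1_def r2_def)
  have "p * b0 = ((x - m11) * (x - m22) - m12 * m21) * r0
      + (m10 * (x - m22) + m12 * 0 + m20 * m12) * r1
      + (m20 * (x - m11) + m10 * m21) * r2"
    unfolding p_def r0_def r1_def r2_def by (simp add: algebra_simps)
  thus "p * b0 = 0" unfolding r by simp
  have "p * b1 = ((x - m00) * (x - m22) - m02 * m20) * r1
      + (m01 * (x - m22) + m21 * m02) * r0
      + (m21 * (x - m00) + m01 * m20) * r2"
    unfolding p_def r0_def r1_def r2_def by (simp add: algebra_simps)
  thus "p * b1 = 0" unfolding r by simp
  have "p * b2 = ((x - m00) * (x - m11) - m01 * m10) * r2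
      + (m02 * (x - m11) + m12 * m01) * r0
      + (m12 * (x - m00) + m02 * m10) * r1"
    unfolding p_def r0_def r1_def r2_def by (simp add: algebra_simps)
  thus "p * b2 = 0" unfolding r by simp
qed

text \<open>
  The adjoint is \<open>x\<^sup>2 - t(x) x + s(x)\<close>, where \<open>t\<close> is the trace and \<open>s\<close> the sum of the principal minors of size two;
  the latter is polarized to a bilinear form, so that the map is visibly quadratic.
\<close>
lemma rank_3_adjoint_exists:
  assumes f: "comm_ring_hom f" and b: "finite_basis f {..<3::nat} b"
  shows "\<exists>q. quadratic_map f q \<and> (\<forall>x. x * q x = f (alg_norm f x))"
proof -
  interpret comm_ring_hom f by fact
  obtain c where c: "\<And>x. x = (\<Sum>i<3. f (c x i) * b i)"
    and c_add: "\<And>x y i. i \<in> {..<3} \<Longrightarrow> c (x + y) i = c x i + c y i"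
    and c_scale: "\<And>a x i. i \<in> {..<3} \<Longrightarrow> c (f a * x) i = a * c x i"
    by (rule finite_basis_coords_linear[OF f b]) (rule that)
  define m where "m x i j = c (x * b j) i" for x i j
  have m_add: "m (x + y) i j = m x i j + m y i j" if "i < 3" for x y i j
    using that by (simp add: m_def c_add distrib_right)
  have m_scale: "m (f a * x) i j = a * m x i j" if "i < 3" for a x i j
    using that by (simp add: m_def c_scale mult.assoc)
  have m: "x * b j = (\<Sum>i<3. f (m x i j) * b i)" for x j unfolding m_def by (rule c)
  have m3: "x * b j = f (m x 0 j) * b 0 + f (m x 1 j) * b 1 + f (m x 2 j) * b 2" for x j
    using m[of x j] by (simp add: numeral_3_eq_3 numeral_2_eq_2)
  define t where "t x = m x 0 0 + m x 1 1 + m x 2 2" for x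
  define s where "s x y = m x 0 0 * m y 1 1 - m x 0 1 * m y 1 0 + m x 0 0 * m y 2 2 - m x 0 2 * m y 2 0
    + m x 1 1 * m y 2 2 - m x 1 2 * m y 2 1" for x y
  have t_add: "t (x + y) = t x + t y" for x y by (simp add: t_def m_add)
  have t_scale: "t (f a * x) = a * t x" for a x by (simp add: t_def m_scale distrib_left)
  have s_add: "s (x + y) z = s x z + s y z" "s z (x + y) = s z x + s z y" for x y z
    by (simp_all add: s_def m_add algebra_simps)
  have s_scale: "s (f a * x) y = a * s x y" "s y (f a * x) = a * s y x" for a x y
    by (simp_all add: s_def m_scale) (simp_all add: algebra_simps)
  define q where "q x = x * x - f (t x) * x + f (s x x)" for x
  have polar: "q (x + y) - q x - q y = 2 * x * y - f (t x) * y - f (t y) * x + f (s x y) + f (s y x)" for x y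
    by (simp add: q_def t_add s_add hom_add algebra_simps)
  have "quadratic_map f q" unfolding quadratic_map_def polar module_hom_iff
  proof (intro conjI allI module_alg_scale[OF f])
    show "q (f a * x) = f (a ^ 2) * q x" for a x
      by (simp add: q_def t_scale s_scale hom_mult power2_eq_square) (simp add: algebra_simps)
  qed (simp_all add: t_add t_scale s_add s_scale hom_add hom_mult, simp_all add: algebra_simps)
  moreover have "x * q x = f (alg_norm f x)" for x
  proof -
    define p where "p = x * q x - f (alg_norm f x)"
    have N: "alg_norm f x = m x 0 0 * (m x 1 1 * m x 2 2 - m x 1 2 * m x 2 1)
        - m x 0 1 * (m x 1 0 * m x 2 2 - m x 1 2 * m x 2 0)
        + m x 0 2 * (m x 1 0 * m x 2 1 - m x 1 1 * m x 2 0)"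
      unfolding alg_norm_eq_det[OF f b m] by (rule det_3)
    have p: "p * b 0 = 0" "p * b 1 = 0" "p * b 2 = 0"
      using cayley_hamilton_3[OF m3[of x 0] m3[of x 1] m3[of x 2]]
      unfolding p_def q_def t_def s_def N by (simp_all add: hom_add hom_mult hom_minus)
    have "p = p * (f (c 1 0) * b 0 + f (c 1 1) * b 1 + f (c 1 2) * b 2)"
      using c[of 1] by (simp add: numeral_3_eq_3 numeral_2_eq_2)
    also have "\<dots> = f (c 1 0) * (p * b 0) + f (c 1 1) * (p * b 1) + f (c 1 2) * (p * b 2)"
      by (simp only: distrib_left mult.left_commute)
    finally show ?thesis unfolding p by (simp add: p_def)
  qed
  ultimately show ?thesis by blast
qed

lemma rank_3_adjoint:
  fixes f :: "'r::comm_ring_1 \<Rightarrow> 'a::comm_ring_1"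
  assumes f: "comm_ring_hom f" and two: "(2 :: 'r) dvd 1" and b: "finite_basis f {..<3::nat} b"
  shows "quadratic_map f (alg_adjoint f)" "x * alg_adjoint f x = f (alg_norm f x)"
proof -
  have "\<exists>!q. quadratic_map f q \<and> (\<forall>x. x * q x = f (alg_norm f x))"
    using rank_3_adjoint_exists[OF f b] quadratic_map_unique[OF f two, where N = "alg_norm f"] by (intro ex_ex1I) blast+
  from theI'[OF this] show "quadratic_map f (alg_adjoint f)" "x * alg_adjoint f x = f (alg_norm f x)"
    unfolding alg_adjoint_def by blast+
qed

text \<open>
  The map \<open>x \<mapsto> N(w)\<inverse> w (w x)\<^sup>#\<close> has the two properties which characterize the adjoint, so it is the adjoint.
\<close>
lemma rank_3_adjoint_mult_unit:
  fixes f :: "'r::comm_ring_1 \<Rightarrow> 'a::comm_ring_1"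
  assumes f: "comm_ring_hom f" and two: "(2 :: 'r) dvd 1" and b: "finite_basis f {..<3::nat} b"
    and v: "w * v = 1"
  shows "alg_adjoint f (w * x) = f (alg_norm f w) * v * alg_adjoint f x"
proof -
  interpret comm_ring_hom f by fact
  note adj = rank_3_adjoint[OF f two b]
  have N: "alg_norm f v * alg_norm f w = 1"
    unfolding alg_norm_mult[OF f b, symmetric] using v by (simp add: mult.commute alg_norm_one[OF f b])
  define d where "d = f (alg_norm f v) * w"
  define q where "q x = d * alg_adjoint f (w * x)" for x
  have "quadratic_map f q"
    unfolding quadratic_map_def module_hom_iff
  proof (intro conjI allI module_alg_scale[OF f])
    have Q: "alg_adjoint f (f c * x) = f (c ^ 2) * alg_adjoint f x"
      "module_hom (alg_scale f) (alg_scale f) (\<lambda>x. alg_adjoint f (x + y) - alg_adjoint f x - alg_adjoint f y)"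
      "module_hom (alg_scale f) (alg_scale f) (\<lambda>y. alg_adjoint f (x + y) - alg_adjoint f x - alg_adjoint f y)"
      for c x y using adj(1) unfolding quadratic_map_def by blast+
    have polar: "q (x + y) - q x - q y
      = d * (alg_adjoint f (w * x + w * y) - alg_adjoint f (w * x) - alg_adjoint f (w * y))" for x y
      by (simp add: q_def algebra_simps)
    show "q (f c * x) = f (c\<^sup>2) * q x" for c x
      using Q(1)[of c "w * x"] by (simp add: q_def mult_ac)
    show "q (x1 + x2 + y) - q (x1 + x2) - q y = q (x1 + y) - q x1 - q y + (q (x2 + y) - q x2 - q y)" for x1 x2 y
      unfolding polar distrib_left[of w x1 x2] module_hom.add[OF Q(2)] by (rule distrib_left)
    show "q (x + (y1 + y2)) - q x - q (y1 + y2) = q (x + y1) - q x - q y1 + (q (x + y2) - q x - q y2)" for x y1 y2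
      unfolding polar distrib_left[of w y1 y2] module_hom.add[OF Q(3)] by (rule distrib_left)
    show "q (f c * x + y) - q (f c * x) - q y = f c * (q (x + y) - q x - q y)" for c x y
      unfolding polar mult.left_commute[of w "f c"] module_hom.scale[OF Q(2)] by (rule mult.left_commute)
    show "q (x + f c * y) - q x - q (f c * y) = f c * (q (x + y) - q x - q y)" for c x y
      unfolding polar mult.left_commute[of w "f c"] module_hom.scale[OF Q(3)] by (rule mult.left_commute)
  qed
  moreover have "x * q x = f (alg_norm f x)" for x
  proof -
    have "x * q x = f (alg_norm f v) * ((w * x) * alg_adjoint f (w * x))"
      by (simp add: q_def d_def mult_ac)
    also have "\<dots> = f (alg_norm f v * alg_norm f w * alg_norm f x)"
      unfolding adj(2) by (simp add: alg_norm_mult[OF f b] hom_mult mult.assoc)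
    finally show ?thesis unfolding N by simp
  qed
  ultimately have "q = alg_adjoint f"
    by (intro quadratic_map_unique[OF f two _ _ adj])
  hence "alg_adjoint f x = d * alg_adjoint f (w * x)" by (simp add: q_def fun_eq_iff)
  hence "f (alg_norm f w) * v * alg_adjoint f x
      = f (alg_norm f v * alg_norm f w) * (w * v) * alg_adjoint f (w * x)"
    by (simp add: d_def hom_mult mult_ac)
  thus ?thesis unfolding N v by simp
qed

section \<open>Quadratic etale algebras\<close>

lemma etale_algebra_reduced:
  fixes f :: "'k::field \<Rightarrow> 'a::comm_ring_1"
  assumes "etale_algebra f" "x * x = 0"
  shows "x = (0 :: 'a)"
proof (rule ccontr)
  assume x: "x \<noteq> 0"
  obtain I where dec: "finite I \<and> (\<Sum>e\<in>I. e) = 1 \<and>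
      (\<forall>e\<in>I. e \<noteq> 0 \<and> e * e = e) \<and>
      (\<forall>e\<in>I. \<forall>e'\<in>I. e \<noteq> e' \<longrightarrow> e * e' = 0) \<and>
      (\<forall>e\<in>I. \<forall>x. e * x \<noteq> 0 \<longrightarrow> (\<exists>y. (e * x) * (e * y) = e)) \<and>
      (\<forall>e\<in>I. \<forall>x. \<exists>p. separable_poly p \<and> e * poly (map_poly f p) x = 0)"
    using assms(1)[unfolded etale_algebra_def, THEN conjunct2, THEN conjunct2] by (rule exE)
  note I = dec[THEN conjunct2, THEN conjunct1] dec[THEN conjunct2, THEN conjunct2, THEN conjunct1]
    dec[THEN conjunct2, THEN conjunct2, THEN conjunct2, THEN conjunct2, THEN conjunct1]
  have "x = (\<Sum>e\<in>I. e * x)" using I(1) by (simp add: sum_distrib_right[symmetric])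
  then obtain e where e: "e \<in> I" "e * x \<noteq> 0" using x by (metis sum.neutral)
  then obtain y where y: "(e * x) * (e * y) = e" using I(3) by blast
  have "(e * x) * e = (e * x) * ((e * x) * (e * y))" unfolding y ..
  also have "\<dots> = e * e * e * y * (x * x)" by (simp only: ac_simps)
  finally have "(e * x) * e = 0" using assms(2) by simp
  moreover have "(e * x) * e = (e * e) * x" by (simp only: ac_simps)
  hence "(e * x) * e = e * x" using I(2) e(1) by simp
  ultimately show False using e(2) by simp
qed

text \<open>
  The elements \<open>1\<close> and \<open>x\<close> are independent, and a basis which contains both of them has only two elements.
\<close>
lemma dim_2_span:
  assumes f: "comm_ring_hom (f :: 'k::field \<Rightarrow> 'a::comm_ring_1)" and dim: "alg_dim f = 2" and x: "x \<notin> range f"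
  shows "\<exists>a b. z = f a + f b * x"
proof -
  interpret comm_ring_hom f by fact
  interpret V: vector_space "alg_scale f" by (rule vector_space_alg_scale[OF f])
  have span1: "V.span {1} = range f" by (auto simp: V.span_singleton)
  have "V.independent {x, 1}"
    using x span1 V.independent_insert[of x "{1}"] V.independent_insert[of 1 "{}"] by auto
  define B where "B = V.extend_basis {x, 1}"
  have B: "{x, 1} \<subseteq> B" "V.independent B" "V.span B = UNIV"
    unfolding B_def using \<open>V.independent {x, 1}\<close>
    by (auto intro!: V.extend_basis_superset V.independent_extend_basis V.span_extend_basis dest: subsetD[OF V.extend_basis_superset])
  have "card B = 2" using dim V.dim_eq_card[of B UNIV] B unfolding alg_dim_def by simp
  moreover have "x \<noteq> 1" using x hom_one by (metis rangeI)
  ultimately have "B = {x, 1}" using B(1) by (intro card_subset_eq[symmetric]) (auto intro: card_ge_0_finite)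
  hence "z \<in> V.span {x, 1}" using B(3) by simp
  then obtain b where "z - f b * x \<in> range f" unfolding V.span_breakdown_eq[of _ x] span1 by blast
  then obtain a where "z - f b * x = f a" by blast
  hence "z = f a + f b * x" by (simp add: algebra_simps)
  thus ?thesis by blast
qed

text \<open>
  Completing the square gives a generator \<open>d\<close> with \<open>d\<^sup>2 = D\<close> in \<open>k\<close>, and \<open>D \<noteq> 0\<close> because there are no nilpotent
  elements. The image \<open>\<alpha> + \<beta> d\<close> of \<open>d\<close> is a square root of \<open>D\<close> too, so \<open>\<alpha> \<beta> = 0\<close>, and \<open>\<beta> \<noteq> 0\<close> as \<open>bar\<close> is injective;
  then \<open>\<beta> = 1\<close> or \<open>\<beta> = -1\<close>, the former being excluded since \<open>bar\<close> moves \<open>d\<close>.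
\<close>
lemma quadratic_etale_generator:
  assumes f: "comm_ring_hom (f :: 'k::field \<Rightarrow> 'a::comm_ring_1)" and dim: "alg_dim f = 2"
    and reduced: "\<And>x. x * x = 0 \<Longrightarrow> x = (0 :: 'a)" and two: "(2 :: 'k) \<noteq> 0"
    and bar: "alg_automorphism f bar" "bar \<noteq> id"
  obtains d D where "d * d = f D" "D \<noteq> 0" "bar d = - d" "\<And>z. \<exists>a b. z = f a + f b * d"
proof -
  interpret f: comm_ring_hom f by fact
  interpret bar: comm_ring_hom bar using bar(1) unfolding alg_automorphism_def by blast
  have bar_f: "bar (f c) = f c" for c using bar(1) unfolding alg_automorphism_def by blast
  have bar_inj: "bar x = bar y \<Longrightarrow> x = y" for x y
    using bar(1) unfolding alg_automorphism_def bij_def inj_def by blast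
  obtain x where x: "bar x \<noteq> x" using bar(2) by (auto simp: fun_eq_iff)
  hence "x \<notin> range f" using bar_f by auto
  then obtain q p where pq: "x * x = f q + f p * x" using dim_2_span[OF f dim] by blast
  define h where "h = p / 2"
  define d where "d = x - f h"
  define D where "D = q + h * h"
  have "p = h + h" using two by (simp add: h_def field_simps)
  hence "f p = f h + f h" by (simp only: f.hom_add)
  hence dD: "d * d = f D" using pq by (simp add: d_def D_def f.hom_add f.hom_mult algebra_simps)
  have bar_d: "bar d \<noteq> d" using x by (simp add: d_def bar.hom_minus bar_f)
  hence d: "d \<notin> range f" using bar_f by auto
  have indep: "a = 0 \<and> b = 0" if ab: "f a + f b * d = 0" for a b
  proof -
    have "b = 0"
    proof (rule ccontr)
      assume b: "b \<noteq> 0"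
      have "d = f (inverse b) * (f b * d)" using b by (simp add: mult.assoc[symmetric] f.hom_mult[symmetric])
      also have "f b * d = f (- a)" using ab by (simp add: f.hom_uminus eq_neg_iff_add_eq_0 add.commute)
      finally have "d = f (inverse b * - a)" by (simp only: f.hom_mult)
      thus False using d by blast
    qed
    moreover from this have "f a = f 0" using ab by simp
    hence "a = 0" by (rule field_hom_inj[OF f])
    ultimately show ?thesis by simp
  qed
  have "D \<noteq> 0"
  proof
    assume "D = 0"
    hence "d * d = 0" using dD by simp
    hence "d = f 0" using reduced[of d] by simp
    thus False using d by blast
  qed
  obtain \<alpha> \<beta> where ab: "bar d = f \<alpha> + f \<beta> * d" using dim_2_span[OF f dim d] by blast
  have "bar d * bar d = f D" unfolding bar.hom_mult[symmetric] dD by (rule bar_f)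
  moreover have "bar d * bar d = f (\<alpha> * \<alpha> + \<beta> * \<beta> * D) + f (2 * \<alpha> * \<beta>) * d"
    unfolding ab by (simp add: f.hom_add f.hom_mult f.hom_numeral dD[symmetric] algebra_simps)
  ultimately have "f (\<alpha> * \<alpha> + \<beta> * \<beta> * D - D) + f (2 * \<alpha> * \<beta>) * d = 0" by (simp add: f.hom_minus algebra_simps)
  from indep[OF this] have 1: "\<alpha> * \<alpha> + \<beta> * \<beta> * D - D = 0" "\<alpha> * \<beta> = 0" using two by auto
  have "\<beta> \<noteq> 0"
  proof
    assume "\<beta> = 0"
    hence "bar d = bar (f \<alpha>)" using ab by (simp add: bar_f)
    thus False using bar_inj d by blast
  qed
  hence "\<alpha> = 0" "\<beta> * \<beta> = 1" using 1 \<open>D \<noteq> 0\<close> by (auto simp: algebra_simps)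
  hence "\<beta> = 1 \<or> \<beta> = - 1" by (metis power2_eq_square power2_eq_1_iff)
  moreover have "\<beta> \<noteq> 1" using ab \<open>\<alpha> = 0\<close> bar_d by auto
  ultimately have "bar d = - d" using ab \<open>\<alpha> = 0\<close> by (simp add: f.hom_uminus)
  thus thesis by (rule that[OF dD \<open>D \<noteq> 0\<close> _ dim_2_span[OF f dim d]])
qed

section \<open>Units and isomorphisms of Jordan algebras\<close>

lemma unit_inv:
  assumes "x dvd 1" shows "x * unit_inv x = 1"
  unfolding unit_inv_def
proof (rule theI')
  obtain y where y: "x * y = 1" using assms by (metis dvdE)
  show "\<exists>!y. x * y = 1"
  proof (rule ex1I[of _ y])
    show "x * y = 1" by fact
    fix z assume z: "x * z = 1"
    have "z = (x * y) * z" unfolding y by simp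
    also have "\<dots> = (x * z) * y" by (simp only: ac_simps)
    finally show "z = y" unfolding z by simp
  qed
qed

lemma unit_mult_cancel:
  fixes w :: "'a::comm_ring_1"
  assumes "w dvd 1" "w * x = w * y" shows "x = y"
proof -
  obtain z where z: "w * z = 1" using assms(1) by (metis dvdE)
  have "x = (w * z) * x" unfolding z by simp
  also have "\<dots> = z * (w * x)" by (simp only: ac_simps)
  also have "\<dots> = (w * z) * y" unfolding assms(2) by (simp only: ac_simps)
  finally show ?thesis unfolding z by simp
qed

lemma hom_unit: "comm_ring_hom h \<Longrightarrow> x dvd 1 \<Longrightarrow> h x dvd 1"
proof -
  assume "comm_ring_hom h" "x dvd 1"
  then interpret h: comm_ring_hom h by simp
  obtain y where "1 = x * y" using \<open>x dvd 1\<close> by (rule dvdE)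
  hence "h 1 = h (x * y)" by (rule arg_cong)
  hence "1 = h x * h y" by (simp add: h.hom_mult)
  thus "h x dvd 1" by (rule dvdI)
qed

text \<open>
  The Jordan product is built from the linear structure, the unit, the adjoint and the trace.
\<close>
lemma jordan_mult_hom:
  assumes lin: "module_hom (cj_scale J1) (cj_scale J2) \<phi>" and one: "\<phi> (cj_one J1) = cj_one J2"
    and adj: "\<And>x. \<phi> (cj_adjoint J1 x) = cj_adjoint J2 (\<phi> x)"
    and tr: "\<And>x. cj_trace J2 (\<phi> x) = cj_trace J1 x"
  shows "\<phi> (jordan_mult J1 x y) = jordan_mult J2 (\<phi> x) (\<phi> y)"
proof -
  interpret module_hom "cj_scale J1" "cj_scale J2" \<phi> by fact
  have "\<phi> (jordan_square J1 x) = jordan_square J2 (\<phi> x)" for x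
    by (simp add: jordan_square_def add diff scale one adj tr[symmetric])
  thus ?thesis by (simp add: jordan_mult_def add diff scale)
qed

lemma L_isomorphic_sym:
  assumes "(J1, J2) \<in> L_isomorphic"
  shows "(J2, J1) \<in> L_isomorphic"
proof -
  obtain \<phi> where \<phi>: "bij \<phi>" "module_hom (cj_scale J1) (cj_scale J2) \<phi>"
    "\<And>x y. \<phi> (jordan_mult J1 x y) = jordan_mult J2 (\<phi> x) (\<phi> y)"
    "\<phi> ` range (\<lambda>l. (l, 0)) = range (\<lambda>l. (l, 0))"
    using assms unfolding L_isomorphic_def by blast
  define \<psi> where "\<psi> = inv_into UNIV \<phi>"
  have \<psi>\<phi>: "\<psi> (\<phi> x) = x" and \<phi>\<psi>: "\<phi> (\<psi> y) = y" for x y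
    using \<phi>(1) by (simp_all add: \<psi>_def bij_is_inj bij_is_surj surj_f_inv_f)
  have eqI: "\<psi> a = b" if "a = \<phi> b" for a b unfolding that by (rule \<psi>\<phi>)
  interpret module_hom "cj_scale J1" "cj_scale J2" \<phi> by (rule \<phi>)
  have "bij \<psi>" unfolding \<psi>_def by (rule bij_imp_bij_inv[OF \<phi>(1)])
  moreover have "module_hom (cj_scale J2) (cj_scale J1) \<psi>"
    unfolding module_hom_iff
    by (intro conjI allI m1.module_axioms m2.module_axioms eqI) (simp_all add: add scale \<phi>\<psi>)
  moreover have "\<psi> (jordan_mult J2 x y) = jordan_mult J1 (\<psi> x) (\<psi> y)" for x y
    by (intro eqI) (simp add: \<phi>(3) \<phi>\<psi>)
  moreover have "\<psi> ` range (\<lambda>l. (l, 0)) = range (\<lambda>l. (l, 0))"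
    by (subst \<phi>(4)[symmetric]) (simp add: image_image \<psi>\<phi>)
  ultimately show ?thesis unfolding L_isomorphic_def by blast
qed

lemma L_isomorphic_trans:
  assumes "(J1, J2) \<in> L_isomorphic" "(J2, J3) \<in> L_isomorphic"
  shows "(J1, J3) \<in> L_isomorphic"
proof -
  obtain \<phi> where \<phi>: "bij \<phi>" "module_hom (cj_scale J1) (cj_scale J2) \<phi>"
    "\<And>x y. \<phi> (jordan_mult J1 x y) = jordan_mult J2 (\<phi> x) (\<phi> y)"
    "\<phi> ` range (\<lambda>l. (l, 0)) = range (\<lambda>l. (l, 0))"
    using assms(1) unfolding L_isomorphic_def by blast
  obtain \<psi> where \<psi>: "bij \<psi>" "module_hom (cj_scale J2) (cj_scale J3) \<psi>"
    "\<And>x y. \<psi> (jordan_mult J2 x y) = jordan_mult J3 (\<psi> x) (\<psi> y)"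
    "\<psi> ` range (\<lambda>l. (l, 0)) = range (\<lambda>l. (l, 0))"
    using assms(2) unfolding L_isomorphic_def by blast
  have "bij (\<psi> \<circ> \<phi>)" by (rule bij_comp[OF \<phi>(1) \<psi>(1)])
  moreover have "module_hom (cj_scale J1) (cj_scale J3) (\<psi> \<circ> \<phi>)" by (rule module_hom_compose[OF \<phi>(2) \<psi>(2)])
  moreover have "(\<psi> \<circ> \<phi>) (jordan_mult J1 x y) = jordan_mult J3 ((\<psi> \<circ> \<phi>) x) ((\<psi> \<circ> \<phi>) y)" for x y
    by (simp add: \<phi>(3) \<psi>(3))
  moreover have "(\<psi> \<circ> \<phi>) ` range (\<lambda>l. (l, 0)) = range (\<lambda>l. (l, 0))"
    unfolding image_comp[symmetric] \<phi>(4) by (rule \<psi>(4))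
  ultimately show ?thesis unfolding L_isomorphic_def by blast
qed

section \<open>The algebra E and its base change to the separable closure\<close>

text \<open>
  The hypotheses of the theorem. They are collected in a locale because \<open>\<tau>\<close>, the action of the Galois group and
  the extended norm depend on most of the parameters.
\<close>
locale tits_data =
  fixes aL :: "'k::field \<Rightarrow> 'l::comm_ring_1"
    and aK :: "'k \<Rightarrow> 'q::comm_ring_1"
    and bar :: "'q \<Rightarrow> 'q"
    and lE :: "'l \<Rightarrow> 'e::comm_ring_1" and kE :: "'q \<Rightarrow> 'e"
    and aS :: "'k \<Rightarrow> 's::field"
    and eS :: "'e \<Rightarrow> 'es::comm_ring_1" and sE :: "'s \<Rightarrow> 'es"
    and kS :: "'q \<Rightarrow> 'qs::comm_ring_1" and sK :: "'s \<Rightarrow> 'qs"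
  assumes char: "CHAR('k) \<noteq> 2" "CHAR('k) \<noteq> 3"
    and L: "etale_algebra aL" "alg_dim aL = 3"
    and K: "etale_algebra aK" "alg_dim aK = 2"
    and bar: "alg_automorphism aK bar" "bar \<noteq> id"
    and E: "is_tensor_product aL aK lE kE"
    and k_s: "separable_closure aS"
    and E_s: "is_tensor_product (lE \<circ> aL) aS eS sE"
    and K_s: "is_tensor_product aK aS kS sK"
begin

sublocale aL: comm_ring_hom aL by (rule is_tensor_product_homs[OF E])
sublocale aK: comm_ring_hom aK by (rule is_tensor_product_homs[OF E])
sublocale lE: comm_ring_hom lE by (rule is_tensor_product_homs[OF E])
sublocale kE: comm_ring_hom kE by (rule is_tensor_product_homs[OF E])
sublocale aS: comm_ring_hom aS by (rule is_tensor_product_homs[OF E_s])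
sublocale eS: comm_ring_hom eS by (rule is_tensor_product_homs[OF E_s])
sublocale sE: comm_ring_hom sE by (rule is_tensor_product_homs[OF E_s])
sublocale kS: comm_ring_hom kS by (rule is_tensor_product_homs[OF K_s])
sublocale sK: comm_ring_hom sK by (rule is_tensor_product_homs[OF K_s])
sublocale bar: comm_ring_hom bar using bar(1) unfolding alg_automorphism_def by blast

lemma bar_aK: "bar (aK c) = aK c" using bar(1) unfolding alg_automorphism_def by blast

lemma lE_aL: "lE (aL c) = kE (aK c)" by (rule is_tensor_product_homs[OF E])
lemma eS_lE_aL: "eS (lE (aL c)) = sE (aS c)" using is_tensor_product_homs(5)[OF E_s] by simp
lemma eS_kE_aK: "eS (kE (aK c)) = sE (aS c)" using eS_lE_aL lE_aL by simp
lemma kS_aK: "kS (aK c) = sK (aS c)" by (rule is_tensor_product_homs[OF K_s])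

lemma two: "(2 :: 'k) \<noteq> 0" and three: "(3 :: 'k) \<noteq> 0"
proof -
  have 1: "CHAR('k) \<noteq> 1" using CHAR_not_1 by auto
  have p2: "c = 1 \<or> c = 2" if "c dvd 2" for c :: nat
    using dvd_imp_le[OF that] that by (cases "c = 0") auto
  have p3: "c = 1 \<or> c = 3" if "c dvd 3" for c :: nat
    using dvd_imp_le[OF that] that by (cases "c = 0"; cases "c = 2") auto
  show "(2 :: 'k) \<noteq> 0" using of_nat_eq_0_iff_char_dvd[where ?'a = 'k, of 2] p2[of "CHAR('k)"] 1 char by auto
  show "(3 :: 'k) \<noteq> 0" using of_nat_eq_0_iff_char_dvd[where ?'a = 'k, of 3] p3[of "CHAR('k)"] 1 char by auto
qed

abbreviation \<tau> where "\<tau> \<equiv> tau lE kE bar"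

text \<open>
  The involution \<open>\<tau>s\<close> of \<open>E \<otimes> k_s\<close>, the structure map \<open>kEs\<close> from \<open>K \<otimes> k_s\<close> to \<open>E \<otimes> k_s\<close>, and the semilinear
  actions of the Galois group, \<open>act\<close> on \<open>E \<otimes> k_s\<close> and \<open>actK\<close> on \<open>K \<otimes> k_s\<close>.
\<close>
definition \<tau>s :: "'es \<Rightarrow> 'es" where taus_eq: "\<tau>s = tensor_map eS sE eS sE \<tau> id"
definition kEs :: "'qs \<Rightarrow> 'es" where kEs_eq: "kEs = tensor_map kS sK eS sE kE id"
definition act :: "('s \<Rightarrow> 's) \<Rightarrow> 'es \<Rightarrow> 'es" where act_eq: "act = (\<lambda>\<sigma>. tensor_map eS sE eS sE id \<sigma>)"
definition actK :: "('s \<Rightarrow> 's) \<Rightarrow> 'qs \<Rightarrow> 'qs" where actK_eq: "actK = (\<lambda>\<sigma>. tensor_map kS sK kS sK id \<sigma>)"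

lemma tau: "comm_ring_hom \<tau>" "\<tau> (lE l) = lE l" "\<tau> (kE x) = kE (bar x)"
proof -
  have a: "lE (id (aL c)) = kE (bar (aK c))" for c by (simp add: bar_aK lE_aL)
  note t = tensor_map[OF E lE.comm_ring_hom_axioms kE.comm_ring_hom_axioms comm_ring_hom_id bar.comm_ring_hom_axioms a]
  show "comm_ring_hom \<tau>" "\<tau> (lE l) = lE l" "\<tau> (kE x) = kE (bar x)"
    using t unfolding tau_def id_def by simp_all
qed

sublocale tau: comm_ring_hom \<tau> by (rule tau)

lemma taus: "comm_ring_hom \<tau>s" "\<tau>s (eS x) = eS (\<tau> x)" "\<tau>s (sE s) = sE s"
proof -
  have a: "eS (\<tau> ((lE \<circ> aL) c)) = sE (id (aS c))" for c by (simp add: tau eS_lE_aL)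
  note t = tensor_map[OF E_s eS.comm_ring_hom_axioms sE.comm_ring_hom_axioms tau(1) comm_ring_hom_id a]
  show "comm_ring_hom \<tau>s" "\<tau>s (eS x) = eS (\<tau> x)" "\<tau>s (sE s) = sE s"
    using t unfolding taus_eq id_def by simp_all
qed

sublocale taus: comm_ring_hom \<tau>s by (rule taus)

lemma kEs: "comm_ring_hom kEs" "kEs (kS x) = eS (kE x)" "kEs (sK s) = sE s"
proof -
  have a: "eS (kE (aK c)) = sE (id (aS c))" for c by (simp add: eS_kE_aK)
  note t = tensor_map[OF K_s eS.comm_ring_hom_axioms sE.comm_ring_hom_axioms kE.comm_ring_hom_axioms comm_ring_hom_id a]
  show "comm_ring_hom kEs" "kEs (kS x) = eS (kE x)" "kEs (sK s) = sE s"
    using t unfolding kEs_eq id_def by simp_all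
qed

sublocale kEs: comm_ring_hom kEs by (rule kEs)

lemma galois: assumes "\<sigma> \<in> galois_group aS"
  shows galois_hom: "comm_ring_hom \<sigma>" and galois_fixes: "\<sigma> (aS c) = aS c"
  using assms unfolding galois_group_def alg_automorphism_def by auto

lemma galois_comp: "\<sigma> \<in> galois_group aS \<Longrightarrow> \<rho> \<in> galois_group aS \<Longrightarrow> \<sigma> \<circ> \<rho> \<in> galois_group aS"
  unfolding galois_group_def alg_automorphism_def by (auto intro: comm_ring_hom_comp bij_comp)

lemma act: assumes \<sigma>: "\<sigma> \<in> galois_group aS"
  shows act_hom: "comm_ring_hom (act \<sigma>)" and act_eS: "act \<sigma> (eS x) = eS x" and act_sE: "act \<sigma> (sE s) = sE (\<sigma> s)"
proof -
  have a: "eS (id ((lE \<circ> aL) c)) = sE (\<sigma> (aS c))" for c by (simp add: eS_lE_aL galois_fixes[OF \<sigma>])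
  note t = tensor_map[OF E_s eS.comm_ring_hom_axioms sE.comm_ring_hom_axioms comm_ring_hom_id galois_hom[OF \<sigma>] a]
  show "comm_ring_hom (act \<sigma>)" "act \<sigma> (eS x) = eS x" "act \<sigma> (sE s) = sE (\<sigma> s)"
    using t unfolding act_eq id_def by simp_all
qed

lemma actK: assumes \<sigma>: "\<sigma> \<in> galois_group aS"
  shows actK_hom: "comm_ring_hom (actK \<sigma>)" and actK_kS: "actK \<sigma> (kS x) = kS x" and actK_sK: "actK \<sigma> (sK s) = sK (\<sigma> s)"
proof -
  have a: "kS (id (aK c)) = sK (\<sigma> (aS c))" for c by (simp add: kS_aK galois_fixes[OF \<sigma>])
  note t = tensor_map[OF K_s kS.comm_ring_hom_axioms sK.comm_ring_hom_axioms comm_ring_hom_id galois_hom[OF \<sigma>] a]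
  show "comm_ring_hom (actK \<sigma>)" "actK \<sigma> (kS x) = kS x" "actK \<sigma> (sK s) = sK (\<sigma> s)"
    using t unfolding actK_eq id_def by simp_all
qed

lemma hom_eq_Es:
  assumes "comm_ring_hom h" "comm_ring_hom h'" "\<And>x. h (eS x) = h' (eS x)" "\<And>s. h (sE s) = h' (sE s)"
  shows "h = h'"
proof
  interpret h: comm_ring_hom h by fact
  interpret h': comm_ring_hom h' by fact
  show "h t = h' t" for t
    by (induction t rule: tensor_product_induct[OF E_s])
      (simp_all add: assms(3,4) h.hom_add h'.hom_add h.hom_mult h'.hom_mult)
qed

lemma hom_eq_Ks:
  assumes "comm_ring_hom h" "comm_ring_hom h'" "\<And>x. h (kS x) = h' (kS x)" "\<And>s. h (sK s) = h' (sK s)"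
  shows "h = h'"
proof
  interpret h: comm_ring_hom h by fact
  interpret h': comm_ring_hom h' by fact
  show "h t = h' t" for t
    by (induction t rule: tensor_product_induct[OF K_s])
      (simp_all add: assms(3,4) h.hom_add h'.hom_add h.hom_mult h'.hom_mult)
qed

lemma act_comp:
  assumes "\<sigma> \<in> galois_group aS" "\<rho> \<in> galois_group aS"
  shows "act (\<sigma> \<circ> \<rho>) x = act \<sigma> (act \<rho> x)"
proof -
  have "act (\<sigma> \<circ> \<rho>) = act \<sigma> \<circ> act \<rho>"
    using assms by (intro hom_eq_Es comm_ring_hom_comp act_hom galois_comp)
      (simp_all add: act_eS act_sE galois_comp)
  thus ?thesis by (simp add: fun_eq_iff)
qed

lemma act_tau:
  assumes "\<sigma> \<in> galois_group aS"
  shows "act \<sigma> (\<tau>s x) = \<tau>s (act \<sigma> x)"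
proof -
  have "act \<sigma> \<circ> \<tau>s = \<tau>s \<circ> act \<sigma>"
    using assms by (intro hom_eq_Es comm_ring_hom_comp act_hom taus) (simp_all add: act_eS act_sE taus)
  thus ?thesis by (simp add: fun_eq_iff)
qed

lemma act_kEs:
  assumes "\<sigma> \<in> galois_group aS"
  shows "act \<sigma> (kEs x) = kEs (actK \<sigma> x)"
proof -
  have "act \<sigma> \<circ> kEs = kEs \<circ> actK \<sigma>"
    using assms by (intro hom_eq_Ks comm_ring_hom_comp act_hom actK_hom kEs) (simp_all add: act_eS act_sE actK_kS actK_sK kEs)
  thus ?thesis by (simp add: fun_eq_iff)
qed

text \<open>
  A basis \<open>b\<close> of \<open>L\<close> over \<open>k\<close> is also a basis of \<open>E\<close> over \<open>K\<close> and of \<open>E \<otimes> k_s\<close> over \<open>K \<otimes> k_s\<close>; all the norms can be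
  computed with it. Independence in the last case is reduced to \<open>k_s\<close>, over which the products \<open>c r * b n\<close> are
  independent for a basis \<open>c\<close> of \<open>K\<close>.
\<close>
lemma rank_3_bases:
  obtains b c where "finite_basis aL {..<3::nat} b" "finite_basis aK {..<2::nat} c"
    "finite_basis kE {..<3} (\<lambda>n. lE (b n))"
    "finite_basis (lE \<circ> aL) ({..<3} \<times> {..<2}) (\<lambda>(n, r). kE (c r) * lE (b n))"
    "finite_basis kEs {..<3} (\<lambda>n. eS (lE (b n)))"
proof -
  obtain b where b: "finite_basis aL {..<3::nat} b"
    using alg_dim_finite_basis[OF aL.comm_ring_hom_axioms L(2)] by auto
  obtain c where c: "finite_basis aK {..<2::nat} c"
    using alg_dim_finite_basis[OF aK.comm_ring_hom_axioms K(2)] by auto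
  have bE: "finite_basis kE {..<3} (\<lambda>n. lE (b n))" by (rule finite_basis_base_change[OF E b])
  have "kE \<circ> aK = lE \<circ> aL" by (auto simp: lE_aL)
  hence B: "finite_basis (lE \<circ> aL) ({..<3} \<times> {..<2}) (\<lambda>(n, r). kE (c r) * lE (b n))"
    using finite_basis_tower[OF aK.comm_ring_hom_axioms kE.comm_ring_hom_axioms bE c] by simp
  have Bs: "finite_basis sE ({..<3} \<times> {..<2}) (\<lambda>p. eS (case p of (n, r) \<Rightarrow> kE (c r) * lE (b n)))"
    by (rule finite_basis_base_change[OF E_s B])
  have cs: "finite_basis sK {..<2} (\<lambda>r. kS (c r))" by (rule finite_basis_base_change[OF K_s c])
  have "finite_basis kEs {..<3} (\<lambda>n. eS (lE (b n)))"
    unfolding finite_basis_def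
  proof (intro conjI allI impI ballI)
    show "\<exists>u. t = (\<Sum>n<3. kEs (u n) * eS (lE (b n)))" for t
    proof (induction t rule: tensor_product_induct[OF E_s])
      case (1 x s)
      obtain v where v: "\<And>x. x = (\<Sum>n<3. kE (v x n) * lE (b n))" using finite_basis_coords[OF bE] by blast
      have "eS x * sE s = eS (\<Sum>n<3. kE (v x n) * lE (b n)) * sE s" using v[of x] by simp
      also have "\<dots> = (\<Sum>n<3. kEs (kS (v x n) * sK s) * eS (lE (b n)))"
        unfolding eS.hom_sum sum_distrib_right
        by (intro sum.cong) (simp_all add: eS.hom_mult kEs.hom_mult kEs mult_ac)
      finally show ?case by (rule exI[of _ "\<lambda>n. kS (v x n) * sK s"])
    next
      case (2 x y)
      then obtain u u' where "x = (\<Sum>n<3. kEs (u n) * eS (lE (b n)))" "y = (\<Sum>n<3. kEs (u' n) * eS (lE (b n)))"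
        by blast
      hence "x + y = (\<Sum>n<3. kEs (u n + u' n) * eS (lE (b n)))"
        by (simp add: kEs.hom_add distrib_right sum.distrib)
      thus ?case by (rule exI[of _ "\<lambda>n. u n + u' n"])
    qed
    fix u n assume u: "(\<Sum>n<3. kEs (u n) * eS (lE (b n))) = 0" and n: "n \<in> {..<3::nat}"
    obtain v where v: "\<And>x. x = (\<Sum>r<2. sK (v x r) * kS (c r))" using finite_basis_coords[OF cs] by blast
    have "(\<Sum>p\<in>{..<3} \<times> {..<2}. sE (case p of (n, r) \<Rightarrow> v (u n) r) * eS (case p of (n, r) \<Rightarrow> kE (c r) * lE (b n)))
        = (\<Sum>n<3. \<Sum>r<2. sE (v (u n) r) * eS (kE (c r) * lE (b n)))"
      unfolding sum.cartesian_product by (intro sum.cong) auto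
    also have "\<dots> = (\<Sum>n<3. kEs (\<Sum>r<2. sK (v (u n) r) * kS (c r)) * eS (lE (b n)))"
      by (simp only: kEs.hom_sum kEs.hom_mult kEs eS.hom_mult sum_distrib_right mult.assoc)
    also have "\<dots> = 0" unfolding v[symmetric] by (rule u)
    finally have "\<forall>p\<in>{..<3} \<times> {..<2}. (case p of (n, r) \<Rightarrow> v (u n) r) = 0"
      using Bs unfolding finite_basis_def
      by (elim conjE allE[of _ "\<lambda>p. case p of (n, r) \<Rightarrow> v (u n) r"]) simp
    hence "\<forall>r<2. v (u n) r = 0" using n by auto
    thus "u n = 0" using v[of "u n"] by simp
  qed simp
  thus thesis using that b c bE B by blast
qed

lemma aK_inj: "aK x = aK y \<Longrightarrow> x = y"
  by (rule field_hom_inj[OF aK.comm_ring_hom_axioms])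

lemma eS_inj: "eS x = eS y \<Longrightarrow> x = y"
  by (rule rank_3_bases) (rule tensor_product_left_inj[OF E_s])

lemma kS_inj: "kS x = kS y \<Longrightarrow> x = y"
  by (rule rank_3_bases) (rule tensor_product_left_inj[OF K_s])

text \<open>
  All the maps concerned carry the basis \<open>b\<close> to itself.
\<close>
lemma norm_lE: "alg_norm kE (lE x) = aK (alg_norm aL x)"
  and norm_eS: "alg_norm kEs (eS y) = kS (alg_norm kE y)"
  and norm_tau: "alg_norm kE (\<tau> y) = bar (alg_norm kE y)"
  and norm_act: "\<sigma> \<in> galois_group aS \<Longrightarrow> alg_norm kEs (act \<sigma> z) = actK \<sigma> (alg_norm kEs z)"
proof -
  obtain b where b: "finite_basis aL {..<3::nat} b" "finite_basis kE {..<3::nat} (\<lambda>n. lE (b n))"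
    "finite_basis kEs {..<3::nat} (\<lambda>n. eS (lE (b n)))" by (rule rank_3_bases)
  note homs = aL.comm_ring_hom_axioms aK.comm_ring_hom_axioms lE.comm_ring_hom_axioms
    kE.comm_ring_hom_axioms eS.comm_ring_hom_axioms kS.comm_ring_hom_axioms bar.comm_ring_hom_axioms
    kEs(1) tau(1)
  show "alg_norm kE (lE x) = aK (alg_norm aL x)"
    by (rule alg_norm_hom[OF _ b(1) _ b(2)]) (simp_all add: homs lE_aL)
  show "alg_norm kEs (eS y) = kS (alg_norm kE y)"
    by (rule alg_norm_hom[OF _ b(2) _ b(3)]) (simp_all add: homs kEs)
  show "alg_norm kE (\<tau> y) = bar (alg_norm kE y)"
    by (rule alg_norm_hom[OF _ b(2) _ b(2)]) (simp_all add: homs tau)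
  show "alg_norm kEs (act \<sigma> z) = actK \<sigma> (alg_norm kEs z)" if "\<sigma> \<in> galois_group aS"
    by (rule alg_norm_hom[OF _ b(3) _ b(3)]) (simp_all add: homs act_kEs[OF that] act_hom[OF that] actK_hom[OF that] act_eS[OF that])
qed

lemma norm_mult: "alg_norm aL (x * x') = alg_norm aL x * alg_norm aL x'"
    "alg_norm kE (y * y') = alg_norm kE y * alg_norm kE y'"
    "alg_norm kEs (z * z') = alg_norm kEs z * alg_norm kEs z'"
  and norm_scalar: "alg_norm kEs (kEs a) = a ^ 3"
  and norm_one: "alg_norm aL 1 = 1" "alg_norm aK 1 = 1"
proof -
  obtain b c where b: "finite_basis aL {..<3::nat} b" "finite_basis aK {..<2::nat} c" "finite_basis kE {..<3::nat} (\<lambda>n. lE (b n))"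
    "finite_basis kEs {..<3::nat} (\<lambda>n. eS (lE (b n)))" by (rule rank_3_bases)
  note hL = aL.comm_ring_hom_axioms and hK = aK.comm_ring_hom_axioms and hE = kE.comm_ring_hom_axioms
  show "alg_norm aL (x * x') = alg_norm aL x * alg_norm aL x'" by (rule alg_norm_mult[OF hL b(1)])
  show "alg_norm kE (y * y') = alg_norm kE y * alg_norm kE y'" by (rule alg_norm_mult[OF hE b(3)])
  show "alg_norm kEs (z * z') = alg_norm kEs z * alg_norm kEs z'" by (rule alg_norm_mult[OF kEs(1) b(4)])
  show "alg_norm kEs (kEs a) = a ^ 3" by (rule alg_norm_scalar[OF kEs(1) b(4)])
  show "alg_norm aL 1 = 1" by (rule alg_norm_one[OF hL b(1)])
  show "alg_norm aK 1 = 1" by (rule alg_norm_one[OF hK b(2)])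
qed

section \<open>The cocycle of an admissible pair\<close>

abbreviation SUs :: "'es set" where "SUs \<equiv> SU lE kE bar eS sE kS sK"

lemma SUs_iff: "x \<in> SUs \<longleftrightarrow> x * \<tau>s x = 1 \<and> alg_norm kEs x = 1"
  unfolding SU_def taus_eq kEs_eq by simp

text \<open>
  The points over \<open>k_s\<close> of the torsor belonging to \<open>(u, \<mu>)\<close>. The last clause says that \<open>\<sigma> \<mapsto> \<sigma>(w)\<close> is continuous;
  it is what makes the cocycle of \<open>w\<close> continuous.
\<close>
definition splits :: "'l \<Rightarrow> 'q \<Rightarrow> 'es \<Rightarrow> bool"
  where "splits u \<mu> w \<longleftrightarrow> w dvd 1 \<and> w * \<tau>s w = eS (lE u) \<and> alg_norm kEs w = kS \<mu> \<and>
    (\<exists>F. finite F \<and> (\<forall>\<sigma>\<in>galois_group aS. \<forall>\<rho>\<in>galois_group aS.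
      (\<forall>x\<in>F. \<rho> x = \<sigma> x) \<longrightarrow> act \<rho> w = act \<sigma> w))"

text \<open>
  In \<open>K \<otimes> k_s\<close> the element \<open>g = d / \<delta>\<close> has square 1, and \<open>\<tau>\<close> changes its sign; the idempotents are
  \<open>(1 + g) / 2\<close> and \<open>(1 - g) / 2\<close>.
\<close>
lemma splitting_idempotents:
  obtains e1 e2 :: 'qs and d :: 'q and D \<delta> where
    "e1 + e2 = 1" "e1 * e2 = 0" "e1 * e1 = e1" "e2 * e2 = e2"
    "\<tau>s (kEs e1) = kEs e2" "\<tau>s (kEs e2) = kEs e1"
    "d * d = aK D" "bar d = - d" "\<forall>z. \<exists>a b. z = aK a + aK b * d"
    "\<delta> * \<delta> = aS D" "kS d = sK \<delta> * (e1 - e2)"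
    "\<forall>\<sigma>\<in>galois_group aS. \<forall>\<rho>\<in>galois_group aS. \<rho> (inverse \<delta>) = \<sigma> (inverse \<delta>)
      \<longrightarrow> actK \<rho> e1 = actK \<sigma> e1 \<and> actK \<rho> e2 = actK \<sigma> e2"
proof -
  obtain d D where d: "d * d = aK D" "D \<noteq> 0" "bar d = - d" and span: "\<And>z. \<exists>a b. z = aK a + aK b * d"
    using quadratic_etale_generator[OF aK.comm_ring_hom_axioms K(2) etale_algebra_reduced[OF K(1)] two bar] by metis
  interpret aS': field_hom aS ..
  have D': "aS D \<noteq> 0" using d(2) by simp
  obtain \<delta> where "\<delta> ^ 2 = aS D" using separable_closure_root[OF k_s, of 2 "aS D"] two D' by auto
  hence \<delta>: "\<delta> * \<delta> = aS D" by (simp add: power2_eq_square)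
  have \<delta>0: "\<delta> \<noteq> 0" using \<delta> D' by auto
  have two_s: "(2 :: 's) \<noteq> 0" using two aS'.hom_0_iff[of 2] by (simp add: aS.hom_numeral)
  define h where "h = sK (inverse (aS 2))"
  define g where "g = kS d * sK (inverse \<delta>)"
  have h2: "h + h = 1"
  proof -
    have half: "inverse (aS 2) + inverse (aS 2) = 1" using two_s by (simp add: aS.hom_numeral field_simps)
    show ?thesis unfolding h_def sK.hom_add[symmetric] half by simp
  qed
  have gg: "g * g = 1"
  proof -
    have "g * g = kS (d * d) * sK (inverse \<delta> * inverse \<delta>)" by (simp add: g_def kS.hom_mult sK.hom_mult mult_ac)
    also have "\<dots> = sK (\<delta> * \<delta> * (inverse \<delta> * inverse \<delta>))" by (simp only: d kS_aK \<delta> sK.hom_mult)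
    also have "\<delta> * \<delta> * (inverse \<delta> * inverse \<delta>) = 1" using \<delta>0 by (simp add: field_simps)
    finally show ?thesis by simp
  qed
  define e1 where "e1 = h * (1 + g)"
  define e2 where "e2 = h * (1 - g)"
  have s: "e1 + e2 = 1" using h2 by (simp add: e1_def e2_def algebra_simps)
  have p: "e1 * e2 = 0"
  proof -
    have "e1 * e2 = h * h * (1 - g * g)" by (simp add: e1_def e2_def algebra_simps)
    thus ?thesis unfolding gg by simp
  qed
  have i1: "e1 * e1 = e1"
  proof -
    have "e1 * e1 = e1 * (e1 + e2)" using p by (simp add: distrib_left)
    thus ?thesis unfolding s by simp
  qed
  have i2: "e2 * e2 = e2"
  proof -
    have "e2 * e2 = (e1 + e2) * e2" using p by (simp add: distrib_right)
    thus ?thesis unfolding s by simp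
  qed
  have tg: "\<tau>s (kEs g) = - kEs g" "\<tau>s (kEs h) = kEs h"
    by (simp_all add: g_def h_def kEs.hom_mult kEs taus.hom_mult taus tau d(3) kE.hom_uminus eS.hom_uminus)
  have t: "\<tau>s (kEs e1) = kEs e2" "\<tau>s (kEs e2) = kEs e1"
    by (simp_all add: e1_def e2_def kEs.hom_mult kEs.hom_add kEs.hom_minus taus.hom_mult taus.hom_add taus.hom_minus tg)
  have kd: "kS d = sK \<delta> * (e1 - e2)"
  proof -
    have "e1 - e2 = (h + h) * g" by (simp add: e1_def e2_def algebra_simps)
    hence "sK \<delta> * (e1 - e2) = kS d * sK (\<delta> * inverse \<delta>)" unfolding h2 by (simp add: g_def sK.hom_mult mult_ac)
    thus ?thesis using \<delta>0 by simp
  qed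
  have ag: "actK \<sigma> e1 = h * (1 + kS d * sK (\<sigma> (inverse \<delta>)))" "actK \<sigma> e2 = h * (1 - kS d * sK (\<sigma> (inverse \<delta>)))"
    if \<sigma>: "\<sigma> \<in> galois_group aS" for \<sigma>
  proof -
    interpret a: comm_ring_hom "actK \<sigma>" by (rule actK_hom[OF \<sigma>])
    interpret \<sigma>: comm_ring_hom \<sigma> by (rule galois_hom[OF \<sigma>])
    interpret \<sigma>: field_hom \<sigma> ..
    have ah: "actK \<sigma> h = h"
      by (simp add: h_def actK_sK[OF \<sigma>] \<sigma>.hom_inverse galois_fixes[OF \<sigma>] del: aS.hom_numeral)
    show "actK \<sigma> e1 = h * (1 + kS d * sK (\<sigma> (inverse \<delta>)))" "actK \<sigma> e2 = h * (1 - kS d * sK (\<sigma> (inverse \<delta>)))"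
      unfolding e1_def e2_def g_def a.hom_mult a.hom_add a.hom_minus ah a.hom_one actK_kS[OF \<sigma>] actK_sK[OF \<sigma>]
      by (rule refl)+
  qed
  have "actK \<rho> e1 = actK \<sigma> e1 \<and> actK \<rho> e2 = actK \<sigma> e2"
    if "\<sigma> \<in> galois_group aS" "\<rho> \<in> galois_group aS" "\<rho> (inverse \<delta>) = \<sigma> (inverse \<delta>)" for \<sigma> \<rho>
    unfolding ag[OF that(1)] ag[OF that(2)] that(3) by simp
  hence cont: "\<forall>\<sigma>\<in>galois_group aS. \<forall>\<rho>\<in>galois_group aS. \<rho> (inverse \<delta>) = \<sigma> (inverse \<delta>)
      \<longrightarrow> actK \<rho> e1 = actK \<sigma> e1 \<and> actK \<rho> e2 = actK \<sigma> e2" by blast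
  have "\<forall>z. \<exists>a b. z = aK a + aK b * d" using span by (rule allI)
  thus thesis by (rule that[OF s p i1 i2 t d(1) d(3) _ \<delta> kd cont])
qed

text \<open>
  The point is \<open>w = e\<^sub>1 s + e\<^sub>2 u s\<inverse>\<close> with \<open>s\<^sup>3 = m\<^sub>1\<close>. Its norm is computed in the two factors: \<open>e\<^sub>1 w = e\<^sub>1 s\<close> has
  norm \<open>e\<^sub>1 s\<^sup>3 = e\<^sub>1 m\<^sub>1\<close>, and \<open>e\<^sub>2 w = e\<^sub>2 u s\<inverse>\<close> has norm \<open>e\<^sub>2 N(u) m\<^sub>1\<inverse> = e\<^sub>2 m\<^sub>2\<close>.
\<close>
lemma admissible_splits:
  assumes adm: "admissible aL aK bar u \<mu>"
  shows "\<exists>w. splits u \<mu> w"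
proof -
  obtain e1 e2 :: 'qs and d :: 'q and D \<delta> where
    e: "e1 + e2 = 1" "e1 * e2 = 0" "e1 * e1 = e1" "e2 * e2 = e2"
    and te: "\<tau>s (kEs e1) = kEs e2" "\<tau>s (kEs e2) = kEs e1"
    and d: "d * d = aK D" "bar d = - d" and span: "\<forall>z. \<exists>a b. z = aK a + aK b * d"
    and \<delta>: "\<delta> * \<delta> = aS D" "kS d = sK \<delta> * (e1 - e2)"
    and cont: "\<forall>\<sigma>\<in>galois_group aS. \<forall>\<rho>\<in>galois_group aS. \<rho> (inverse \<delta>) = \<sigma> (inverse \<delta>)
      \<longrightarrow> actK \<rho> e1 = actK \<sigma> e1 \<and> actK \<rho> e2 = actK \<sigma> e2"
    by (rule splitting_idempotents)
  have u: "u dvd 1" and N\<mu>: "aK (alg_norm aL u) = \<mu> * bar \<mu>"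
    using adm unfolding admissible_def by auto
  obtain \<alpha> \<beta> where ab: "\<mu> = aK \<alpha> + aK \<beta> * d" using span by blast
  \<comment> \<open>The components of \<open>\<mu>\<close>: \<open>d\<close> is \<open>\<delta>\<close> in the first factor and \<open>-\<delta>\<close> in the second one.\<close>
  define m1 where "m1 = aS \<alpha> + aS \<beta> * \<delta>"
  define m2 where "m2 = aS \<alpha> - aS \<beta> * \<delta>"
  have "\<mu> * bar \<mu> = aK (\<alpha> * \<alpha> - \<beta> * \<beta> * D)"
    unfolding ab by (simp add: bar.hom_add bar.hom_mult bar_aK d(2) aK.hom_minus aK.hom_mult d(1)[symmetric] algebra_simps)
  hence N: "alg_norm aL u = \<alpha> * \<alpha> - \<beta> * \<beta> * D" using N\<mu> by (intro aK_inj) simp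
  have "m1 * m2 = aS \<alpha> * aS \<alpha> - aS \<beta> * aS \<beta> * (\<delta> * \<delta>)" by (simp add: m1_def m2_def algebra_simps)
  hence m12: "m1 * m2 = aS (alg_norm aL u)" unfolding N \<delta> by (simp add: aS.hom_minus aS.hom_mult)
  interpret aS': field_hom aS ..
  have "alg_norm aL u \<noteq> 0"
  proof -
    obtain v where "1 = u * v" using u by (rule dvdE)
    hence "alg_norm aL u * alg_norm aL v = 1" using norm_mult(1)[of u v] norm_one(1) by simp
    thus ?thesis by auto
  qed
  hence m1: "m1 \<noteq> 0" using m12 by auto
  obtain s where s: "s ^ 3 = m1" using separable_closure_root[OF k_s, of 3 m1] three m1 by auto
  have s0: "s \<noteq> 0" using s m1 by auto
  define E1 where "E1 = kEs e1"
  define E2 where "E2 = kEs e2"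
  have EE: "E1 + E2 = 1" "E1 * E2 = 0" "E1 * E1 = E1" "E2 * E2 = E2"
    unfolding E1_def E2_def using e by (simp_all add: kEs.hom_add[symmetric] kEs.hom_mult[symmetric])
  define S where "S = sE s"
  define R where "R = sE (inverse s)"
  define U where "U = eS (lE u)"
  have SR: "S * R = 1" unfolding S_def R_def sE.hom_mult[symmetric] using s0 by simp
  have tS: "\<tau>s S = S" "\<tau>s R = R" "\<tau>s U = U" "\<tau>s E1 = E2" "\<tau>s E2 = E1"
    unfolding S_def R_def U_def E1_def E2_def by (simp_all add: taus tau te)
  define w where "w = E1 * S + E2 * U * R"
  have tw: "\<tau>s w = E2 * S + E1 * U * R" by (simp add: w_def taus.hom_add taus.hom_mult tS)
  have wt: "w * \<tau>s w = U"
  proof -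
    have "w * \<tau>s w = (E1 * E2) * (S * S) + (E1 * E1) * U * (S * R) + (E2 * E2) * U * (S * R) + (E1 * E2) * (U * R * U * R)"
      unfolding tw unfolding w_def by (simp add: algebra_simps)
    also have "\<dots> = (E1 + E2) * U" unfolding EE(2-4) SR by (simp add: distrib_right)
    finally show ?thesis unfolding EE(1) by simp
  qed
  have "U dvd 1" unfolding U_def
    by (intro hom_unit[OF eS.comm_ring_hom_axioms] hom_unit[OF lE.comm_ring_hom_axioms] u)
  hence w: "w dvd 1" using wt by (metis dvd_mult_left)
  \<comment> \<open>The norm of a scalar is its cube, and the cube of an idempotent is the idempotent itself.\<close>
  define n where "n = alg_norm kEs w"
  have pow3: "x ^ 3 = x" if "x * x = x" for x :: 'qs
    using that by (simp add: power3_eq_cube)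
  have n1: "e1 * n = e1 * sK m1"
  proof -
    have "E1 * w = (E1 * E1) * S + (E1 * E2) * (U * R)" by (simp add: w_def algebra_simps)
    hence "E1 * w = E1 * S" unfolding EE by simp
    hence "alg_norm kEs (kEs e1 * w) = alg_norm kEs (kEs e1 * kEs (sK s))"
      by (simp add: E1_def S_def kEs)
    hence "e1 ^ 3 * n = e1 ^ 3 * sK s ^ 3" unfolding norm_mult norm_scalar n_def .
    thus ?thesis unfolding pow3[OF e(3)] s[symmetric] sK.hom_power .
  qed
  have n2: "e2 * n = e2 * sK m2"
  proof -
    have "E2 * w = (E1 * E2) * S + (E2 * E2) * U * R" by (simp add: w_def algebra_simps)
    hence "E2 * w = E2 * U * R" unfolding EE by simp
    hence "alg_norm kEs (kEs e2 * w) = alg_norm kEs (kEs e2 * eS (lE u) * kEs (sK (inverse s)))"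
      by (simp add: E2_def R_def U_def kEs)
    hence "e2 ^ 3 * n = e2 ^ 3 * kS (aK (alg_norm aL u)) * sK (inverse s) ^ 3"
      unfolding norm_mult norm_scalar n_def norm_eS norm_lE .
    hence "e2 * n = e2 * sK (m1 * m2) * sK (inverse s ^ 3)"
      unfolding pow3[OF e(4)] kS_aK m12 sK.hom_power .
    also have "\<dots> = e2 * sK (m1 * m2 * inverse s ^ 3)" by (simp add: sK.hom_mult mult.assoc)
    also have "m1 * m2 * inverse s ^ 3 = m2" using s0 by (simp add: s[symmetric] power_inverse)
    finally show ?thesis .
  qed
  have "n = e1 * n + e2 * n" using e(1) by (simp add: distrib_right[symmetric])
  also have "\<dots> = (e1 + e2) * sK (aS \<alpha>) + sK (aS \<beta>) * (sK \<delta> * (e1 - e2))"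
    unfolding n1 n2 by (simp add: m1_def m2_def sK.hom_add sK.hom_minus sK.hom_mult algebra_simps)
  also have "\<dots> = kS \<mu>" unfolding e \<delta>(2)[symmetric] ab by (simp add: kS.hom_add kS.hom_mult kS_aK)
  finally have n: "alg_norm kEs w = kS \<mu>" unfolding n_def .
  have "act \<rho> w = act \<sigma> w"
    if \<sigma>: "\<sigma> \<in> galois_group aS" and \<rho>: "\<rho> \<in> galois_group aS" and eq: "\<forall>x\<in>{s, inverse s, inverse \<delta>}. \<rho> x = \<sigma> x"
    for \<sigma> \<rho>
  proof -
    interpret a: comm_ring_hom "act \<sigma>" by (rule act_hom[OF \<sigma>])
    interpret b: comm_ring_hom "act \<rho>" by (rule act_hom[OF \<rho>])
    have "actK \<rho> e1 = actK \<sigma> e1" "actK \<rho> e2 = actK \<sigma> e2" using bspec[OF bspec[OF cont \<sigma>] \<rho>] eq by auto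
    thus ?thesis unfolding w_def a.hom_add a.hom_mult b.hom_add b.hom_mult
      unfolding E1_def E2_def S_def R_def U_def act_kEs[OF \<sigma>] act_kEs[OF \<rho>] act_sE[OF \<sigma>] act_sE[OF \<rho>]
        act_eS[OF \<sigma>] act_eS[OF \<rho>] using eq by simp
  qed
  hence "\<exists>F. finite F \<and> (\<forall>\<sigma>\<in>galois_group aS. \<forall>\<rho>\<in>galois_group aS.
      (\<forall>x\<in>F. \<rho> x = \<sigma> x) \<longrightarrow> act \<rho> w = act \<sigma> w)"
    by (intro exI[of _ "{s, inverse s, inverse \<delta>}"] conjI ballI impI) (rule finite.insertI finite.emptyI)+
  thus ?thesis using w wt n unfolding splits_def U_def by blast
qed

definition cocycle_of :: "'es \<Rightarrow> ('s \<Rightarrow> 's) \<Rightarrow> 'es"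
  where "cocycle_of w = (\<lambda>\<sigma>\<in>galois_group aS. unit_inv w * act \<sigma> w)"

lemma cocycle_of_mult:
  assumes "splits u \<mu> w" "\<sigma> \<in> galois_group aS"
  shows "w * cocycle_of w \<sigma> = act \<sigma> w"
proof -
  have "w * cocycle_of w \<sigma> = (w * unit_inv w) * act \<sigma> w"
    using assms(2) by (simp add: cocycle_of_def mult.assoc)
  thus ?thesis using unit_inv[of w] assms(1) by (simp add: splits_def)
qed

text \<open>
  Both equations of \<open>SU\<close> follow from \<open>w c(\<sigma>) = \<sigma>(w)\<close> by cancellation, since \<open>w \<tau>(w)\<close> and \<open>N(w)\<close> come from
  \<open>E\<close> and \<open>K\<close> and are therefore invariant.
\<close>
lemma cocycle_of_cocycle:
  assumes w: "splits u \<mu> w"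
  shows "cocycle_of w \<in> galois_cocycles aS act SUs"
proof -
  have wu: "w dvd 1" and wt: "w * \<tau>s w = eS (lE u)" and wN: "alg_norm kEs w = kS \<mu>"
    using w by (auto simp: splits_def)
  note cm = cocycle_of_mult[OF w]
  have "cocycle_of w \<sigma> \<in> SUs" if \<sigma>: "\<sigma> \<in> galois_group aS" for \<sigma>
  proof -
    interpret a: comm_ring_hom "act \<sigma>" by (rule act_hom[OF \<sigma>])
    let ?c = "cocycle_of w \<sigma>"
    have wtu: "w * \<tau>s w dvd 1" using wu hom_unit[OF taus(1) wu] by (metis mult_dvd_mono mult_1)
    have "(w * \<tau>s w) * (?c * \<tau>s ?c) = (w * ?c) * \<tau>s (w * ?c)" by (simp add: taus.hom_mult mult_ac)
    also have "\<dots> = act \<sigma> (w * \<tau>s w)" unfolding cm[OF \<sigma>] a.hom_mult act_tau[OF \<sigma>] ..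
    also have "\<dots> = (w * \<tau>s w) * 1" unfolding wt act_eS[OF \<sigma>] by simp
    finally have 1: "?c * \<tau>s ?c = 1" by (rule unit_mult_cancel[OF wtu])
    have wNu: "alg_norm kEs w dvd 1"
    proof -
      obtain v where v: "1 = w * v" using wu by (rule dvdE)
      have "alg_norm kEs w * alg_norm kEs v = alg_norm kEs (kEs 1)" unfolding norm_mult(3)[symmetric] v[symmetric] by simp
      also have "\<dots> = 1" unfolding norm_scalar by simp
      finally show ?thesis by (metis dvd_triv_left)
    qed
    have "alg_norm kEs w * alg_norm kEs ?c = alg_norm kEs (act \<sigma> w)" unfolding norm_mult(3)[symmetric] cm[OF \<sigma>] ..
    also have "\<dots> = alg_norm kEs w * 1" unfolding norm_act[OF \<sigma>] wN actK_kS[OF \<sigma>] by simp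
    finally have "alg_norm kEs ?c = 1" by (rule unit_mult_cancel[OF wNu])
    with 1 show ?thesis unfolding SUs_iff by blast
  qed
  moreover have "krull_continuous aS (cocycle_of w)"
    unfolding krull_continuous_def
  proof
    fix \<sigma> assume \<sigma>: "\<sigma> \<in> galois_group aS"
    obtain F where F: "finite F \<and> (\<forall>\<sigma>\<in>galois_group aS. \<forall>\<rho>\<in>galois_group aS.
      (\<forall>x\<in>F. \<rho> x = \<sigma> x) \<longrightarrow> act \<rho> w = act \<sigma> w)"
      using w[unfolded splits_def, THEN conjunct2, THEN conjunct2, THEN conjunct2] by (rule exE)
    have "cocycle_of w \<rho> = cocycle_of w \<sigma>" if "\<rho> \<in> galois_group aS" "\<forall>x\<in>F. \<rho> x = \<sigma> x" for \<rho>
    proof -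
      have "act \<rho> w = act \<sigma> w" by (rule F[THEN conjunct2, THEN bspec, OF \<sigma>, THEN bspec, THEN mp, OF that])
      thus ?thesis using \<sigma> that(1) by (simp add: cocycle_of_def)
    qed
    thus "\<exists>F. finite F \<and> (\<forall>\<rho>\<in>galois_group aS. (\<forall>x\<in>F. \<rho> x = \<sigma> x) \<longrightarrow> cocycle_of w \<rho> = cocycle_of w \<sigma>)"
      using F[THEN conjunct1] by (intro exI[of _ F] conjI ballI impI)
  qed
  moreover have "cocycle_of w (\<sigma> \<circ> \<rho>) = cocycle_of w \<sigma> * act \<sigma> (cocycle_of w \<rho>)"
    if \<sigma>: "\<sigma> \<in> galois_group aS" and \<rho>: "\<rho> \<in> galois_group aS" for \<sigma> \<rho>
  proof (rule unit_mult_cancel[OF wu])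
    interpret a: comm_ring_hom "act \<sigma>" by (rule act_hom[OF \<sigma>])
    have "w * cocycle_of w (\<sigma> \<circ> \<rho>) = act \<sigma> (w * cocycle_of w \<rho>)"
      unfolding cm[OF galois_comp[OF \<sigma> \<rho>]] cm[OF \<rho>] by (rule act_comp[OF \<sigma> \<rho>])
    also have "\<dots> = w * (cocycle_of w \<sigma> * act \<sigma> (cocycle_of w \<rho>))"
      unfolding a.hom_mult cm[OF \<sigma>, symmetric] by (rule mult.assoc)
    finally show "w * cocycle_of w (\<sigma> \<circ> \<rho>) = w * (cocycle_of w \<sigma> * act \<sigma> (cocycle_of w \<rho>))" .
  qed
  moreover have "cocycle_of w \<in> extensional (galois_group aS)" unfolding cocycle_of_def by simp
  ultimately show ?thesis unfolding galois_cocycles_def PiE_def by auto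
qed

text \<open>
  The coordinates with respect to a basis of \<open>E\<close> are invariant, hence in \<open>k\<close>.
\<close>
lemma galois_descent:
  assumes fixed: "\<And>\<sigma>. \<sigma> \<in> galois_group aS \<Longrightarrow> act \<sigma> y = y"
  shows "y \<in> range eS"
proof -
  obtain b c where B: "finite_basis (lE \<circ> aL) ({..<3::nat} \<times> {..<2::nat}) (\<lambda>(n, r). kE (c r) * lE (b n))"
    by (rule rank_3_bases)
  define I where "I = {..<3::nat} \<times> {..<2::nat}"
  define B' where "B' = (\<lambda>(n, r). kE (c r) * lE (b n))"
  have Bs: "finite_basis sE I (\<lambda>p. eS (B' p))" unfolding I_def B'_def by (rule finite_basis_base_change[OF E_s B])
  obtain v where v: "\<And>x. x = (\<Sum>p\<in>I. sE (v x p) * eS (B' p))" using finite_basis_coords[OF Bs] by blast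
  have "v y p \<in> range aS" if p: "p \<in> I" for p
  proof (rule separable_closure_fixed_field[OF k_s])
    fix \<sigma> assume \<sigma>: "\<sigma> \<in> galois_group aS"
    interpret a: comm_ring_hom "act \<sigma>" by (rule act_hom[OF \<sigma>])
    have "act \<sigma> (\<Sum>p\<in>I. sE (v y p) * eS (B' p)) = (\<Sum>p\<in>I. sE (\<sigma> (v y p)) * eS (B' p))"
      unfolding a.hom_sum a.hom_mult act_sE[OF \<sigma>] act_eS[OF \<sigma>] ..
    hence "(\<Sum>p\<in>I. sE (\<sigma> (v y p)) * eS (B' p)) = (\<Sum>p\<in>I. sE (v y p) * eS (B' p))"
      unfolding v[symmetric] fixed[OF \<sigma>] by (rule sym)
    from finite_basis_coeff_eq[OF sE.comm_ring_hom_axioms Bs, of "\<lambda>p. \<sigma> (v y p)" "v y", OF this p]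
    show "\<sigma> (v y p) = v y p" .
  qed
  hence "\<forall>p\<in>I. \<exists>a. v y p = aS a" by blast
  from bchoice[OF this] obtain a where a: "\<forall>p\<in>I. v y p = aS (a p)" by blast
  have "y = (\<Sum>p\<in>I. sE (v y p) * eS (B' p))" by (rule v)
  also have "\<dots> = eS (\<Sum>p\<in>I. lE (aL (a p)) * B' p)"
    unfolding eS.hom_sum eS.hom_mult eS_lE_aL using a by (intro sum.cong) simp_all
  finally show ?thesis by blast
qed

text \<open>
  The coboundary relation for \<open>m\<close> says precisely that \<open>w m\<close> and \<open>w'\<close> are multiplied by the same cocycle, so
  their quotient \<open>y\<close> is invariant. The equations for \<open>y\<close> are those for \<open>w\<close>, \<open>w'\<close> and \<open>m\<close> combined.
\<close>
lemma cohomologous_splits: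
  assumes w: "splits u \<mu> w" and w': "splits u' \<mu>' w'" and u: "u dvd 1"
    and coh: "(cocycle_of w, cocycle_of w') \<in> cohomologous aS act SUs"
  shows "\<exists>y. y dvd 1 \<and> lE u = lE u' * (y * \<tau> y) \<and> \<mu> = \<mu>' * alg_norm kE y"
proof -
  obtain m where m: "m \<in> SUs" and mc: "\<And>\<sigma>. \<sigma> \<in> galois_group aS \<Longrightarrow> m * cocycle_of w' \<sigma> = cocycle_of w \<sigma> * act \<sigma> m"
    using coh unfolding cohomologous_def by blast
  have wu: "w dvd 1" "w' dvd 1" and wt: "w * \<tau>s w = eS (lE u)" "w' * \<tau>s w' = eS (lE u')"
    and wN: "alg_norm kEs w = kS \<mu>" "alg_norm kEs w' = kS \<mu>'"
    using w w' by (auto simp: splits_def)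
  define y where "y = w * m * unit_inv w'"
  have "y * w' = w * m * (w' * unit_inv w')" unfolding y_def by (simp only: ac_simps)
  hence yw: "y * w' = w * m" unfolding unit_inv[OF wu(2)] by simp
  have "act \<sigma> y = y" if \<sigma>: "\<sigma> \<in> galois_group aS" for \<sigma>
  proof -
    interpret a: comm_ring_hom "act \<sigma>" by (rule act_hom[OF \<sigma>])
    have "act \<sigma> w' * act \<sigma> y = act \<sigma> (y * w')" by (simp add: a.hom_mult mult.commute)
    also have "\<dots> = w * cocycle_of w \<sigma> * act \<sigma> m" unfolding yw a.hom_mult cocycle_of_mult[OF w \<sigma>] ..
    also have "\<dots> = w * (m * cocycle_of w' \<sigma>)" unfolding mc[OF \<sigma>] by (rule mult.assoc)
    also have "\<dots> = (y * w') * cocycle_of w' \<sigma>" unfolding yw by (simp only: mult.assoc)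
    also have "\<dots> = y * act \<sigma> w'" unfolding mult.assoc cocycle_of_mult[OF w' \<sigma>] ..
    also have "\<dots> = act \<sigma> w' * y" by (rule mult.commute)
    finally show ?thesis by (rule unit_mult_cancel[OF hom_unit[OF act_hom[OF \<sigma>] wu(2)]])
  qed
  hence "y \<in> range eS" by (rule galois_descent)
  then obtain z where z: "y = eS z" by blast
  have "eS (lE u' * (z * \<tau> z)) = (w' * \<tau>s w') * (y * \<tau>s y)"
    unfolding wt z by (simp add: eS.hom_mult taus)
  also have "\<dots> = (y * w') * \<tau>s (y * w')" by (simp add: taus.hom_mult mult_ac)
  also have "\<dots> = (w * \<tau>s w) * (m * \<tau>s m)" unfolding yw by (simp add: taus.hom_mult mult_ac)
  also have "\<dots> = eS (lE u)" using m unfolding SUs_iff wt by simp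
  finally have 1: "lE u = lE u' * (z * \<tau> z)" by (intro eS_inj) simp
  have "kS (\<mu>' * alg_norm kE z) = alg_norm kEs (y * w')"
    unfolding norm_mult(3) z norm_eS wN kS.hom_mult by (rule mult.commute)
  also have "\<dots> = kS \<mu>" using m unfolding yw norm_mult(3) SUs_iff wN by simp
  finally have 2: "\<mu> = \<mu>' * alg_norm kE z" by (intro kS_inj) simp
  have "lE u dvd 1" by (rule hom_unit[OF lE.comm_ring_hom_axioms u])
  hence "z dvd 1" unfolding 1 by (metis dvd_mult_left dvd_mult_right)
  with 1 2 show ?thesis by blast
qed

section \<open>Isomorphic Tits process algebras\<close>

lemma tits_scale_module:
  "Modules.module (\<lambda>c (a, b). (aL c * a, lE (aL c) * b))"
  by unfold_locales (auto simp: plus_prod_def aL.hom_add aL.hom_mult lE.hom_add lE.hom_mult algebra_simps)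

text \<open>
  The isomorphism is \<open>(a, b) \<mapsto> (a, b y)\<close>. The first component of the adjoint is preserved because
  \<open>b y u' \<tau>(b y) = b u \<tau>(b)\<close>. In the second one, \<open>\<tau>(b y)\<^sup># = N(\<tau>(y)) \<tau>(y)\<inverse> \<tau>(b)\<^sup>#\<close> and
  \<open>N(\<tau>(y)) = bar N(y)\<close>, so the factor \<open>bar \<mu>'\<close> becomes \<open>bar \<mu>\<close>, while \<open>\<tau>(y)\<inverse> u'\<inverse> = u\<inverse> y\<close> restores the factor \<open>y\<close>.
\<close>
lemma tits_process_isomorphic:
  assumes u: "u dvd 1" and u': "u' dvd 1" and y: "y dvd 1"
    and uy: "lE u = lE u' * (y * \<tau> y)" and \<mu>y: "\<mu> = \<mu>' * alg_norm kE y"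
  shows "(tits_process aL aK lE kE bar u \<mu>, tits_process aL aK lE kE bar u' \<mu>') \<in> L_isomorphic"
    (is "(?J, ?J') \<in> _")
proof -
  obtain z where z: "1 = y * z" using y by (rule dvdE)
  define \<phi> :: "'l \<times> 'e \<Rightarrow> 'l \<times> 'e" where "\<phi> = (\<lambda>(a, b). (a, b * y))"
  have "bij \<phi>"
  proof (rule o_bij)
    show "(\<lambda>(a, b). (a, b * z)) \<circ> \<phi> = id" "\<phi> \<circ> (\<lambda>(a, b). (a, b * z)) = id"
      using z by (auto simp: \<phi>_def fun_eq_iff mult.assoc mult.commute[of z])
  qed
  moreover have lin: "module_hom (cj_scale ?J) (cj_scale ?J') \<phi>"
    unfolding module_hom_iff using tits_scale_module
    by (auto simp: tits_process_def Let_def \<phi>_def plus_prod_def distrib_right mult.assoc)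
  moreover have "\<phi> (cj_adjoint ?J x) = cj_adjoint ?J' (\<phi> x)" for x
  proof (cases x)
    case (Pair a b)
    have 1: "b * y * lE u' * \<tau> (b * y) = b * lE u * \<tau> b"
      unfolding uy by (simp add: tau.hom_mult mult_ac)
    obtain b3 where b3: "finite_basis kE {..<3::nat} (\<lambda>n. lE (b3 n))" by (rule rank_3_bases)
    have "(2 :: 'k) dvd 1" using two by (simp add: dvd_field_iff)
    hence two_q: "(2 :: 'q) dvd 1" using hom_unit[OF aK.comm_ring_hom_axioms] aK.hom_numeral by metis
    have tz: "\<tau> y * \<tau> z = 1" unfolding tau.hom_mult[symmetric] z[symmetric] by simp
    have adj: "alg_adjoint kE (\<tau> (b * y)) = kE (bar (alg_norm kE y)) * \<tau> z * alg_adjoint kE (\<tau> b)"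
      using rank_3_adjoint_mult_unit[OF kE.comm_ring_hom_axioms two_q b3 tz, of "\<tau> b"]
      unfolding norm_tau by (simp add: tau.hom_mult mult.commute)
    have inv: "lE v * lE (unit_inv v) = 1" if "v dvd 1" for v
      unfolding lE.hom_mult[symmetric] unit_inv[OF that] by simp
    have 2: "\<tau> z * lE (unit_inv u') = lE (unit_inv u) * y"
    proof (rule unit_mult_cancel[OF hom_unit[OF lE.comm_ring_hom_axioms u]])
      have "lE u * (\<tau> z * lE (unit_inv u')) = (lE u' * lE (unit_inv u')) * (\<tau> y * \<tau> z) * y"
        unfolding uy by (simp only: ac_simps)
      also have "\<dots> = (lE u * lE (unit_inv u)) * y" unfolding inv[OF u] inv[OF u'] tz by simp
      finally show "lE u * (\<tau> z * lE (unit_inv u')) = lE u * (lE (unit_inv u) * y)" by (simp only: mult.assoc)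
    qed
    have "kE (bar \<mu>') * alg_adjoint kE (\<tau> (b * y)) * lE (unit_inv u')
        = (kE (bar \<mu>') * kE (bar (alg_norm kE y))) * alg_adjoint kE (\<tau> b) * (\<tau> z * lE (unit_inv u'))"
      unfolding adj by (simp only: ac_simps)
    also have "\<dots> = kE (bar \<mu>) * alg_adjoint kE (\<tau> b) * (lE (unit_inv u) * y)"
      unfolding 2 \<mu>y bar.hom_mult kE.hom_mult ..
    finally have 3: "kE (bar \<mu>') * alg_adjoint kE (\<tau> (b * y)) * lE (unit_inv u') - lE a * (b * y)
        = (kE (bar \<mu>) * alg_adjoint kE (\<tau> b) * lE (unit_inv u) - lE a * b) * y"
      by (simp add: left_diff_distrib mult.assoc)
    show ?thesis unfolding Pair by (simp add: tits_process_def Let_def \<phi>_def 1 3)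
  qed
  hence "\<phi> (jordan_mult ?J x x') = jordan_mult ?J' (\<phi> x) (\<phi> x')" for x x'
    by (intro jordan_mult_hom[OF lin]) (auto simp: tits_process_def Let_def \<phi>_def)
  moreover have "\<phi> ` range (\<lambda>l. (l, 0)) = range (\<lambda>l. (l, 0))"
    by (simp add: image_image \<phi>_def)
  ultimately show ?thesis unfolding L_isomorphic_def by blast
qed

section \<open>The surjection\<close>

lemma cohomologous_refl:
  assumes "c \<in> galois_cocycles aS act SUs"
  shows "(c, c) \<in> cohomologous aS act SUs"
proof -
  have "alg_norm kEs 1 = 1" using norm_scalar[of 1] by simp
  hence "1 \<in> SUs" unfolding SUs_iff by simp
  moreover have "\<forall>\<sigma>\<in>galois_group aS. 1 * c \<sigma> = c \<sigma> * act \<sigma> 1"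
  proof
    fix \<sigma> assume "\<sigma> \<in> galois_group aS"
    then interpret a: comm_ring_hom "act \<sigma>" by (rule act_hom)
    show "1 * c \<sigma> = c \<sigma> * act \<sigma> 1" by simp
  qed
  ultimately show ?thesis using assms unfolding cohomologous_def by blast
qed

lemma cohomologous_cocycles_isomorphic:
  assumes adm: "admissible aL aK bar u \<mu>" "admissible aL aK bar u' \<mu>'"
    and w: "splits u \<mu> w" "splits u' \<mu>' w'"
    and coh: "(cocycle_of w, cocycle_of w') \<in> cohomologous aS act SUs"
  shows "(tits_process aL aK lE kE bar u \<mu>, tits_process aL aK lE kE bar u' \<mu>') \<in> L_isomorphic"
proof -
  have u: "u dvd 1" "u' dvd 1" using adm by (simp_all add: admissible_def)
  obtain y where "y dvd 1 \<and> lE u = lE u' * (y * \<tau> y) \<and> \<mu> = \<mu>' * alg_norm kE y"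
    using cohomologous_splits[OF w u(1) coh] by (rule exE)
  thus ?thesis using tits_process_isomorphic[OF u] by simp
qed

text \<open>
  Each admissible pair gets a cohomology class \<open>h\<close>, and pairs with the same class give isomorphic algebras. A
  section \<open>sel\<close> of \<open>h\<close> on its image, with the default value \<open>(1, 1)\<close>, followed by the class of the
  Tits process algebra is the required map.
\<close>
theorem H1_SU_surjection:
  "\<exists>\<Phi>. \<Phi> ` H1_SU lE kE bar aS eS sE kS sK = L_isomorphism_classes aL aK lE kE bar"
proof -
  define adm where "adm p \<longleftrightarrow> admissible aL aK bar (fst p) (snd p)" for p
  define J where "J p = tits_process aL aK lE kE bar (fst p) (snd p)" for p
  define A where "A = tits_process_algebras aL aK lE kE bar"
  define R where "R = L_isomorphic \<inter> A \<times> A"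
  define C where "C = cohomologous aS act SUs"
  define Z where "Z = galois_cocycles aS act SUs"
  have A: "A = J ` Collect adm" unfolding A_def tits_process_algebras_def J_def adm_def
    by (auto simp: image_def)
  have classes: "L_isomorphism_classes aL aK lE kE bar = (\<lambda>p. R `` {J p}) ` Collect adm"
    unfolding L_isomorphism_classes_def A_def[symmetric] R_def[symmetric] quotient_def
    unfolding A by auto
  have H1: "H1_SU lE kE bar aS eS sE kS sK = (\<lambda>c. C `` {c}) ` Z"
    unfolding H1_SU_def galois_H1_def act_eq[symmetric] C_def[symmetric] Z_def[symmetric] quotient_def by auto
  have "\<forall>p\<in>Collect adm. \<exists>w. splits (fst p) (snd p) w"
    using admissible_splits by (simp add: adm_def)
  from bchoice[OF this] obtain W where W: "\<And>p. adm p \<Longrightarrow> splits (fst p) (snd p) (W p)" by blast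
  define h where "h p = C `` {cocycle_of (W p)}" for p
  have cZ: "cocycle_of (W p) \<in> Z" if "adm p" for p
    unfolding Z_def by (rule cocycle_of_cocycle[OF W[OF that]])
  have hJ: "R `` {J p} = R `` {J q}" if pq: "adm p" "adm q" and eq: "h p = h q" for p q
  proof -
    have "cocycle_of (W q) \<in> C `` {cocycle_of (W q)}"
      using cohomologous_refl cZ[OF pq(2)] unfolding C_def Z_def by simp
    hence "(cocycle_of (W p), cocycle_of (W q)) \<in> C" using eq unfolding h_def by blast
    hence iso: "(J p, J q) \<in> L_isomorphic" unfolding J_def C_def
      using cohomologous_cocycles_isomorphic W pq unfolding adm_def by blast
    have "J p \<in> A" "J q \<in> A" using pq A by auto
    thus ?thesis unfolding R_def
      using iso L_isomorphic_sym[OF iso] L_isomorphic_trans by blast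
  qed
  define p0 :: "'l \<times> 'q" where "p0 = (1, 1)"
  have p0: "adm p0" unfolding adm_def p0_def admissible_def by (simp add: norm_one)
  define sel where "sel x = (if \<exists>p. adm p \<and> h p = x then SOME p. adm p \<and> h p = x else p0)" for x
  have sel_adm: "adm (sel x)" for x
    unfolding sel_def using p0 someI_ex[of "\<lambda>p. adm p \<and> h p = x"] by auto
  have sel_h: "h (sel (h p)) = h p" if "adm p" for p
  proof -
    have ex: "\<exists>q. adm q \<and> h q = h p" using that by (intro exI[of _ p] conjI refl)
    show ?thesis unfolding sel_def if_P[OF ex] by (rule conjunct2[OF someI_ex[OF ex]])
  qed
  have "(\<lambda>x. R `` {J (sel x)}) ` H1_SU lE kE bar aS eS sE kS sK = L_isomorphism_classes aL aK lE kE bar"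
  proof
    show "(\<lambda>x. R `` {J (sel x)}) ` H1_SU lE kE bar aS eS sE kS sK \<subseteq> L_isomorphism_classes aL aK lE kE bar"
      unfolding classes using sel_adm by auto
    show "L_isomorphism_classes aL aK lE kE bar \<subseteq> (\<lambda>x. R `` {J (sel x)}) ` H1_SU lE kE bar aS eS sE kS sK"
    proof
      fix X assume "X \<in> L_isomorphism_classes aL aK lE kE bar"
      then obtain p where p: "adm p" "X = R `` {J p}" unfolding classes by blast
      have "h p \<in> H1_SU lE kE bar aS eS sE kS sK" unfolding H1 h_def using cZ[OF p(1)] by blast
      moreover have "X = R `` {J (sel (h p))}"
        unfolding p(2) by (rule hJ[OF p(1) sel_adm sel_h[OF p(1), symmetric]])
      ultimately show "X \<in> (\<lambda>x. R `` {J (sel x)}) ` H1_SU lE kE bar aS eS sE kS sK" by blast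
    qed
  qed
  thus ?thesis by (rule exI[of _ "\<lambda>x. R `` {J (sel x)}"])
qed

end

theorem theorem5p5:
  fixes aL :: "'k::field \<Rightarrow> 'l::comm_ring_1"
    and aK :: "'k \<Rightarrow> 'q::comm_ring_1"
    and bar :: "'q \<Rightarrow> 'q"
    and lE :: "'l \<Rightarrow> 'e::comm_ring_1" and kE :: "'q \<Rightarrow> 'e"
    and aS :: "'k \<Rightarrow> 's::field"
    and eS :: "'e \<Rightarrow> 'es::comm_ring_1" and sE :: "'s \<Rightarrow> 'es"
    and kS :: "'q \<Rightarrow> 'qs::comm_ring_1" and sK :: "'s \<Rightarrow> 'qs"
  assumes char: "CHAR('k) \<noteq> 2" "CHAR('k) \<noteq> 3"
    and L: "etale_algebra aL" "alg_dim aL = 3"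
    and K: "etale_algebra aK" "alg_dim aK = 2"
    and bar: "alg_automorphism aK bar" "bar \<noteq> id"
    and E: "is_tensor_product aL aK lE kE"
    and k_s: "separable_closure aS"
    and E_s: "is_tensor_product (lE \<circ> aL) aS eS sE"
    and K_s: "is_tensor_product aK aS kS sK"
  shows "\<exists>\<Phi>. \<Phi> ` H1_SU lE kE bar aS eS sE kS sK = L_isomorphism_classes aL aK lE kE bar"
proof -
  interpret tits_data aL aK bar lE kE aS eS sE kS sK
    by (rule tits_data.intro[OF char L K bar E k_s E_s K_s])
  show ?thesis by (rule H1_SU_surjection)
qed

end
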